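(* Let $q$ be a prime power and let $S$ be a matrix over the finite field $GF(q)$ with rows indexed by a finite set $V^S$ and columns indexed by a finite set $\mathcal{A}^S$. Let $J=(J_\alpha)_{\alpha\in\mathcal{A}^S}$ be real numbers with $J_\alpha\ge0$ for all $\alpha\in\mathcal{A}^S$. Let $$Z_{\mathrm{Potts}}(S;J,q)=\sum_{\sigma}\frac{1}{q^{|V^S|}}\prod_{\alpha\in\mathcal{A}^S}\exp\Big[J_\alpha\,\delta\Big(\sum_{i\in V^S}S_{i,\alpha}\sigma_i,\,0\Big)\Big],$$ where $\sigma$ ranges over all assignments of an element $\sigma_i\in GF(q)$ to each $i\in V^S$, be the partition function of the normalized Potts model of the linear matroid defined by the columns of $S$, and let $Z_{\mathrm B}(S;J,q)$ and $Z_{\mathrm{MF}}(S;J,q)$ be the Bethe and naïve mean-field partition functions of this graphical model. Then $$Z_{\mathrm{Potts}}(S;J,q)\ge Z_{\mathrm B}(S;J,q)\ge Z_{\mathrm{MF}}(S;J,q).$$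
   Context: $\delta(x,0)=1$ if $x=0$ in $GF(q)$ and $0$ otherwise. Graphical models: for a finite set $\mathcal{X}$ and a hypergraph $G=(V,\mathcal{A})$ with potentials $\phi_i:\mathcal{X}\to\mathbb{R}_{\ge0}$ ($i\in V$) and $\psi_\alpha:\mathcal{X}^{|\alpha|}\to\mathbb{R}_{\ge0}$ ($\alpha\in\mathcal{A}$), the local marginal polytope $\mathcal{T}$ is the set of nonnegative $\tau=(\tau_i(x_i),\tau_\alpha(x_\alpha))$ with $\sum_{x_i}\tau_i(x_i)=1$ for all $i\in V$ and $\sum_{x_{\alpha\setminus i}}\tau_\alpha(x_\alpha)=\tau_i(x_i)$ for all $\alpha\in\mathcal{A}$, $i\in\alpha$ and $x_i \in \mathcal{X}$. For $\tau\in\mathcal{T}$, $$\log Z_{\mathrm B}(G,\tau;\phi,\psi)=\sum_{i\in V}\sum_{x_i}\tau_i(x_i)\log\phi_i(x_i)+\sum_{\alpha\in\mathcal{A}}\sum_{x_\alpha}\tau_\alpha(x_\alpha)\log\psi_\alpha(x_\alpha)-\sum_{i\in V}\sum_{x_i}\tau_i(x_i)\log\tau_i(x_i)-\sum_{\alpha\in\mathcal{A}}\sum_{x_\alpha}\tau_\alpha(x_\alpha)\log\frac{\tau_\alpha(x_\alpha)}{\prod_{i\in\alpha}\tau_i(x_i)}$$ (with $0\log 0=0$ and the usual conventions). The Bethe partition function is $Z_{\mathrm B}(G;\phi,\psi)=\max_{\tau\in\mathcal{T}}Z_{\mathrm B}(G,\tau;\phi,\psi)$. The naïve mean-field partition function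 $Z_{\mathrm{MF}}(G;\phi,\psi)$ is the maximum of the same expression over those $\tau\in\mathcal{T}$ with $\tau_\alpha(x_\alpha)=\prod_{i\in\alpha}\tau_i(x_i)$ for all $\alpha\in\mathcal{A}$. For the normalized Potts model of $S$, $\mathcal{X}=GF(q)$ (spins $\{1,\dots,q\}$ are identified with the elements of $GF(q)$). The hypergraph has vertex set $V^S$ and one hyperedge for each column $\alpha\in\mathcal{A}^S$, consisting of the rows $i$ with $S_{i,\alpha}\ne0$ (distinct columns are distinct hyperedges even if they have the same support). The potentials are $\psi_\alpha(\sigma_\alpha)=\exp[J_\alpha\delta(\sum_{i\in\alpha}S_{i,\alpha}\sigma_i,0)]$ and $\phi_i\equiv 1/q$ (these constants account for the normalizing factor $1/q^{|V^S|}$).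
   Formalization: For a zero column of S (empty hyperedge), the local marginal polytope additionally requires τ_α to sum to 1; without this the inequality Z_Potts ≥ Z_B fails (e.g. V^S empty, one column, J=0). For nonempty hyperedges this condition already follows from the others. *)

theory Defs
  imports Complex_Main "HOL-Library.FuncSet" "HOL-Library.Cardinality"
begin

section \<open>Graphical models on hypergraphs\<close>

text \<open>
  A hypergraph has a finite vertex set \<open>V\<close>, a finite index set \<open>A\<close> of hyperedges, and a map \<open>edge\<close>
  giving the vertices of each hyperedge.  Indexing allows distinct hyperedges with the same vertices.
  The finite type \<open>'x\<close> is the alphabet; a configuration on a set of vertices is an extensional function.
\<close>

definition configs :: "'v set \<Rightarrow> ('v \<Rightarrow> 'x::finite) set" where
  "configs U = (U \<rightarrow>\<^sub>E UNIV)"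

text \<open>
  A point of the polytope is a pair of the vertex and the hyperedge pseudomarginals; only their values
  on \<open>V\<close>, \<open>A\<close> and \<open>configs (edge \<alpha>)\<close> matter.  The normalisation of \<open>\<tau>\<^sub>\<alpha>\<close> follows from the other
  conditions whenever \<open>edge \<alpha>\<close> is nonempty (lemma \<open>edge_normalization_redundant\<close> below).  It is stated
  for the sake of empty hyperedges (zero columns of a matrix), for which marginalisation imposes
  nothing; \<open>\<tau>\<^sub>\<alpha>\<close> is then the trivial distribution on the single empty configuration.
\<close>

definition local_marginal_polytope ::
  "'v set \<Rightarrow> 'a set \<Rightarrow> ('a \<Rightarrow> 'v set)
    \<Rightarrow> (('v \<Rightarrow> 'x::finite \<Rightarrow> real) \<times> ('a \<Rightarrow> ('v \<Rightarrow> 'x) \<Rightarrow> real)) set" where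
  "local_marginal_polytope V A edge = {(\<tau>v, \<tau>e).
     (\<forall>i\<in>V. \<forall>x. 0 \<le> \<tau>v i x) \<and>
     (\<forall>\<alpha>\<in>A. \<forall>x\<in>configs (edge \<alpha>). 0 \<le> \<tau>e \<alpha> x) \<and>
     (\<forall>i\<in>V. (\<Sum>x\<in>UNIV. \<tau>v i x) = 1) \<and>
     (\<forall>\<alpha>\<in>A. (\<Sum>x\<in>configs (edge \<alpha>). \<tau>e \<alpha> x) = 1) \<and>
     (\<forall>\<alpha>\<in>A. \<forall>i\<in>edge \<alpha>. \<forall>y. (\<Sum>x\<in>{x \<in> configs (edge \<alpha>). x i = y}. \<tau>e \<alpha> x) = \<tau>v i y)}"

lemma edge_normalization_redundant:
  fixes \<tau>v :: "'v \<Rightarrow> 'x::finite \<Rightarrow> real" and \<tau>e :: "'a \<Rightarrow> ('v \<Rightarrow> 'x) \<Rightarrow> real"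
  assumes "finite (edge \<alpha>)" and "i \<in> edge \<alpha>" and "(\<Sum>x\<in>UNIV. \<tau>v i x) = 1"
    and "\<And>y. (\<Sum>x\<in>{x \<in> configs (edge \<alpha>). x i = y}. \<tau>e \<alpha> x) = \<tau>v i y"
  shows "(\<Sum>x\<in>configs (edge \<alpha>). \<tau>e \<alpha> x) = 1"
proof -
  have "finite (configs (edge \<alpha>) :: ('v \<Rightarrow> 'x) set)"
    unfolding configs_def using assms(1) by (intro finite_PiE) auto
  then have "(\<Sum>y\<in>UNIV. \<Sum>x\<in>{x \<in> configs (edge \<alpha>). x i = y}. \<tau>e \<alpha> x)
      = (\<Sum>x\<in>configs (edge \<alpha>). \<tau>e \<alpha> x)"
    by (intro sum.group) auto
  then show ?thesis using assms(3,4) by simp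
qed

text \<open>
  Here \<open>0 log 0 = 0\<close> holds because of the factor \<open>0\<close>, and \<open>\<tau>\<^sub>\<alpha>(x) = 0\<close> whenever the product of the
  vertex marginals vanishes.  The remaining convention, \<open>\<tau> log 0 = - \<infinity>\<close> for \<open>\<tau> > 0\<close> and a
  vanishing potential, is accounted for in \<open>bethe_value\<close>, since \<open>ln 0 = 0\<close> in the library.
\<close>

definition log_bethe_value ::
  "'v set \<Rightarrow> 'a set \<Rightarrow> ('a \<Rightarrow> 'v set) \<Rightarrow> ('v \<Rightarrow> 'x::finite \<Rightarrow> real) \<Rightarrow> ('a \<Rightarrow> ('v \<Rightarrow> 'x) \<Rightarrow> real)
    \<Rightarrow> ('v \<Rightarrow> 'x \<Rightarrow> real) \<times> ('a \<Rightarrow> ('v \<Rightarrow> 'x) \<Rightarrow> real) \<Rightarrow> real" where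
  "log_bethe_value V A edge \<phi> \<psi> = (\<lambda>(\<tau>v, \<tau>e).
     (\<Sum>i\<in>V. \<Sum>x\<in>UNIV. \<tau>v i x * ln (\<phi> i x))
     + (\<Sum>\<alpha>\<in>A. \<Sum>x\<in>configs (edge \<alpha>). \<tau>e \<alpha> x * ln (\<psi> \<alpha> x))
     - (\<Sum>i\<in>V. \<Sum>x\<in>UNIV. \<tau>v i x * ln (\<tau>v i x))
     - (\<Sum>\<alpha>\<in>A. \<Sum>x\<in>configs (edge \<alpha>). \<tau>e \<alpha> x * ln (\<tau>e \<alpha> x / (\<Prod>i\<in>edge \<alpha>. \<tau>v i (x i)))))"

definition bethe_value ::
  "'v set \<Rightarrow> 'a set \<Rightarrow> ('a \<Rightarrow> 'v set) \<Rightarrow> ('v \<Rightarrow> 'x::finite \<Rightarrow> real) \<Rightarrow> ('a \<Rightarrow> ('v \<Rightarrow> 'x) \<Rightarrow> real)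
    \<Rightarrow> ('v \<Rightarrow> 'x \<Rightarrow> real) \<times> ('a \<Rightarrow> ('v \<Rightarrow> 'x) \<Rightarrow> real) \<Rightarrow> real" where
  "bethe_value V A edge \<phi> \<psi> \<tau> =
     (if (\<exists>i\<in>V. \<exists>x. fst \<tau> i x > 0 \<and> \<phi> i x = 0)
       \<or> (\<exists>\<alpha>\<in>A. \<exists>x\<in>configs (edge \<alpha>). snd \<tau> \<alpha> x > 0 \<and> \<psi> \<alpha> x = 0)
      then 0 else exp (log_bethe_value V A edge \<phi> \<psi> \<tau>))"

text \<open>\<open>GREATEST\<close> denotes an attained maximum.\<close>

definition bethe_partition_function ::
  "'v set \<Rightarrow> 'a set \<Rightarrow> ('a \<Rightarrow> 'v set) \<Rightarrow> ('v \<Rightarrow> 'x::finite \<Rightarrow> real) \<Rightarrow> ('a \<Rightarrow> ('v \<Rightarrow> 'x) \<Rightarrow> real)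
    \<Rightarrow> real" where
  "bethe_partition_function V A edge \<phi> \<psi> =
     (GREATEST z. \<exists>\<tau>\<in>local_marginal_polytope V A edge. z = bethe_value V A edge \<phi> \<psi> \<tau>)"

definition mean_field_points ::
  "'v set \<Rightarrow> 'a set \<Rightarrow> ('a \<Rightarrow> 'v set)
    \<Rightarrow> (('v \<Rightarrow> 'x::finite \<Rightarrow> real) \<times> ('a \<Rightarrow> ('v \<Rightarrow> 'x) \<Rightarrow> real)) set" where
  "mean_field_points V A edge = {\<tau> \<in> local_marginal_polytope V A edge.
     \<forall>\<alpha>\<in>A. \<forall>x\<in>configs (edge \<alpha>). snd \<tau> \<alpha> x = (\<Prod>i\<in>edge \<alpha>. fst \<tau> i (x i))}"

definition mean_field_partition_function ::
  "'v set \<Rightarrow> 'a set \<Rightarrow> ('a \<Rightarrow> 'v set) \<Rightarrow> ('v \<Rightarrow> 'x::finite \<Rightarrow> real) \<Rightarrow> ('a \<Rightarrow> ('v \<Rightarrow> 'x) \<Rightarrow> real)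
    \<Rightarrow> real" where
  "mean_field_partition_function V A edge \<phi> \<psi> =
     (GREATEST z. \<exists>\<tau>\<in>mean_field_points V A edge. z = bethe_value V A edge \<phi> \<psi> \<tau>)"

section \<open>The normalized Potts model of a matrix over a finite field\<close>

text \<open>
  \<open>S i \<alpha>\<close> is the entry in row \<open>i \<in> V\<close> and column \<open>\<alpha> \<in> A\<close>; the finite field is the type \<open>'k\<close>, and
  \<open>q = CARD('k)\<close>.
\<close>

definition delta0 :: "'k::zero \<Rightarrow> real" where
  "delta0 x = (if x = 0 then 1 else 0)"

definition potts_partition_function ::
  "'v set \<Rightarrow> 'a set \<Rightarrow> ('v \<Rightarrow> 'a \<Rightarrow> 'k::{field,finite}) \<Rightarrow> ('a \<Rightarrow> real) \<Rightarrow> real" where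
  "potts_partition_function V A S J =
     (\<Sum>\<sigma>\<in>configs V. 1 / real CARD('k) ^ card V *
        (\<Prod>\<alpha>\<in>A. exp (J \<alpha> * delta0 (\<Sum>i\<in>V. S i \<alpha> * \<sigma> i))))"

definition potts_edge :: "'v set \<Rightarrow> ('v \<Rightarrow> 'a \<Rightarrow> 'k::{field,finite}) \<Rightarrow> 'a \<Rightarrow> 'v set" where
  "potts_edge V S \<alpha> = {i \<in> V. S i \<alpha> \<noteq> 0}"

definition potts_phi :: "'v \<Rightarrow> 'k::{field,finite} \<Rightarrow> real" where
  "potts_phi i x = 1 / real CARD('k)"

definition potts_psi ::
  "'v set \<Rightarrow> ('v \<Rightarrow> 'a \<Rightarrow> 'k::{field,finite}) \<Rightarrow> ('a \<Rightarrow> real) \<Rightarrow> 'a \<Rightarrow> ('v \<Rightarrow> 'k) \<Rightarrow> real" where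
  "potts_psi V S J \<alpha> \<sigma> = exp (J \<alpha> * delta0 (\<Sum>i\<in>potts_edge V S \<alpha>. S i \<alpha> * \<sigma> i))"

definition potts_bethe ::
  "'v set \<Rightarrow> 'a set \<Rightarrow> ('v \<Rightarrow> 'a \<Rightarrow> 'k::{field,finite}) \<Rightarrow> ('a \<Rightarrow> real) \<Rightarrow> real" where
  "potts_bethe V A S J =
     bethe_partition_function V A (potts_edge V S) potts_phi (potts_psi V S J)"

definition potts_mean_field ::
  "'v set \<Rightarrow> 'a set \<Rightarrow> ('v \<Rightarrow> 'a \<Rightarrow> 'k::{field,finite}) \<Rightarrow> ('a \<Rightarrow> real) \<Rightarrow> real" where
  "potts_mean_field V A S J =
     mean_field_partition_function V A (potts_edge V S) potts_phi (potts_psi V S J)"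

end

theory Submission
  imports Defs "HOL-Analysis.Analysis" "HOL-Combinatorics.Multiset_Permutations"
begin

text \<open>
  Expanding \<open>exp (J \<delta>) = 1 + (exp J - 1) \<delta>\<close> turns the Potts partition function \<open>Z\<close> into a sum over
  sets \<open>B\<close> of columns, with weight the probability that a uniform \<open>\<sigma>\<close> is annihilated by all forms in
  \<open>B\<close>; this probability is log-supermodular in \<open>B\<close>.  An \<open>M\<close>-cover replaces every row and column by
  \<open>M\<close> copies, joined by permutations.  By the method of types, the average of the partition functions
  of all \<open>M\<close>-covers is at least \<open>exp (M F(\<tau>))\<close>, up to a polynomial factor in \<open>M\<close>, for every rational
  point \<open>\<tau>\<close> of the local marginal polytope, where \<open>F\<close> is the logarithm of the Bethe functional.  An
  inequality in the spirit of Ahlswede and Daykin bounds the partition function of a single cover by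
  \<open>Z ^ M\<close> times a defect, which measures the dependence among the lifts of independent columns.  A
  single cover may well have a large defect, but its average is polynomial in \<open>M\<close>: independent columns
  have a transversal of rows, and a random rearrangement of a sequence hits a given one with
  probability at most the reciprocal of the size of its type class.  Letting \<open>M\<close> tend to infinity
  gives \<open>F(\<tau>) \<le> ln Z\<close>, first for rational \<open>\<tau>\<close>, then for all \<open>\<tau>\<close> by density.
\<close>

section \<open>Sums of log-supermodular set functions\<close>

text \<open>For two copies a set of lifted columns is a pair (X, Y) of sets of columns with levels X
  \<union> Y and X \<inter> Y; bounding \<open>g\<close> by the product of \<open>f\<close> over the
  levels has the shape of the Ahlswede-Daykin hypothesis, with \<open>g\<close> in place of a
  product. For \<open>M\<close> copies the levels sort the copies of each column, and one basis
  adapted to all levels at once compares the lift with \<open>M\<close> unlinked copies of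
  \<open>S\<close>. The obstacle is that lifting can create dependences. For odd q the forms x1 +
  x2, x2 + x3, x3 + x1 are independent, but a double cover joining two triangles to a hexagon has an
  alternating solution. If every independent set lifted to an independent one, the defect would be
  at most \<open>2 ^ card A\<close>, which is harmless for growing \<open>M\<close>. A transversal
  turns independence into one constraint per column on a random rearrangement, each on a row of its
  own. Only exponential growth in \<open>M\<close> is compared, so crude bounds for factorials and
  for the number of types are enough.\<close>

definition log_supermodular_on :: "'e set \<Rightarrow> ('e set \<Rightarrow> real) \<Rightarrow> bool" where
  "log_supermodular_on U f \<longleftrightarrow> (\<forall>X Y. X \<subseteq> U \<longrightarrow> Y \<subseteq> U \<longrightarrow> f X * f Y \<le> f (X \<union> Y) * f (X \<inter> Y))"

lemma log_supermodular_onD: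
  "log_supermodular_on U f \<Longrightarrow> X \<subseteq> U \<Longrightarrow> Y \<subseteq> U \<Longrightarrow> f X * f Y \<le> f (X \<union> Y) * f (X \<inter> Y)"
  unfolding log_supermodular_on_def by blast

text \<open>Expanding \<open>(c - a) * (c - b) \<ge> 0\<close> and bounding \<open>a * b\<close> by
  \<open>c * d\<close> gives \<open>c * (a + b) \<le> c * (c + d)\<close>. This is the numerical
  core of the four functions inequality: two terms dominated by \<open>c\<close> one at a time and
  by \<open>c * d\<close> in product.\<close>

lemma add_mult_add_le:
  fixes a b c d :: real
  assumes "a \<le> c" "b \<le> c" "a * b \<le> c * d" "0 < c"
  shows "a + b \<le> c + d"
proof -
  have "0 \<le> (c - a) * (c - b)" using assms by simp
  then have "c * (a + b) \<le> c * c + a * b" by (simp add: algebra_simps)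
  also have "\<dots> \<le> c * (c + d)" using assms by (simp add: algebra_simps)
  finally show ?thesis using assms by simp
qed

text \<open>After multiplying out, the products with \<open>e\<close> in both factors or in neither
  are compared directly. The two mixed ones are only comparable jointly: each is at most
  \<open>f (insert e (X \<union> Y)) * f (X \<inter> Y)\<close>, and their product is at most the
  product of the two mixed terms on the right.\<close>

lemma log_supermodular_on_marginal1:
  assumes lsm: "log_supermodular_on (insert e U) f" and e: "e \<notin> U"
    and pos: "\<And>X. X \<subseteq> insert e U \<Longrightarrow> 0 < f X"
  shows "log_supermodular_on U (\<lambda>X. f X + f (insert e X))"
  unfolding log_supermodular_on_def
proof (intro allI impI)
  fix X Y assume XY: "X \<subseteq> U" "Y \<subseteq> U"
  note D = log_supermodular_onD[OF lsm]
  have e': "e \<notin> X" "e \<notin> Y" using XY e by auto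
  have 1: "f X * f Y \<le> f (X \<union> Y) * f (X \<inter> Y)" using D[of X Y] XY by auto
  have 2: "f (insert e X) * f (insert e Y) \<le> f (insert e (X \<union> Y)) * f (insert e (X \<inter> Y))"
    using D[of "insert e X" "insert e Y"] XY by (simp add: insert_mono subset_insertI2) 
  have 3: "f (insert e X) * f Y \<le> f (insert e (X \<union> Y)) * f (X \<inter> Y)"
    using D[of "insert e X" "Y"] XY e' by (simp add: insert_mono subset_insertI2 Int_insert_left) 
  have 4: "f X * f (insert e Y) \<le> f (insert e (X \<union> Y)) * f (X \<inter> Y)"
    using D[of X "insert e Y"] XY e' by (simp add: insert_mono subset_insertI2 Int_insert_right) 
  have p: "0 < f Z" "0 < f (insert e Z)" if "Z \<subseteq> U" for Z using pos that by blast+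
  have pp: "0 < f (X \<union> Y)" "0 < f (X \<inter> Y)" "0 < f (insert e (X \<union> Y))" "0 < f (insert e (X \<inter> Y))"
    "0 < f X" "0 < f Y" "0 < f (insert e X)" "0 < f (insert e Y)"
    using p[of "X \<union> Y"] p[of "X \<inter> Y"] p[of X] p[of Y] XY by auto
  have "(f (insert e X) * f Y) * (f X * f (insert e Y))
      = (f (insert e X) * f (insert e Y)) * (f X * f Y)" by (simp add: algebra_simps)
  also have "\<dots> \<le> (f (insert e (X \<union> Y)) * f (insert e (X \<inter> Y))) * (f (X \<union> Y) * f (X \<inter> Y))"
    using pp by (intro mult_mono[OF 2 1]) auto
  finally have 5: "(f (insert e X) * f Y) * (f X * f (insert e Y))
      \<le> (f (insert e (X \<union> Y)) * f (X \<inter> Y)) * (f (X \<union> Y) * f (insert e (X \<inter> Y)))"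
    by (simp add: algebra_simps)
  have 6: "f (insert e X) * f Y + f X * f (insert e Y)
      \<le> f (insert e (X \<union> Y)) * f (X \<inter> Y) + f (X \<union> Y) * f (insert e (X \<inter> Y))"
    by (rule add_mult_add_le[OF 3 4 5]) (use pp in simp)
  show "(f X + f (insert e X)) * (f Y + f (insert e Y))
      \<le> (f (X \<union> Y) + f (insert e (X \<union> Y))) * (f (X \<inter> Y) + f (insert e (X \<inter> Y)))"
    using 1 2 6 by (simp add: algebra_simps)
qed

lemma sum_Pow_insert:
  fixes f :: "'e set \<Rightarrow> real"
  assumes "finite A" "a \<notin> A"
  shows "(\<Sum>X\<in>Pow (insert a A). f X) = (\<Sum>X\<in>Pow A. f X + f (insert a X))"
proof -
  have inj: "inj_on (insert a) (Pow A)" using assms by (auto intro!: inj_onI)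
  have "(\<Sum>X\<in>Pow (insert a A). f X) = (\<Sum>X\<in>Pow A. f X) + (\<Sum>X\<in>insert a ` Pow A. f X)"
    unfolding Pow_insert using assms by (intro sum.union_disjoint) auto
  then show ?thesis by (simp add: sum.reindex[OF inj] sum.distrib)
qed

lemma sum_Pow_union:
  fixes f :: "'e set \<Rightarrow> real"
  assumes "finite W" "U \<inter> W = {}"
  shows "(\<Sum>Y\<in>Pow (U \<union> W). f Y) = (\<Sum>X\<in>Pow U. \<Sum>T\<in>Pow W. f (X \<union> T))"
proof -
  have inj: "inj_on (\<lambda>(X, T). X \<union> T) (Pow U \<times> Pow W)"
  proof (rule inj_onI, clarify)
    fix X T X' T' assume "X \<subseteq> U" "T \<subseteq> W" "X' \<subseteq> U" "T' \<subseteq> W" "X \<union> T = X' \<union> T'"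
    then have "X = (X \<union> T) \<inter> U" "T = (X \<union> T) \<inter> W" "X' = (X \<union> T) \<inter> U" "T' = (X \<union> T) \<inter> W"
      using assms(2) by auto
    then show "X = X' \<and> T = T'" by simp
  qed
  have im: "Pow (U \<union> W) = (\<lambda>(X, T). X \<union> T) ` (Pow U \<times> Pow W)"
  proof (intro equalityI subsetI)
    fix Y assume "Y \<in> Pow (U \<union> W)"
    then have "Y = (\<lambda>(X, T). X \<union> T) (Y \<inter> U, Y \<inter> W)" by auto
    then show "Y \<in> (\<lambda>(X, T). X \<union> T) ` (Pow U \<times> Pow W)" by blast
  qed auto
  show ?thesis unfolding im sum.reindex[OF inj] by (simp add: sum.cartesian_product case_prod_unfold)
qed

lemma log_supermodular_on_marginal:
  assumes "finite W" "U \<inter> W = {}" "log_supermodular_on (U \<union> W) f"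
    and "\<And>X. X \<subseteq> U \<union> W \<Longrightarrow> 0 < f X"
  shows "log_supermodular_on U (\<lambda>X. \<Sum>T\<in>Pow W. f (X \<union> T))"
  using assms
proof (induction W arbitrary: f)
  case empty
  then show ?case by simp
next
  case (insert w W)
  define g where "g X = f X + f (insert w X)" for X
  have "log_supermodular_on (U \<union> W) g"
    unfolding g_def using insert by (intro log_supermodular_on_marginal1) auto
  moreover have "0 < g X" if "X \<subseteq> U \<union> W" for X
    unfolding g_def by (intro add_pos_pos insert.prems(3)) (use that in auto)
  ultimately have "log_supermodular_on U (\<lambda>X. \<Sum>T\<in>Pow W. g (X \<union> T))"
    using insert by (intro insert.IH) auto
  moreover have "(\<Sum>T\<in>Pow (insert w W). f (X \<union> T)) = (\<Sum>T\<in>Pow W. g (X \<union> T))" for X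
    unfolding g_def using insert by (subst sum_Pow_insert) auto
  ultimately show ?case by simp
qed

text \<open>Summation by parts. With \<open>D = G - \<gamma>\<close>, the left side minus the right
  side is a combination of the values \<open>D k\<close> with coefficients \<open>1 - p 0\<close>,
  then the drops \<open>p (k - 1) - p k\<close>, and finally the last value of \<open>p\<close>. All
  of these are nonnegative, while \<open>D\<close> is nonpositive.\<close>

lemma sum_le_sum_of_antimono:
  fixes G \<gamma> p :: "nat \<Rightarrow> real"
  assumes le: "\<And>k. k \<le> n \<Longrightarrow> G k \<le> \<gamma> k"
    and anti: "\<And>j k. j \<le> k \<Longrightarrow> k < n \<Longrightarrow> p k \<le> p j"
    and p01: "\<And>k. k < n \<Longrightarrow> 0 \<le> p k \<and> p k \<le> 1"
  shows "G 0 + (\<Sum>k<n. p k * (G (Suc k) - G k)) \<le> \<gamma> 0 + (\<Sum>k<n. p k * (\<gamma> (Suc k) - \<gamma> k))"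
proof -
  define D where "D k = G k - \<gamma> k" for k
  have D: "D k \<le> 0" if "k \<le> n" for k using le[OF that] by (simp add: D_def)
  define P where "P k = (if k = 0 then 1 else p (k - 1))" for k :: nat
  have "D 0 + (\<Sum>k<m. p k * (D (Suc k) - D k)) \<le> P m * D m" if "m \<le> n" for m
    using that
  proof (induction m)
    case 0 then show ?case by (simp add: P_def)
  next
    case (Suc m)
    have "p m \<le> P m" using Suc anti[of "m-1" m] p01[of m] by (auto simp: P_def)
    then have "P m * D m \<le> p m * D m" using D[of m] Suc by (intro mult_right_mono_neg) auto
    then show ?case using Suc by (simp add: P_def algebra_simps)
  qed
  from this[of n] have "D 0 + (\<Sum>k<n. p k * (D (Suc k) - D k)) \<le> P n * D n" by simp
  also have "\<dots> \<le> 0" using D[of n] p01[of "n-1"] by (cases n) (auto simp: P_def mult_le_0_iff)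
  finally show ?thesis unfolding D_def by (simp add: algebra_simps sum_subtractf sum.distrib)
qed

lemma sorted_enumeration:
  fixes p :: "nat \<Rightarrow> real"
  obtains e where "bij_betw e {..<M} {..<M}" "\<And>j k. j \<le> k \<Longrightarrow> k < M \<Longrightarrow> p (e k) \<le> p (e j)"
proof -
  define xs where "xs = sort_key (\<lambda>i. - p i) [0..<M]"
  have len: "length xs = M" and d: "distinct xs" and s: "set xs = {..<M}"
    by (auto simp: xs_def)
  have "bij_betw (\<lambda>k. xs ! k) {..<M} {..<M}"
    by (rule bij_betw_nth[OF d]) (simp_all only: len s)
  moreover have "p (xs ! k) \<le> p (xs ! j)" if "j \<le> k" "k < M" for j k
  proof -
    have "sorted (map (\<lambda>i. - p i) xs)" by (simp add: xs_def)
    from sorted_nth_mono[OF this that(1)] that len show ?thesis by simp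
  qed
  ultimately show thesis by (rule that)
qed

text \<open>
  A supermodular function is dominated by the modular function of its increments along any chain;
  for the chain ordered by the marginals of the normalised \<open>F\<close>, this bound only involves the values
  of \<open>F\<close> on one set of each cardinality.
\<close>

lemma sum_Pow_le_prod_of_card_bound:
  fixes F :: "nat set \<Rightarrow> real"
  assumes lsm: "log_supermodular_on {..<M} F"
    and pos: "\<And>T. T \<subseteq> {..<M} \<Longrightarrow> 0 < F T"
    and ab: "\<And>k. k < M \<Longrightarrow> 0 < a k \<and> 0 < b k"
    and bound: "\<And>T. T \<subseteq> {..<M} \<Longrightarrow> F T \<le> (\<Prod>k<M. if k < card T then b k else a k)"
  shows "(\<Sum>T\<in>Pow {..<M}. F T) \<le> (\<Prod>k<M. a k + b k)"
proof -
  define Z where "Z = (\<Sum>T\<in>Pow {..<M}. F T)"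
  have Z: "0 < Z" unfolding Z_def by (intro sum_pos pos) auto
  define P where "P T = F T / Z" for T
  have P: "0 < P T" if "T \<subseteq> {..<M}" for T using pos[OF that] Z by (simp add: P_def)
  have Pnn: "0 \<le> P T" if "T \<subseteq> {..<M}" for T using P[OF that] by simp
  have P1: "(\<Sum>T\<in>Pow {..<M}. P T) = 1"
    using Z by (simp add: P_def Z_def flip: sum_divide_distrib)
  define p where "p i = (\<Sum>T\<in>Pow {..<M}. if i \<in> T then P T else 0)" for i
  obtain e where e: "bij_betw e {..<M} {..<M}"
    and anti: "\<And>j k. j \<le> k \<Longrightarrow> k < M \<Longrightarrow> p (e k) \<le> p (e j)"
    using sorted_enumeration[of M p] by blast
  have eM: "e k < M" if "k < M" for k using e that by (auto simp: bij_betw_def)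
  have einj: "e j = e k \<longleftrightarrow> j = k" if "j < M" "k < M" for j k
    using e that by (auto simp: bij_betw_def inj_on_def)
  \<comment> \<open>The chain adds elements in the order of decreasing marginals. This order allows
    the increments of \<open>G\<close> along the chain to be exchanged for those of
    \<open>\<gamma>\<close>.\<close>
  define C where "C k = e ` {..<k}" for k
  have CM: "C k \<subseteq> {..<M}" if "k \<le> M" for k using eM that by (auto simp: C_def)
  have eC: "e k \<in> C j \<longleftrightarrow> k < j" if "j \<le> M" "k < M" for j k
    using einj that by (auto simp: C_def image_iff)
  have C_all: "C M = {..<M}" using e by (simp add: C_def bij_betw_def)
  define G where "G k = ln (F (C k))" for k
  \<comment> \<open>The logarithm of the assumed bound for sets of cardinality
    \<open>j\<close>.\<close>
  define \<gamma> where "\<gamma> j = (\<Sum>k<M. if k < j then ln (b k) else ln (a k))" for j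
  have cardC: "card (C k) = k" if "k \<le> M" for k
    unfolding C_def using e that by (subst card_image) (auto simp: bij_betw_def inj_on_def)
  have ab0: "a k \<noteq> 0" "b k \<noteq> 0" if "k < M" for k using ab[OF that] by auto
  have G\<gamma>: "G k \<le> \<gamma> k" if k: "k \<le> M" for k
  proof -
    have "G k \<le> ln (\<Prod>j<M. if j < k then b j else a j)"
      unfolding G_def using bound[OF CM[OF k]] pos[OF CM[OF k]] cardC[OF k] ab
      by (subst ln_le_cancel_iff) (auto intro!: prod_pos)
    also have "\<dots> = \<gamma> k" unfolding \<gamma>_def using ab ab0 by (subst ln_prod) (auto intro!: sum.cong split: if_splits)
    finally show ?thesis .
  qed
  \<comment> \<open>Adding \<open>e n\<close> to \<open>T \<inter> C n\<close> raises
    \<open>ln F\<close> by at most as much as adding it to the larger set \<open>C n\<close>.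
    Telescoping leaves values of \<open>F\<close> on the chain only.\<close>
  have up: "ln (F T) \<le> G 0 + (\<Sum>k<M. if e k \<in> T then G (Suc k) - G k else 0)"
    if T: "T \<subseteq> {..<M}" for T
  proof -
    have "ln (F (T \<inter> C n)) \<le> G 0 + (\<Sum>k<n. if e k \<in> T then G (Suc k) - G k else 0)"
      if "n \<le> M" for n
      using that
    proof (induction n)
      case 0 then show ?case by (simp add: G_def C_def)
    next
      case (Suc n)
      then have IH: "ln (F (T \<inter> C n)) \<le> G 0 + (\<Sum>k<n. if e k \<in> T then G (Suc k) - G k else 0)"
        by simp
      have Cs: "C (Suc n) = insert (e n) (C n)" by (simp add: C_def lessThan_Suc)
      show ?case
      proof (cases "e n \<in> T")
        case False
        then have "T \<inter> C (Suc n) = T \<inter> C n" using Cs by auto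
        then show ?thesis using IH False by simp
      next
        case True
        have nin: "e n \<notin> C n" using eC[of n n] Suc by simp
        have u: "T \<inter> C (Suc n) \<union> C n = C (Suc n)" using True Cs by auto
        have i: "T \<inter> C (Suc n) \<inter> C n = T \<inter> C n" using nin Cs by auto
        have s: "T \<inter> C (Suc n) \<subseteq> {..<M}" "C n \<subseteq> {..<M}" "C (Suc n) \<subseteq> {..<M}" "T \<inter> C n \<subseteq> {..<M}"
          using T CM Suc by auto
        have "F (T \<inter> C (Suc n)) * F (C n) \<le> F (C (Suc n)) * F (T \<inter> C n)"
          using log_supermodular_onD[OF lsm s(1,2)] by (simp add: u i)
        then have "ln (F (T \<inter> C (Suc n)) * F (C n)) \<le> ln (F (C (Suc n)) * F (T \<inter> C n))"
          using pos s by (subst ln_le_cancel_iff) (auto intro!: mult_pos_pos)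
        then have "ln (F (T \<inter> C (Suc n))) + G n \<le> G (Suc n) + ln (F (T \<inter> C n))"
          using pos s by (simp add: ln_mult G_def less_imp_neq[symmetric])
        then show ?thesis using IH True by simp
      qed
    qed
    from this[of M] show ?thesis using T C_all by (simp add: Int_absorb2)
  qed
  have p01: "0 \<le> p i \<and> p i \<le> 1" for i
  proof
    show "0 \<le> p i" unfolding p_def using Pnn by (intro sum_nonneg) auto
    have "p i \<le> (\<Sum>T\<in>Pow {..<M}. P T)" unfolding p_def using Pnn by (intro sum_mono) auto
    then show "p i \<le> 1" using P1 by simp
  qed
  \<comment> \<open>The unnormalised product measure in which the k-th element of the chain has
    weight \<open>b k\<close> if present and \<open>a k\<close> if absent. Its total mass is the
    asserted bound, and its logarithm is the modular function reached by the exchange of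
    increments.\<close>
  define Q where "Q T = (\<Prod>k<M. if e k \<in> T then b k else a k)" for T
  have Q: "0 < Q T" for T unfolding Q_def using ab by (auto intro!: prod_pos)
  have lnQ: "ln (Q T) = (\<Sum>k<M. if e k \<in> T then ln (b k) else ln (a k))" for T
    unfolding Q_def using ab ab0 by (subst ln_prod) (auto intro!: sum.cong split: if_splits)
  have expect: "(\<Sum>T\<in>Pow {..<M}. P T * (c + (\<Sum>k<M. if e k \<in> T then d k else 0)))
      = c + (\<Sum>k<M. p (e k) * d k)" for c and d :: "nat \<Rightarrow> real"
  proof -
    have "(\<Sum>T\<in>Pow {..<M}. P T * (\<Sum>k<M. if e k \<in> T then d k else 0))
        = (\<Sum>k<M. \<Sum>T\<in>Pow {..<M}. P T * (if e k \<in> T then d k else 0))"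
      by (subst sum.swap) (simp add: sum_distrib_left)
    also have "\<dots> = (\<Sum>k<M. p (e k) * d k)"
      unfolding p_def by (intro sum.cong refl) (auto simp: sum_distrib_right intro!: sum.cong)
    finally show ?thesis using P1 by (simp add: distrib_left sum.distrib flip: sum_distrib_right)
  qed
  have "(\<Sum>T\<in>Pow {..<M}. P T * ln (F T))
      \<le> (\<Sum>T\<in>Pow {..<M}. P T * (G 0 + (\<Sum>k<M. if e k \<in> T then G (Suc k) - G k else 0)))"
    using up Pnn by (intro sum_mono mult_left_mono) auto
  also have "\<dots> = G 0 + (\<Sum>k<M. p (e k) * (G (Suc k) - G k))" by (rule expect)
  also have "\<dots> \<le> \<gamma> 0 + (\<Sum>k<M. p (e k) * (\<gamma> (Suc k) - \<gamma> k))"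
    by (rule sum_le_sum_of_antimono) (use G\<gamma> anti p01 in auto)
  also have "\<dots> = \<gamma> 0 + (\<Sum>k<M. p (e k) * (ln (b k) - ln (a k)))"
  proof -
    have "\<gamma> (Suc k) - \<gamma> k = ln (b k) - ln (a k)" if "k < M" for k
    proof -
      have "\<gamma> (Suc k) - \<gamma> k = (\<Sum>j<M. if j = k then ln (b k) - ln (a k) else 0)"
        unfolding \<gamma>_def sum_subtractf[symmetric] by (intro sum.cong) auto
      then show ?thesis using that by simp
    qed
    then show ?thesis by simp
  qed
  also have "\<dots> = (\<Sum>T\<in>Pow {..<M}. P T * ln (Q T))"
  proof -
    have "ln (Q T) = \<gamma> 0 + (\<Sum>k<M. if e k \<in> T then ln (b k) - ln (a k) else 0)" for T
      unfolding lnQ \<gamma>_def sum.distrib[symmetric] by (intro sum.cong) auto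
    then show ?thesis by (simp add: expect)
  qed
  finally have E: "(\<Sum>T\<in>Pow {..<M}. P T * ln (F T)) \<le> (\<Sum>T\<in>Pow {..<M}. P T * ln (Q T))" .
  define W where "W = (\<Prod>k<M. a k + b k)"
  have W: "0 < W" unfolding W_def using ab by (auto intro!: prod_pos add_pos_pos)
  have QW: "(\<Sum>T\<in>Pow {..<M}. Q T) = W"
  proof -
    have "bij_betw ((`) e) (Pow {..<M}) (Pow {..<M})" using bij_betw_Pow[OF e] .
    then have "(\<Sum>T\<in>Pow {..<M}. Q T) = (\<Sum>S\<in>Pow {..<M}. Q (e ` S))"
      by (rule sum.reindex_bij_betw[symmetric])
    also have "\<dots> = (\<Sum>S\<in>Pow {..<M}. prod b S * prod a ({..<M} - S))"
    proof (intro sum.cong refl)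
      fix S assume S: "S \<in> Pow {..<M}"
      have "Q (e ` S) = (\<Prod>k<M. if k \<in> S then b k else a k)"
        unfolding Q_def using S einj by (intro prod.cong) (auto simp: image_iff)
      also have "\<dots> = prod b ({..<M} \<inter> S) * prod a ({..<M} \<inter> - S)"
        by (subst prod.If_cases) auto
      finally show "Q (e ` S) = prod b S * prod a ({..<M} - S)"
        using S by (simp add: Int_absorb1 Diff_eq)
    qed
    also have "\<dots> = W" unfolding W_def by (subst add.commute) (simp add: prod_add)
    finally show ?thesis .
  qed
  \<comment> \<open>Gibbs' inequality. Once \<open>F\<close> is replaced by \<open>Q\<close> under
    the average, what remains is minus the relative entropy of \<open>P\<close> with respect to
    \<open>Q / W\<close>, which is nonpositive by \<open>ln x \<le> x - 1\<close>.\<close>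
  have "ln Z - ln W = (\<Sum>T\<in>Pow {..<M}. P T * (ln Z - ln W))"
    using P1 by (simp flip: sum_distrib_right)
  also have "\<dots> = (\<Sum>T\<in>Pow {..<M}. P T * ln (F T)) - (\<Sum>T\<in>Pow {..<M}. P T * ln (P T * W))"
    unfolding sum_subtractf[symmetric]
  proof (intro sum.cong refl)
    fix T assume T: "T \<in> Pow {..<M}"
    then have pos': "0 < F T" "0 < P T" using pos P by auto
    have "ln (P T) = ln (F T) - ln Z" unfolding P_def using pos' Z by (simp add: ln_div)
    moreover have "ln (P T * W) = ln (P T) + ln W" using pos' W by (simp add: ln_mult less_imp_neq[symmetric])
    ultimately have "ln Z - ln W = ln (F T) - ln (P T * W)" by simp
    then show "P T * (ln Z - ln W) = P T * ln (F T) - P T * ln (P T * W)"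
      by (simp only: right_diff_distrib[symmetric])
  qed
  also have "\<dots> \<le> (\<Sum>T\<in>Pow {..<M}. P T * ln (Q T)) - (\<Sum>T\<in>Pow {..<M}. P T * ln (P T * W))"
    using E by simp
  also have "\<dots> \<le> (\<Sum>T\<in>Pow {..<M}. Q T / W - P T)"
    unfolding sum_subtractf[symmetric]
  proof (intro sum_mono)
    fix T assume "T \<in> Pow {..<M}"
    then have PT: "0 < P T" using P by auto
    have "ln (Q T) - ln (P T * W) = ln (Q T / (P T * W))"
      using Q[of T] PT W by (subst ln_div) auto
    also have "\<dots> \<le> Q T / (P T * W) - 1" using Q PT W by (intro ln_le_minus_one) simp
    finally have "P T * (ln (Q T) - ln (P T * W)) \<le> P T * (Q T / (P T * W) - 1)"
      using PT by simp
    also have "\<dots> = Q T / W - P T" using PT W by (simp add: field_simps)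
    finally show "P T * ln (Q T) - P T * ln (P T * W) \<le> Q T / W - P T" by (simp add: algebra_simps)
  qed
  also have "\<dots> = 0" using QW P1 W by (simp add: sum_subtractf flip: sum_divide_distrib)
  finally have "ln Z \<le> ln W" by simp
  then show ?thesis using Z W by (simp add: Z_def W_def)
qed

text \<open>A column belongs to exactly as many levels, counted from 0, as it has copies in
  \<open>X\<close>. The levels form a decreasing chain that records \<open>X\<close> up to permuting
  the copies within each column.\<close>

definition level :: "('a \<times> nat) set \<Rightarrow> nat \<Rightarrow> 'a set" where
  "level X k = {\<alpha>. k < card {m. (\<alpha>, m) \<in> X}}"

lemma level_subset: "X \<subseteq> A \<times> B \<Longrightarrow> level X k \<subseteq> A"
proof
  fix \<alpha> assume X: "X \<subseteq> A \<times> B" and \<alpha>: "\<alpha> \<in> level X k"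
  then have "{m. (\<alpha>, m) \<in> X} \<noteq> {}" unfolding level_def by (metis (mono_tags, lifting) card.empty mem_Collect_eq not_less_zero)
  then show "\<alpha> \<in> A" using X by auto
qed

lemma level_empty [simp]: "level {} k = {}" by (simp add: level_def)

lemma level_union_column:
  assumes "X \<subseteq> A \<times> B" "a \<notin> A" "T \<subseteq> {a} \<times> B"
  shows "level (X \<union> T) k = (if k < card (snd ` T) then insert a (level X k) else level X k)"
proof -
  have 1: "{m. (\<alpha>, m) \<in> X \<union> T} = {m. (\<alpha>, m) \<in> X}" if "\<alpha> \<noteq> a" for \<alpha>
    using assms that by auto
  have 2: "{m. (a, m) \<in> X \<union> T} = snd ` T" using assms by force
  have 3: "a \<notin> level X k" using level_subset[OF assms(1)] assms(2) by blast
  show ?thesis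
  proof (intro set_eqI)
    fix \<alpha>
    show "\<alpha> \<in> level (X \<union> T) k \<longleftrightarrow> \<alpha> \<in> (if k < card (snd ` T) then insert a (level X k) else level X k)"
    proof (cases "\<alpha> = a")
      case True
      then have "\<alpha> \<in> level (X \<union> T) k \<longleftrightarrow> k < card (snd ` T)"
        unfolding level_def mem_Collect_eq using 2 by simp
      then show ?thesis using True 3 by simp
    next
      case False
      then have "\<alpha> \<in> level (X \<union> T) k \<longleftrightarrow> \<alpha> \<in> level X k"
        unfolding level_def mem_Collect_eq using 1[of \<alpha>] by (simp only: not_False_eq_True)
      then show ?thesis using False by simp
    qed
  qed
qed

text \<open>One column \<open>a\<close> is summed out at a time. For fixed \<open>X\<close> in the
  other columns, adding the copies \<open>T\<close> of \<open>a\<close> puts \<open>a\<close> into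
  the first \<open>card T\<close> levels, so the level bound depends on \<open>T\<close> through its
  cardinality alone. Hence the sum over \<open>T\<close> is at most the product of
  \<open>f B + f (insert a B)\<close> over the levels \<open>B\<close> of \<open>X\<close>, which is
  the level bound for the marginals \<open>f'\<close> and \<open>g'\<close>. Log-supermodularity
  also passes to \<open>g'\<close>, so the induction continues.\<close>

theorem sum_le_power_of_level_bound:
  fixes f :: "'a set \<Rightarrow> real"
  assumes "finite A"
    and "\<And>B. B \<subseteq> A \<Longrightarrow> 0 < f B"
    and "\<And>X. X \<subseteq> A \<times> {..<M} \<Longrightarrow> 0 < g X"
    and "log_supermodular_on (A \<times> {..<M}) g"
    and "\<And>X. X \<subseteq> A \<times> {..<M} \<Longrightarrow> g X \<le> (\<Prod>k<M. f (level X k))"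
  shows "(\<Sum>X\<in>Pow (A \<times> {..<M}). g X) \<le> (\<Sum>B\<in>Pow A. f B) ^ M"
  using assms
proof (induction A arbitrary: f g rule: finite_induct)
  case empty
  then show ?case using empty(4)[of "{}"] by simp
next
  case (insert a A)
  define W where "W = {a} \<times> {..<M}"
  define U where "U = A \<times> {..<M}"
  have UW: "insert a A \<times> {..<M} = U \<union> W" by (auto simp: U_def W_def)
  have disj: "U \<inter> W = {}" and fW: "finite W" using insert.hyps by (auto simp: U_def W_def)
  define f' where "f' B = f B + f (insert a B)" for B
  define g' where "g' X = (\<Sum>T\<in>Pow W. g (X \<union> T))" for X
  note gpos = insert.prems(2)[unfolded UW] and glsm = insert.prems(3)[unfolded UW]
    and gle = insert.prems(4)[unfolded UW]
  have "(\<Sum>X\<in>Pow U. g' X) \<le> (\<Sum>B\<in>Pow A. f' B) ^ M"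
    unfolding U_def
  proof (rule insert.IH)
    show "0 < f' B" if "B \<subseteq> A" for B
      unfolding f'_def using that by (intro add_pos_pos insert.prems(1)) auto
    show "0 < g' X" if "X \<subseteq> A \<times> {..<M}" for X
      unfolding g'_def using fW that by (intro sum_pos gpos) (auto simp: U_def)
    show "log_supermodular_on (A \<times> {..<M}) g'"
      unfolding g'_def U_def[symmetric]
      by (rule log_supermodular_on_marginal[OF fW disj glsm]) (rule gpos)
    fix X assume "X \<subseteq> A \<times> {..<M}"
    then have X: "X \<subseteq> U" by (simp add: U_def)
    define F where "F T = g (X \<union> Pair a ` T)" for T
    have sub: "X \<union> Pair a ` T \<subseteq> U \<union> W" if "T \<subseteq> {..<M}" for T
      using X that by (auto simp: W_def)
    have lev: "level (X \<union> Pair a ` T) k = (if k < card T then insert a (level X k) else level X k)"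
      if "T \<subseteq> {..<M}" for T k
    proof -
      have "snd ` Pair a ` T = T" by (simp add: image_image)
      moreover have "Pair a ` T \<subseteq> {a} \<times> {..<M}" using that by auto
      ultimately show ?thesis
        using level_union_column[of X A "{..<M}" a "Pair a ` T" k] X insert.hyps
        by (simp add: U_def)
    qed
    have levA: "level X k \<subseteq> A" for k using level_subset[of X A] X by (simp add: U_def)
    have "(\<Sum>T\<in>Pow {..<M}. F T) \<le> (\<Prod>k<M. f (level X k) + f (insert a (level X k)))"
    proof (rule sum_Pow_le_prod_of_card_bound)
      show "log_supermodular_on {..<M} F"
        unfolding log_supermodular_on_def
      proof (intro allI impI)
        fix S T assume ST: "S \<subseteq> {..<M}" "T \<subseteq> {..<M}"
        have "(X \<union> Pair a ` S) \<union> (X \<union> Pair a ` T) = X \<union> Pair a ` (S \<union> T)" by auto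
        moreover have "(X \<union> Pair a ` S) \<inter> (X \<union> Pair a ` T) = X \<union> Pair a ` (S \<inter> T)" by auto
        ultimately show "F S * F T \<le> F (S \<union> T) * F (S \<inter> T)"
          unfolding F_def using log_supermodular_onD[OF glsm sub[OF ST(1)] sub[OF ST(2)]] by simp
      qed
      show "0 < F T" if "T \<subseteq> {..<M}" for T unfolding F_def using gpos sub[OF that] by blast
      show "0 < f (level X k) \<and> 0 < f (insert a (level X k))" if "k < M" for k
        using levA[of k] by (auto intro!: insert.prems(1))
      show "F T \<le> (\<Prod>k<M. if k < card T then f (insert a (level X k)) else f (level X k))"
        if "T \<subseteq> {..<M}" for T
      proof -
        have "F T \<le> (\<Prod>k<M. f (level (X \<union> Pair a ` T) k))"
          unfolding F_def by (rule gle[OF sub[OF that]])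
        also have "\<dots> = (\<Prod>k<M. if k < card T then f (insert a (level X k)) else f (level X k))"
          by (intro prod.cong refl) (simp add: lev[OF that])
        finally show ?thesis .
      qed
    qed
    moreover have "g' X = (\<Sum>T\<in>Pow {..<M}. F T)"
    proof -
      have "bij_betw (Pair a) {..<M} W" by (auto simp: W_def bij_betw_def inj_on_def)
      from sum.reindex_bij_betw[OF bij_betw_Pow[OF this], of "\<lambda>T. g (X \<union> T)"]
      show ?thesis by (simp add: g'_def F_def)
    qed
    ultimately show "g' X \<le> (\<Prod>k<M. f' (level X k))" by (simp add: f'_def)
  qed
  moreover have "(\<Sum>X\<in>Pow (insert a A \<times> {..<M}). g X) = (\<Sum>X\<in>Pow U. g' X)"
    unfolding UW g'_def by (rule sum_Pow_union[OF fW disj])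
  moreover have "(\<Sum>B\<in>Pow (insert a A). f B) = (\<Sum>B\<in>Pow A. f' B)"
    unfolding f'_def by (rule sum_Pow_insert) (use insert.hyps in auto)
  ultimately show ?case by simp
qed

section \<open>Linear forms over a finite field\<close>

definition linear_form :: "'u set \<Rightarrow> ('u \<Rightarrow> 'e \<Rightarrow> 'k::{field,finite}) \<Rightarrow> 'e \<Rightarrow> ('u \<Rightarrow> 'k) \<Rightarrow> 'k" where
  "linear_form U S e x = (\<Sum>j\<in>U. S j e * x j)"

definition solutions :: "'u set \<Rightarrow> ('u \<Rightarrow> 'e \<Rightarrow> 'k::{field,finite}) \<Rightarrow> 'e set \<Rightarrow> ('u \<Rightarrow> 'k) set" where
  "solutions U S B = {x \<in> configs U. \<forall>e\<in>B. linear_form U S e x = 0}"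

definition solution_prob :: "'u set \<Rightarrow> ('u \<Rightarrow> 'e \<Rightarrow> 'k::{field,finite}) \<Rightarrow> 'e set \<Rightarrow> real" where
  "solution_prob U S B = real (card (solutions U S B)) / real CARD('k) ^ card U"

text \<open>Linear independence by counting: the solution space has codimension
  \<open>card B\<close>, and a space of dimension d over the field has \<open>CARD('k)\<close> to
  the power d elements.\<close>

definition independent_columns :: "'u set \<Rightarrow> ('u \<Rightarrow> 'e \<Rightarrow> 'k::{field,finite}) \<Rightarrow> 'e set \<Rightarrow> bool" where
  "independent_columns U S B \<longleftrightarrow> card (solutions U S B) * CARD('k) ^ card B = CARD('k) ^ card U"

section \<open>Counting solutions of homogeneous linear systems\<close>

lemma finite_configs [simp]: "finite U \<Longrightarrow> finite (configs U :: ('u \<Rightarrow> 'x::finite) set)"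
  unfolding configs_def by (intro finite_PiE) auto

lemma card_configs: "finite U \<Longrightarrow> card (configs U :: ('u \<Rightarrow> 'x::finite) set) = CARD('x) ^ card U"
  unfolding configs_def by (simp add: card_PiE)

lemma configs_ext: "x \<in> configs U \<Longrightarrow> y \<in> configs U \<Longrightarrow> (\<And>j. j \<in> U \<Longrightarrow> x j = y j) \<Longrightarrow> x = y"
  unfolding configs_def by (rule PiE_ext)

lemma restrict_in_configs [simp]: "restrict x U \<in> configs U"
  unfolding configs_def by auto

lemma CARD_field_pos: "0 < CARD('k::{field,finite})" by simp

lemma linear_form_add_mult:
  "linear_form U S e (\<lambda>j\<in>U. x j + c * y j) = linear_form U S e x + c * linear_form U S e y"
  unfolding linear_form_def by (simp add: algebra_simps sum.distrib sum_distrib_left)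

lemma linear_form_add_mult_both:
  "linear_form U S e (\<lambda>j\<in>U. x j + y j) = linear_form U S e x + linear_form U S e y"
  "linear_form U S e (\<lambda>j\<in>U. x j - y j) = linear_form U S e x - linear_form U S e y"
  unfolding linear_form_def by (simp_all add: algebra_simps sum.distrib sum_subtractf)

lemma finite_solutions [simp]: "finite U \<Longrightarrow> finite (solutions U S B)"
  unfolding solutions_def by simp

lemma solutions_mono: "B \<subseteq> C \<Longrightarrow> solutions U S C \<subseteq> solutions U S B"
  unfolding solutions_def by auto

lemma solutions_Un: "solutions U S (B \<union> C) = solutions U S B \<inter> solutions U S C"
  unfolding solutions_def by auto

lemma solutions_empty: "solutions U S {} = configs U"
  unfolding solutions_def by simp

lemma zero_in_solutions: "(\<lambda>j\<in>U. 0) \<in> solutions U S B"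
  unfolding solutions_def linear_form_def by simp

lemma card_solutions_pos: "finite U \<Longrightarrow> 0 < card (solutions U S B)"
  using zero_in_solutions[of U S B] by (auto simp: card_gt_0_iff)

lemma solution_prob_pos: "finite U \<Longrightarrow> 0 < solution_prob U S B"
  unfolding solution_prob_def using card_solutions_pos[of U S B] by simp

lemma solution_prob_antimono: "finite U \<Longrightarrow> B \<subseteq> C \<Longrightarrow> solution_prob U S C \<le> solution_prob U S B"
  unfolding solution_prob_def
  by (intro divide_right_mono) (auto intro!: card_mono solutions_mono)

text \<open>The counting form of dim K + dim L = dim (K \<inter> L) + dim (K + L) for the solution
  spaces K of \<open>X\<close> and L of \<open>Y\<close>: K \<inter> L solves
  \<open>X \<union> Y\<close>, and K + L lies in the solutions of the common forms. The injection
  sends (x, y) to the sum x + y and the displacement of x from a fixed representative with the same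
  sum.\<close>

lemma card_solutions_mult_le:
  assumes "finite U"
  shows "card (solutions U S X) * card (solutions U S Y)
    \<le> card (solutions U S (X \<union> Y)) * card (solutions U S (X \<inter> Y))"
proof -
  define add where "add = (\<lambda>(x, y). \<lambda>j\<in>U. x j + y j :: 'b)"
  define D where "D = solutions U S X \<times> solutions U S Y"
  define rep where "rep z = (SOME v. v \<in> D \<and> add v = z)" for z
  define h where "h v = ((\<lambda>j\<in>U. fst v j - fst (rep (add v)) j), add v)" for v
  have rep: "rep (add v) \<in> D" "add (rep (add v)) = add v" if "v \<in> D" for v
    using someI[of "\<lambda>u. u \<in> D \<and> add u = add v" v] that unfolding rep_def by auto
  have dom: "x \<in> configs U" if "x \<in> solutions U S Z" for x Z using that by (simp add: solutions_def)
  have 1: "h v \<in> solutions U S (X \<union> Y) \<times> solutions U S (X \<inter> Y)" if v: "v \<in> D" for v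
  proof -
    obtain x y where xy: "v = (x, y)" "x \<in> solutions U S X" "y \<in> solutions U S Y"
      using v unfolding D_def by auto
    obtain x' y' where xy': "rep (add v) = (x', y')" "x' \<in> solutions U S X" "y' \<in> solutions U S Y"
      using rep(1)[OF v] unfolding D_def by auto
    \<comment> \<open>Both pairs have the same sum, so the displacement of the first component is
      opposite to that of the second. Seen from the second component, it annihilates the forms in
      \<open>Y\<close> as well.\<close>
    have eq: "x j - x' j = y' j - y j" if "j \<in> U" for j
    proof -
      have "(\<lambda>j\<in>U. x' j + y' j) = (\<lambda>j\<in>U. x j + y j)"
        using rep(2)[OF v] xy'(1) xy(1) by (simp add: add_def)
      from fun_cong[OF this, of j] that have "x' j + y' j = x j + y j" by simp
      then show ?thesis by (simp add: algebra_simps)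
    qed
    have d: "(\<lambda>j\<in>U. x j - x' j) = (\<lambda>j\<in>U. y' j - y j)"
      by (rule restrict_ext) (rule eq)
    have "(\<lambda>j\<in>U. x j - x' j) \<in> solutions U S X"
      using xy xy' by (simp add: solutions_def linear_form_add_mult_both)
    moreover have "(\<lambda>j\<in>U. x j - x' j) \<in> solutions U S Y"
      unfolding d using xy xy' by (simp add: solutions_def linear_form_add_mult_both)
    moreover have "add v \<in> solutions U S (X \<inter> Y)"
      using xy by (simp add: add_def solutions_def linear_form_add_mult_both)
    ultimately show ?thesis unfolding h_def using xy(1) xy'(1) by (simp add: solutions_Un)
  qed
  have "inj_on h D"
  proof (rule inj_onI)
    fix v v' assume v: "v \<in> D" and v': "v' \<in> D" and eq: "h v = h v'"
    obtain x y where xy: "v = (x, y)" "x \<in> configs U" "y \<in> configs U"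
      using v dom unfolding D_def by auto
    obtain x' y' where xy': "v' = (x', y')" "x' \<in> configs U" "y' \<in> configs U"
      using v' dom unfolding D_def by auto
    have a: "add v = add v'" using eq by (simp add: h_def)
    have h1: "(\<lambda>j\<in>U. fst v j - fst (rep (add v)) j) = (\<lambda>j\<in>U. fst v' j - fst (rep (add v)) j)"
      using eq a by (simp add: h_def)
    have "x j = x' j" if "j \<in> U" for j
      using fun_cong[OF h1, of j] that xy xy' by simp
    then have x: "x = x'" using configs_ext xy xy' by blast
    have "y j = y' j" if "j \<in> U" for j
      using fun_cong[OF a, of j] that xy xy' x by (simp add: add_def)
    then have "y = y'" using configs_ext xy xy' by blast
    then show "v = v'" using x xy xy' by simp
  qed
  moreover have "h ` D \<subseteq> solutions U S (X \<union> Y) \<times> solutions U S (X \<inter> Y)" by (intro image_subsetI 1)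
  moreover have "finite (solutions U S (X \<union> Y) \<times> solutions U S (X \<inter> Y))" using assms by simp
  ultimately have "card D \<le> card (solutions U S (X \<union> Y) \<times> solutions U S (X \<inter> Y))"
    by (rule card_inj_on_le)
  then show ?thesis by (simp add: D_def card_cartesian_product)
qed

lemma log_supermodular_on_solution_prob:
  assumes "finite U"
  shows "log_supermodular_on E (solution_prob U S)"
  unfolding log_supermodular_on_def
proof (intro allI impI)
  fix X Y
  have "real (card (solutions U S X) * card (solutions U S Y))
    \<le> real (card (solutions U S (X \<union> Y)) * card (solutions U S (X \<inter> Y)))"
    using card_solutions_mult_le[OF assms, of S X Y] by (simp only: of_nat_le_iff)
  then show "solution_prob U S X * solution_prob U S Y
      \<le> solution_prob U S (X \<union> Y) * solution_prob U S (X \<inter> Y)"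
    unfolding solution_prob_def by (simp add: divide_right_mono)
qed

text \<open>If the new form does not vanish on some solution \<open>x\<close>, every solution of
  \<open>B\<close> is uniquely a solution of the enlarged system plus a multiple of
  \<open>x\<close>; hence the factor \<open>CARD('k)\<close>.\<close>

lemma solutions_insert_cases:
  fixes S :: "'u \<Rightarrow> 'e \<Rightarrow> 'k::{field,finite}"
  assumes U: "finite U"
  obtains "solutions U S (insert e B) = solutions U S B"
  | x where "x \<in> solutions U S B" "linear_form U S e x \<noteq> 0"
      "card (solutions U S (insert e B)) * CARD('k) = card (solutions U S B)"
proof (cases "\<exists>x\<in>solutions U S B. linear_form U S e x \<noteq> 0")
  case False
  then have "solutions U S (insert e B) = solutions U S B" unfolding solutions_def by auto
  then show ?thesis using that by blast
next
  case True
  then obtain x where x: "x \<in> solutions U S B" "linear_form U S e x \<noteq> 0" by blast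
  define h where "h = (\<lambda>(y, t). \<lambda>j\<in>U. y j + t * x j)"
  have "bij_betw h (solutions U S (insert e B) \<times> UNIV) (solutions U S B)"
    unfolding bij_betw_def
  proof
    show "inj_on h (solutions U S (insert e B) \<times> UNIV)"
    proof (rule inj_onI, clarify)
      fix y t y' t'
      assume y: "y \<in> solutions U S (insert e B)" and y': "y' \<in> solutions U S (insert e B)"
        and eq: "h (y, t) = h (y', t')"
      have "linear_form U S e (h (y, t)) = linear_form U S e (h (y', t'))" using eq by simp
      then have t: "t = t'"
        using y y' x by (simp add: h_def linear_form_add_mult solutions_def)
      have "y j = y' j" if "j \<in> U" for j
        using fun_cong[OF eq, of j] that t by (simp add: h_def)
      then have "y = y'"
        using y y' by (intro configs_ext[of y U y']) (simp_all add: solutions_def)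
      then show "y = y' \<and> t = t'" using t by simp
    qed
    show "h ` (solutions U S (insert e B) \<times> UNIV) = solutions U S B"
    proof (intro equalityI subsetI)
      fix z assume "z \<in> h ` (solutions U S (insert e B) \<times> UNIV)"
      then show "z \<in> solutions U S B"
        using x by (auto simp: h_def linear_form_add_mult solutions_def)
    next
      fix z assume z: "z \<in> solutions U S B"
      define t where "t = linear_form U S e z / linear_form U S e x"
      define y where "y = (\<lambda>j\<in>U. z j + (- t) * x j)"
      have "linear_form U S e' y = linear_form U S e' z + (- t) * linear_form U S e' x" for e'
        unfolding y_def by (rule linear_form_add_mult)
      moreover have "y \<in> configs U" by (simp add: y_def)
      ultimately have "y \<in> solutions U S (insert e B)"
        using z x by (simp add: solutions_def t_def)
      moreover have "h (y, t) = z"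
        using z by (intro configs_ext[of _ U]) (auto simp: h_def y_def solutions_def)
      ultimately show "z \<in> h ` (solutions U S (insert e B) \<times> UNIV)"
        by (intro image_eqI[of z h "(y, t)"]) simp_all
    qed
  qed
  from bij_betw_same_card[OF this] have "card (solutions U S (insert e B)) * CARD('k) = card (solutions U S B)"
    by (simp add: card_cartesian_product)
  then show ?thesis using that x by blast
qed

lemma card_solutions_insert:
  fixes S :: "'u \<Rightarrow> 'e \<Rightarrow> 'k::{field,finite}"
  assumes U: "finite U"
  shows "card (solutions U S B) \<le> card (solutions U S (insert e B)) * CARD('k)"
  using U by (rule solutions_insert_cases[of U S e B]) (use CARD_field_pos[where ?'k='k] in auto)

lemma card_solutions_union_ge:
  fixes S :: "'u \<Rightarrow> 'e \<Rightarrow> 'k::{field,finite}"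
  assumes U: "finite U" and C: "finite C"
  shows "card (solutions U S B) \<le> card (solutions U S (B \<union> C)) * CARD('k) ^ card C"
  using C
proof induction
  case (insert e C)
  have "card (solutions U S (B \<union> C)) \<le> card (solutions U S (insert e (B \<union> C))) * CARD('k)"
    by (rule card_solutions_insert[OF U])
  then have "card (solutions U S (B \<union> C)) * CARD('k) ^ card C
      \<le> card (solutions U S (insert e (B \<union> C))) * CARD('k) * CARD('k) ^ card C"
    by (rule mult_le_mono1)
  with insert.IH have "card (solutions U S B)
      \<le> card (solutions U S (insert e (B \<union> C))) * CARD('k) * CARD('k) ^ card C"
    by (rule order_trans)
  then show ?case using insert.hyps by (simp add: mult.assoc)
qed simp

lemma solution_prob_union_ge:
  fixes S :: "'u \<Rightarrow> 'e \<Rightarrow> 'k::{field,finite}"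
  assumes U: "finite U" and C: "finite C"
  shows "solution_prob U S B \<le> solution_prob U S (B \<union> C) * real CARD('k) ^ card C"
proof -
  have "real (card (solutions U S B)) \<le> real (card (solutions U S (B \<union> C)) * CARD('k) ^ card C)"
    using card_solutions_union_ge[OF U C, of S B] by (simp only: of_nat_le_iff)
  then show ?thesis unfolding solution_prob_def by (simp add: divide_right_mono)
qed

section \<open>Independent sets of columns and bases\<close>

lemma independent_columns_empty: "finite U \<Longrightarrow> independent_columns U S {}"
  by (simp add: independent_columns_def solutions_empty card_configs)

lemma independent_columns_insert_iff:
  fixes S :: "'u \<Rightarrow> 'e \<Rightarrow> 'k::{field,finite}"
  assumes U: "finite U" and B: "finite B" "e \<notin> B"
  shows "independent_columns U S (insert e B) \<longleftrightarrow>
    independent_columns U S B \<and> card (solutions U S (insert e B)) * CARD('k) = card (solutions U S B)"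
proof
  assume ind: "independent_columns U S (insert e B)"
  have "card (solutions U S (insert e B)) * CARD('k) * CARD('k) ^ card B = CARD('k) ^ card U"
    using ind B by (simp add: independent_columns_def mult.assoc)
  moreover have "CARD('k) ^ card U \<le> card (solutions U S B) * CARD('k) ^ card B"
    using card_solutions_union_ge[OF U B(1), of S "{}"] by (simp add: solutions_empty card_configs U)
  moreover have "card (solutions U S B) * CARD('k) ^ card B
      \<le> card (solutions U S (insert e B)) * CARD('k) * CARD('k) ^ card B"
    using card_solutions_insert[OF U, of S B e] by simp
  \<comment> \<open>A new form divides the count by at most \<open>CARD('k)\<close>, so the three
    quantities form an increasing chain whose ends coincide; all of them are equal.\<close>
  ultimately have "card (solutions U S B) * CARD('k) ^ card B = CARD('k) ^ card U"
    and "card (solutions U S (insert e B)) * CARD('k) * CARD('k) ^ card B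
      = card (solutions U S B) * CARD('k) ^ card B"
    by linarith+
  then show "independent_columns U S B
      \<and> card (solutions U S (insert e B)) * CARD('k) = card (solutions U S B)"
    unfolding independent_columns_def
    using CARD_field_pos[where ?'k='k] by (metis mult_cancel2 not_less_zero power_not_zero)
next
  assume "independent_columns U S B
      \<and> card (solutions U S (insert e B)) * CARD('k) = card (solutions U S B)"
  then show "independent_columns U S (insert e B)"
    unfolding independent_columns_def using B by (simp add: mult.assoc[symmetric])
qed

lemma solution_prob_independent:
  fixes S :: "'u \<Rightarrow> 'e \<Rightarrow> 'k::{field,finite}"
  assumes "independent_columns U S B"
  shows "solution_prob U S B = 1 / real CARD('k) ^ card B"
proof -
  have "real (card (solutions U S B)) * real CARD('k) ^ card B = real CARD('k) ^ card U"
    using assms unfolding independent_columns_def by (metis of_nat_mult of_nat_power)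
  then show ?thesis unfolding solution_prob_def by (simp add: field_simps)
qed

text \<open>The greedy construction: a column is added only if it shrinks the solution set. It then
  shrinks it by the full factor \<open>CARD('k)\<close>, so independence is kept.\<close>

lemma extend_to_basis:
  fixes S :: "'u \<Rightarrow> 'e \<Rightarrow> 'k::{field,finite}"
  assumes U: "finite U" and D: "finite D" and I: "finite I" "independent_columns U S I"
  shows "\<exists>I'. I \<subseteq> I' \<and> I' \<subseteq> I \<union> D \<and> independent_columns U S I'
    \<and> solutions U S I' = solutions U S (I \<union> D)"
  using D
proof induction
  case empty
  then show ?case using I by auto
next
  case (insert e D)
  then obtain I' where I': "I \<subseteq> I'" "I' \<subseteq> I \<union> D" "independent_columns U S I'"
    "solutions U S I' = solutions U S (I \<union> D)" by blast
  have fin: "finite I'" using I' I insert.hyps finite_subset by blast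
  have eq: "solutions U S (insert e I') = solutions U S (I \<union> insert e D)"
    using I'(4) by (auto simp: solutions_def)
  show ?case
  proof (cases "solutions U S (insert e I') = solutions U S I'")
    case True
    then show ?thesis using I' eq by (intro exI[of _ I']) auto
  next
    case False
    then have "e \<notin> I'" by (metis insert_absorb)
    moreover have "card (solutions U S (insert e I')) * CARD('k) = card (solutions U S I')"
      using U by (rule solutions_insert_cases[of U S e I']) (use False in auto)
    ultimately have "independent_columns U S (insert e I')"
      using independent_columns_insert_iff[OF U fin] I'(3) by blast
    then show ?thesis using I' eq by (intro exI[of _ "insert e I'"]) auto
  qed
qed

text \<open>A basis of each set of the chain is extended to a basis of the next, so the part of the
  final basis inside \<open>C k\<close> already accounts for all constraints of \<open>C k\<close>.
  The inequality for an earlier \<open>C k\<close> survives later extensions, since enlarging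
  \<open>I\<close> lowers its left side. Having one \<open>I\<close> for all \<open>k\<close>
  permits all levels of a set of lifted columns to be tested against one lifted independent
  set.\<close>

lemma basis_of_chain:
  fixes S :: "'u \<Rightarrow> 'e \<Rightarrow> 'k::{field,finite}" and C :: "nat \<Rightarrow> 'e set"
  assumes U: "finite U" and C: "\<And>k. finite (C k)" "mono C"
  shows "\<exists>I. I \<subseteq> C n \<and> independent_columns U S I
    \<and> (\<forall>k\<le>n. 1 / real CARD('k) ^ card (I \<inter> C k) \<le> solution_prob U S (C k))"
proof (induction n)
  case 0
  obtain I where I: "I \<subseteq> C 0" "independent_columns U S I" "solutions U S I = solutions U S (C 0)"
    using extend_to_basis[OF U C(1), of "{}" S 0] independent_columns_empty[OF U] by auto
  then have "solution_prob U S (C 0) = 1 / real CARD('k) ^ card I"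
    using solution_prob_independent[OF I(2)] by (simp add: solution_prob_def)
  then show ?case using I by (intro exI[of _ I]) (simp add: Int_absorb2)
next
  case (Suc n)
  then obtain I where I: "I \<subseteq> C n" "independent_columns U S I"
    "\<forall>k\<le>n. 1 / real CARD('k) ^ card (I \<inter> C k) \<le> solution_prob U S (C k)" by blast
  have mono: "C n \<subseteq> C (Suc n)" using C(2) by (auto simp: mono_def)
  have finI: "finite I" using I(1) C(1) finite_subset by blast
  obtain I' where I': "I \<subseteq> I'" "I' \<subseteq> I \<union> C (Suc n)" "independent_columns U S I'"
    "solutions U S I' = solutions U S (I \<union> C (Suc n))"
    using extend_to_basis[OF U C(1) finI I(2)] by blast
  have un: "I \<union> C (Suc n) = C (Suc n)" using I(1) mono by auto
  have finI': "finite I'" using I'(2) un C(1) finite_subset by metis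
  have "1 / real CARD('k) ^ card (I' \<inter> C k) \<le> solution_prob U S (C k)" if "k \<le> Suc n" for k
  proof (cases "k = Suc n")
    case True
    have "solution_prob U S (C (Suc n)) = 1 / real CARD('k) ^ card I'"
      using solution_prob_independent[OF I'(3)] I'(4) un by (simp add: solution_prob_def)
    then show ?thesis using True I'(2) un by (simp add: Int_absorb2)
  next
    case False
    have "card (I \<inter> C k) \<le> card (I' \<inter> C k)" using I'(1) finI' by (intro card_mono) auto
    then have "1 / real CARD('k) ^ card (I' \<inter> C k) \<le> 1 / real CARD('k) ^ card (I \<inter> C k)"
      using CARD_field_pos[where ?'k='k] by (intro divide_left_mono power_increasing) auto
    also have "\<dots> \<le> solution_prob U S (C k)" using I(3) that False by simp
    finally show ?thesis .
  qed
  then show ?case using I' un by (intro exI[of _ I']) auto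
qed

text \<open>
  Existence of a transversal: some solution \<open>x\<close> of the forms in \<open>B\<close> is not annihilated by the form \<open>a\<close>,
  so \<open>x i \<noteq> 0 \<noteq> S i a\<close> for some row \<open>i\<close>, and the columns \<open>B\<close> stay independent without row \<open>i\<close>.
\<close>

lemma independent_columns_transversal:
  fixes S :: "'u \<Rightarrow> 'e \<Rightarrow> 'k::{field,finite}"
  assumes "finite B" "finite U" "independent_columns U S B"
  shows "\<exists>g. inj_on g B \<and> g ` B \<subseteq> U \<and> (\<forall>e\<in>B. S (g e) e \<noteq> 0)"
  using assms
proof (induction B arbitrary: U rule: finite_induct)
  case empty
  then show ?case by simp
next
  case (insert a B)
  note U = insert.prems(1)
  have ind: "independent_columns U S B"
    and card: "card (solutions U S (insert a B)) * CARD('k) = card (solutions U S B)"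
    using independent_columns_insert_iff[OF U insert.hyps] insert.prems(2) by auto
  have q2: "1 < CARD('k)"
    using card_mono[of UNIV "{0, 1 :: 'k}"] by simp
  have "solutions U S (insert a B) \<noteq> solutions U S B"
  proof
    assume "solutions U S (insert a B) = solutions U S B"
    then show False using card q2 card_solutions_pos[OF U, of S B] by simp
  qed
  then obtain x where x: "x \<in> solutions U S B" "linear_form U S a x \<noteq> 0"
    using U by (rule_tac solutions_insert_cases[of U S a B]) auto
  then obtain i where i: "i \<in> U" "S i a * x i \<noteq> 0"
    unfolding linear_form_def by (meson sum.not_neutral_contains_not_neutral)
  define U' where "U' = U - {i}"
  \<comment> \<open>Column \<open>a\<close> is replaced by the coordinate form of row
    \<open>i\<close>. As \<open>x i\<close> is nonzero, this form also cuts the solutions of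
    \<open>B\<close> by the factor \<open>CARD('k)\<close>. The surviving solutions vanish at
    \<open>i\<close>, so they are the solutions of \<open>B\<close> on \<open>U'\<close>.\<close>
  define S' where "S' j e = (if e = a then (if j = i then 1 else 0) else S j e)" for j e
  have lf_a: "linear_form U S' a y = y i" for y
    unfolding linear_form_def S'_def using U i(1) by (simp add: if_distrib[of "\<lambda>c. c * _"] cong: if_cong)
  have lf_B: "linear_form U S' e y = linear_form U S e y" if "e \<in> B" for e y
    using that insert.hyps unfolding linear_form_def S'_def by (intro sum.cong) auto
  have sol_B: "solutions U S' B = solutions U S B"
    unfolding solutions_def using lf_B by auto
  have "solutions U S' (insert a B) \<noteq> solutions U S' B"
  proof
    assume "solutions U S' (insert a B) = solutions U S' B"
    then have "x \<in> solutions U S' (insert a B)" using x sol_B by simp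
    then show False using i lf_a by (simp add: solutions_def)
  qed
  then have card': "card (solutions U S' (insert a B)) * CARD('k) = card (solutions U S B)"
    using U sol_B by (rule_tac solutions_insert_cases[of U S' a B]) auto
  have lf_U': "linear_form U S e y = linear_form U' S e (restrict y U')" if "y i = 0" for e y
    unfolding linear_form_def U'_def using U i that by (simp add: sum.remove[of U i])
  have "bij_betw (\<lambda>y. restrict y U') (solutions U S' (insert a B)) (solutions U' S B)"
    unfolding bij_betw_def
  proof
    show "inj_on (\<lambda>y. restrict y U') (solutions U S' (insert a B))"
    proof (rule inj_onI)
      fix y z assume y: "y \<in> solutions U S' (insert a B)" and z: "z \<in> solutions U S' (insert a B)"
        and eq: "restrict y U' = restrict z U'"
      have yz: "y i = 0" "z i = 0" using y z lf_a by (auto simp: solutions_def)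
      have "y j = z j" if "j \<in> U" for j
        using fun_cong[OF eq, of j] that yz by (cases "j = i") (auto simp: U'_def)
      then show "y = z"
        using y z by (intro configs_ext[of y U z]) (simp_all add: solutions_def)
    qed
    show "(\<lambda>y. restrict y U') ` solutions U S' (insert a B) = solutions U' S B"
    proof (intro equalityI subsetI)
      fix z assume "z \<in> (\<lambda>y. restrict y U') ` solutions U S' (insert a B)"
      then obtain y where y: "y \<in> solutions U S' (insert a B)" "z = restrict y U'" by blast
      have "y i = 0" using y lf_a by (auto simp: solutions_def)
      then show "z \<in> solutions U' S B"
        using y lf_B lf_U'[of y] by (auto simp: solutions_def)
    next
      fix z assume z: "z \<in> solutions U' S B"
      define y where "y = (\<lambda>j\<in>U. if j = i then 0 else z j)"
      have yi: "y i = 0" using i by (simp add: y_def)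
      have zy: "restrict y U' = z"
        using z by (intro configs_ext[of "restrict y U'" U' z] restrict_in_configs)
          (auto simp: y_def U'_def solutions_def)
      have "y \<in> configs U" by (simp add: y_def)
      then have "y \<in> solutions U S' (insert a B)"
        using z lf_a lf_B lf_U'[of y] yi zy by (auto simp: solutions_def)
      then show "z \<in> (\<lambda>y. restrict y U') ` solutions U S' (insert a B)" using zy by blast
    qed
  qed
  from bij_betw_same_card[OF this]
  have "card (solutions U' S B) * CARD('k) = card (solutions U S B)" using card' by simp
  moreover have "card (solutions U S B) * CARD('k) ^ card B = CARD('k) ^ card U"
    using ind by (simp add: independent_columns_def)
  moreover have "CARD('k) ^ card U = CARD('k) * CARD('k) ^ card U'"
    using U i(1) by (metis U'_def card_Suc_Diff1 power_Suc)
  ultimately have "CARD('k) * (card (solutions U' S B) * CARD('k) ^ card B) = CARD('k) * CARD('k) ^ card U'"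
    by (metis mult.assoc mult.commute)
  then have "independent_columns U' S B"
    unfolding independent_columns_def using CARD_field_pos[where ?'k='k] by (simp only: mult_cancel1) simp
  then obtain g where g: "inj_on g B" "g ` B \<subseteq> U'" "\<forall>e\<in>B. S (g e) e \<noteq> 0"
    using insert.IH[of U'] U by (auto simp: U'_def)
  have gB: "(g(a := i)) ` B = g ` B" using insert.hyps by (intro image_cong) auto
  have "inj_on (g(a := i)) (insert a B)"
    using g insert.hyps gB by (auto simp: inj_on_insert U'_def intro: inj_on_fun_updI)
  moreover have "(g(a := i)) ` insert a B \<subseteq> U"
    using g i insert.hyps by (auto simp: U'_def)
  moreover have "\<forall>e\<in>insert a B. S ((g(a := i)) e) e \<noteq> 0"
    using g i insert.hyps by auto
  ultimately show ?case by blast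
qed

text \<open>The Fortuin-Kasteleyn or random-cluster representation. The product of the delta terms
  over \<open>B\<close> is the indicator of \<open>solutions U S B\<close>, whose average over all
  configurations is \<open>solution_prob U S B\<close>.\<close>

lemma potts_partition_function_expand:
  fixes S :: "'u \<Rightarrow> 'e \<Rightarrow> 'k::{field,finite}"
  assumes U: "finite U" and A: "finite A"
  shows "potts_partition_function U A S J
    = (\<Sum>B\<in>Pow A. (\<Prod>\<alpha>\<in>B. exp (J \<alpha>) - 1) * solution_prob U S B)"
proof -
  have e: "exp (J \<alpha> * delta0 (\<Sum>i\<in>U. S i \<alpha> * x i)) = (exp (J \<alpha>) - 1) * delta0 (linear_form U S \<alpha> x) + 1"
    for \<alpha> and x :: "'u \<Rightarrow> 'k"
    by (simp add: delta0_def linear_form_def)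
  have p: "(\<Prod>\<alpha>\<in>A. exp (J \<alpha> * delta0 (\<Sum>i\<in>U. S i \<alpha> * x i)))
      = (\<Sum>B\<in>Pow A. (\<Prod>\<alpha>\<in>B. exp (J \<alpha>) - 1) * (if x \<in> solutions U S B then 1 else 0))"
    if x: "x \<in> configs U" for x :: "'u \<Rightarrow> 'k"
  proof -
    have "(\<Prod>\<alpha>\<in>B. delta0 (linear_form U S \<alpha> x)) = (if x \<in> solutions U S B then 1 else 0)"
      if B: "B \<in> Pow A" for B
    proof (cases "x \<in> solutions U S B")
      case True
      then show ?thesis by (auto simp: solutions_def delta0_def intro!: prod.neutral)
    next
      case False
      have "finite B" using B A finite_subset by auto
      then show ?thesis using False x by (auto simp: solutions_def delta0_def)
    qed
    then show ?thesis unfolding e by (simp add: prod_add[OF A] prod.distrib)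
  qed
  have "potts_partition_function U A S J = (\<Sum>x\<in>configs U. 1 / real CARD('k) ^ card U *
      (\<Sum>B\<in>Pow A. (\<Prod>\<alpha>\<in>B. exp (J \<alpha>) - 1) * (if x \<in> solutions U S B then 1 else 0)))"
    unfolding potts_partition_function_def using p by (intro sum.cong) auto
  also have "\<dots> = (\<Sum>B\<in>Pow A. \<Sum>x\<in>configs U. (\<Prod>\<alpha>\<in>B. exp (J \<alpha>) - 1) *
      (1 / real CARD('k) ^ card U * (if x \<in> solutions U S B then 1 else 0)))"
    by (subst sum.swap) (simp add: sum_distrib_left algebra_simps)
  also have "\<dots> = (\<Sum>B\<in>Pow A. (\<Prod>\<alpha>\<in>B. exp (J \<alpha>) - 1) * solution_prob U S B)"
  proof (intro sum.cong refl)
    fix B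
    have "(\<Sum>x\<in>configs U. (if x \<in> solutions U S B then 1 else 0)) = real (card (solutions U S B))"
    proof -
      have "configs U \<inter> {x. x \<in> solutions U S B} = solutions U S B" by (auto simp: solutions_def)
      then show ?thesis using U by (simp add: sum.If_cases)
    qed
    then show "(\<Sum>x\<in>configs U. (\<Prod>\<alpha>\<in>B. exp (J \<alpha>) - 1) *
      (1 / real CARD('k) ^ card U * (if x \<in> solutions U S B then 1 else 0)))
      = (\<Prod>\<alpha>\<in>B. exp (J \<alpha>) - 1) * solution_prob U S B"
      unfolding sum_distrib_left[symmetric] solution_prob_def by simp
  qed
  finally show ?thesis .
qed

section \<open>Lifting the columns of a matrix\<close>

text \<open>
  The bound below holds for an arbitrary matrix \<open>T\<close> with \<open>M\<close> columns \<open>(\<alpha>, 0), \<dots>, (\<alpha>, M - 1)\<close> for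
  each column \<open>\<alpha>\<close> of \<open>S\<close>.  A summand of the defect is 1 exactly if the lift of the independent set
  \<open>I\<close> is independent.
\<close>

definition lift_defect ::
  "'v set \<Rightarrow> 'a set \<Rightarrow> ('v \<Rightarrow> 'a \<Rightarrow> 'k::{field,finite}) \<Rightarrow> nat \<Rightarrow> 'u set \<Rightarrow> ('u \<Rightarrow> 'a \<times> nat \<Rightarrow> 'k) \<Rightarrow> real" where
  "lift_defect V A S M U T = (\<Sum>I\<in>{I. I \<subseteq> A \<and> independent_columns V S I}.
     real CARD('k) ^ (M * card I) * solution_prob U T (I \<times> {..<M}))"

text \<open>Double counting: a column of \<open>I\<close> lies in as many levels as it has copies in
  \<open>X\<close>.\<close>

lemma card_fiber_sum:
  assumes "finite I" "X \<subseteq> A \<times> {..<M}"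
  shows "(\<Sum>k<M. card (I \<inter> level X k)) = card (X \<inter> I \<times> {..<M})"
proof -
  define c where "c \<alpha> = card {m. (\<alpha>, m) \<in> X}" for \<alpha>
  have sub: "{m. (\<alpha>, m) \<in> X} \<subseteq> {..<M}" for \<alpha> using assms(2) by auto
  have c: "c \<alpha> \<le> M" for \<alpha> using card_mono[OF _ sub[of \<alpha>]] by (simp add: c_def)
  have "card (I \<inter> level X k) = (\<Sum>\<alpha>\<in>I. if k < c \<alpha> then 1 else 0)" for k
  proof -
    have "I \<inter> level X k = I \<inter> {\<alpha>. k < c \<alpha>}" by (auto simp: level_def c_def)
    then show ?thesis using assms(1) by (simp add: sum.If_cases)
  qed
  then have "(\<Sum>k<M. card (I \<inter> level X k)) = (\<Sum>\<alpha>\<in>I. \<Sum>k<M. if k < c \<alpha> then 1 else 0)"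
    by (simp add: sum.swap[of _ I])
  also have "\<dots> = (\<Sum>\<alpha>\<in>I. c \<alpha>)"
  proof (intro sum.cong refl)
    fix \<alpha>
    have "{..<M} \<inter> {k. k < c \<alpha>} = {..<c \<alpha>}" using c[of \<alpha>] by auto
    then show "(\<Sum>k<M. if k < c \<alpha> then 1 else 0) = c \<alpha>" by (simp add: sum.If_cases)
  qed
  also have "\<dots> = card (Sigma I (\<lambda>\<alpha>. {m. (\<alpha>, m) \<in> X}))"
    unfolding c_def using assms(1) sub finite_subset by (subst card_SigmaI) (auto intro: finite_subset[OF sub])
  also have "Sigma I (\<lambda>\<alpha>. {m. (\<alpha>, m) \<in> X}) = X \<inter> I \<times> {..<M}" using sub by auto
  finally show ?thesis .
qed

lemma prod_levels:
  fixes w :: "'a \<Rightarrow> real"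
  assumes "finite A" "X \<subseteq> A \<times> {..<M}"
  shows "(\<Prod>x\<in>X. w (fst x)) = (\<Prod>k<M. \<Prod>\<alpha>\<in>level X k. w \<alpha>)"
proof -
  define c where "c \<alpha> = card {m. (\<alpha>, m) \<in> X}" for \<alpha>
  have sub: "{m. (\<alpha>, m) \<in> X} \<subseteq> {..<M}" for \<alpha> using assms(2) by auto
  have c: "c \<alpha> \<le> M" for \<alpha> using card_mono[OF _ sub[of \<alpha>]] by (simp add: c_def)
  have "X = Sigma A (\<lambda>\<alpha>. {m. (\<alpha>, m) \<in> X})" using assms(2) by auto
  then have "(\<Prod>x\<in>X. w (fst x)) = (\<Prod>\<alpha>\<in>A. \<Prod>m\<in>{m. (\<alpha>, m) \<in> X}. w \<alpha>)"
    using assms(1) finite_subset[OF sub]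
    by (subst prod.Sigma) (auto simp: case_prod_unfold)
  also have "\<dots> = (\<Prod>\<alpha>\<in>A. \<Prod>k<M. if k < c \<alpha> then w \<alpha> else 1)"
  proof (rule prod.cong[OF refl])
    fix \<alpha>
    have "{..<M} \<inter> {k. k < c \<alpha>} = {..<c \<alpha>}" using c[of \<alpha>] by auto
    then show "(\<Prod>m\<in>{m. (\<alpha>, m) \<in> X}. w \<alpha>) = (\<Prod>k<M. if k < c \<alpha> then w \<alpha> else 1)"
      by (simp add: prod.If_cases c_def)
  qed
  also have "\<dots> = (\<Prod>k<M. \<Prod>\<alpha>\<in>A. if k < c \<alpha> then w \<alpha> else 1)" by (rule prod.swap)
  also have "\<dots> = (\<Prod>k<M. \<Prod>\<alpha>\<in>level X k. w \<alpha>)"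
  proof (rule prod.cong[OF refl])
    fix k
    have "A \<inter> {\<alpha>. k < c \<alpha>} = level X k"
      using level_subset[OF assms(2), of k] by (auto simp: level_def c_def)
    then show "(\<Prod>\<alpha>\<in>A. if k < c \<alpha> then w \<alpha> else 1) = (\<Prod>\<alpha>\<in>level X k. w \<alpha>)"
      using assms(1) by (simp add: prod.If_cases)
  qed
  finally show ?thesis .
qed

text \<open>Only the copies \<open>Y\<close> of columns in a basis \<open>I\<close> adapted to all
  levels are kept, and \<open>Y\<close> is then completed to the full lift of \<open>I\<close>.
  Dropping conditions raises the probability, and restoring each missing copy costs at most a factor
  \<open>CARD('k)\<close>. Compared with the value \<open>1 / CARD('k) ^ card Y\<close> of
  independent conditions, the loss is the summand of \<open>I\<close> in the defect. The value
  itself factors over the levels, where \<open>basis_of_chain\<close> bounds each factor.\<close>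

lemma solution_prob_lift_le:
  fixes S :: "'v \<Rightarrow> 'a \<Rightarrow> 'k::{field,finite}" and T :: "'u \<Rightarrow> 'a \<times> nat \<Rightarrow> 'k"
  assumes V: "finite V" and A: "finite A" and U: "finite U" and X: "X \<subseteq> A \<times> {..<M}"
  shows "solution_prob U T X \<le> lift_defect V A S M U T * (\<Prod>k<M. solution_prob V S (level X k))"
proof -
  let ?q = "real CARD('k)"
  have q: "0 < ?q" by simp
  have lev: "level X k \<subseteq> A" for k using level_subset[OF X] .
  \<comment> \<open>Levels decrease with their index, whereas \<open>basis_of_chain\<close> expects
    an increasing chain. With the index reversed, \<open>C M\<close> is level 0, the
    largest.\<close>
  define C where "C k = level X (M - k)" for k
  have "mono C" unfolding C_def mono_def level_def by (auto intro: le_less_trans diff_le_mono2)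
  moreover have "finite (C k)" for k unfolding C_def using lev A finite_subset by blast
  ultimately obtain I where I: "I \<subseteq> C M" "independent_columns V S I"
    "\<forall>k\<le>M. 1 / ?q ^ card (I \<inter> C k) \<le> solution_prob V S (C k)"
    using basis_of_chain[OF V, where C = C and S = S and n = M] by blast
  have IA: "I \<subseteq> A" using I(1) lev by (auto simp: C_def)
  have finI: "finite I" using IA A finite_subset by blast
  have I3: "1 / ?q ^ card (I \<inter> level X k) \<le> solution_prob V S (level X k)" if "k < M" for k
    using I(3)[rule_format, of "M - k"] that by (simp add: C_def)
  define Y where "Y = X \<inter> I \<times> {..<M}"
  define R where "R = I \<times> {..<M} - Y"
  have Y: "Y \<subseteq> I \<times> {..<M}" by (auto simp: Y_def)
  have finR: "finite R" using finI by (simp add: R_def)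
  have YR: "Y \<union> R = I \<times> {..<M}" using Y by (auto simp: R_def)
  have cardR: "card R + card Y = M * card I"
  proof -
    have "card Y \<le> card (I \<times> {..<M})" by (rule card_mono) (use finI Y in auto)
    moreover have "card R = card (I \<times> {..<M}) - card Y"
      unfolding R_def using finI Y by (intro card_Diff_subset) (auto intro: finite_subset)
    ultimately have "card R + card Y = card (I \<times> {..<M})" by simp
    then show ?thesis by (simp add: card_cartesian_product mult.commute)
  qed
  have "solution_prob U T X \<le> solution_prob U T Y"
    by (rule solution_prob_antimono[OF U]) (auto simp: Y_def)
  also have "\<dots> \<le> solution_prob U T (I \<times> {..<M}) * ?q ^ card R"
    using solution_prob_union_ge[OF U finR, of T Y] YR by simp
  also have "\<dots> = ?q ^ (M * card I) * solution_prob U T (I \<times> {..<M}) * (1 / ?q ^ card Y)"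
    using q unfolding cardR[symmetric] by (simp add: power_add)
  also have "1 / ?q ^ card Y = (\<Prod>k<M. 1 / ?q ^ card (I \<inter> level X k))"
    unfolding Y_def card_fiber_sum[OF finI X, symmetric] by (simp add: power_sum prod_dividef)
  also have "?q ^ (M * card I) * solution_prob U T (I \<times> {..<M}) * (\<Prod>k<M. 1 / ?q ^ card (I \<inter> level X k))
      \<le> lift_defect V A S M U T * (\<Prod>k<M. solution_prob V S (level X k))"
  proof (rule mult_mono)
    have "finite {I. I \<subseteq> A \<and> independent_columns V S I}"
      by (rule finite_subset[of _ "Pow A"]) (use A in auto)
    then show "?q ^ (M * card I) * solution_prob U T (I \<times> {..<M}) \<le> lift_defect V A S M U T"
      unfolding lift_defect_def
      using IA I(2) less_imp_le[OF solution_prob_pos[OF U]]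
      by (intro member_le_sum) (auto intro!: mult_nonneg_nonneg)
    show "0 \<le> lift_defect V A S M U T"
      unfolding lift_defect_def using solution_prob_pos[OF U, of T]
      by (intro sum_nonneg mult_nonneg_nonneg less_imp_le) auto
    show "(\<Prod>k<M. 1 / ?q ^ card (I \<inter> level X k)) \<le> (\<Prod>k<M. solution_prob V S (level X k))"
      by (rule prod_mono) (use I3 in auto)
    show "0 \<le> (\<Prod>k<M. 1 / ?q ^ card (I \<inter> level X k))" by (rule prod_nonneg) auto
  qed
  finally show ?thesis .
qed

lemma lift_defect_pos:
  assumes "finite V" "finite A" "finite U"
  shows "0 < lift_defect V A S M U T"
proof -
  have "finite {I. I \<subseteq> A \<and> independent_columns V S I}"
    by (rule finite_subset[of _ "Pow A"]) (use assms in auto)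
  then show ?thesis
    unfolding lift_defect_def using solution_prob_pos[OF assms(3), of T] independent_columns_empty[OF assms(1), of S]
    by (intro sum_pos mult_pos_pos) auto
qed

text \<open>An instance of \<open>sum_le_power_of_level_bound\<close>: \<open>f\<close> consists of
  the terms of the expansion for \<open>S\<close>, and \<open>g\<close> of those for
  \<open>T\<close> divided by the defect. The division turns \<open>solution_prob_lift_le\<close>
  into the level bound and preserves log-supermodularity. Strict positivity of \<open>J\<close>
  makes every weight \<open>exp (J \<alpha>) - 1\<close> positive, as the logarithms in the level
  argument require.\<close>

theorem potts_partition_function_lift_le:
  fixes S :: "'v \<Rightarrow> 'a \<Rightarrow> 'k::{field,finite}" and T :: "'u \<Rightarrow> 'a \<times> nat \<Rightarrow> 'k"
  assumes V: "finite V" and A: "finite A" and U: "finite U" and J: "\<And>\<alpha>. \<alpha> \<in> A \<Longrightarrow> 0 < J \<alpha>"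
  shows "potts_partition_function U (A \<times> {..<M}) T (J \<circ> fst)
    \<le> lift_defect V A S M U T * potts_partition_function V A S J ^ M"
proof -
  define w where "w \<alpha> = exp (J \<alpha>) - 1" for \<alpha>
  have w: "0 < w \<alpha>" if "\<alpha> \<in> A" for \<alpha> using J[OF that] by (simp add: w_def)
  define D where "D = lift_defect V A S M U T"
  have D: "0 < D" unfolding D_def by (rule lift_defect_pos[OF V A U])
  define f where "f B = (\<Prod>\<alpha>\<in>B. w \<alpha>) * solution_prob V S B" for B
  define g where "g X = (\<Prod>x\<in>X. w (fst x)) * solution_prob U T X / D" for X
  have wpos: "0 < (\<Prod>x\<in>X. w (fst x))" if "X \<subseteq> A \<times> {..<M}" for X
    using that w by (intro prod_pos) auto
  have fin: "finite X" if "X \<subseteq> A \<times> {..<M}" for X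
    using that A finite_subset by blast
  have "(\<Sum>X\<in>Pow (A \<times> {..<M}). g X) \<le> (\<Sum>B\<in>Pow A. f B) ^ M"
  proof (rule sum_le_power_of_level_bound[OF A])
    show "0 < f B" if "B \<subseteq> A" for B
      unfolding f_def using that w solution_prob_pos[OF V, of S B] by (intro mult_pos_pos prod_pos) auto
    show "0 < g X" if "X \<subseteq> A \<times> {..<M}" for X
      unfolding g_def using wpos[OF that] solution_prob_pos[OF U, of T X] D by simp
    show "log_supermodular_on (A \<times> {..<M}) g"
      unfolding log_supermodular_on_def
    proof (intro allI impI)
      fix X Y assume XY: "X \<subseteq> A \<times> {..<M}" "Y \<subseteq> A \<times> {..<M}"
      define W where "W X = (\<Prod>x\<in>X. w (fst x))" for X :: "('a \<times> nat) set"
      have W: "W X * W Y = W (X \<union> Y) * W (X \<inter> Y)"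
        unfolding W_def using fin XY by (simp add: prod.union_inter)
      have "g X * g Y = (W X * W Y) * (solution_prob U T X * solution_prob U T Y) / (D * D)"
        by (simp add: g_def W_def)
      also have "\<dots> \<le> (W X * W Y) * (solution_prob U T (X \<union> Y) * solution_prob U T (X \<inter> Y)) / (D * D)"
        using log_supermodular_onD[OF log_supermodular_on_solution_prob[OF U, of UNIV T], of X Y]
          wpos[OF XY(1)] wpos[OF XY(2)] D
        by (intro divide_right_mono mult_left_mono) (auto simp: W_def)
      also have "\<dots> = g (X \<union> Y) * g (X \<inter> Y)" unfolding W by (simp add: g_def W_def)
      finally show "g X * g Y \<le> g (X \<union> Y) * g (X \<inter> Y)" .
    qed
    fix X assume X: "X \<subseteq> A \<times> {..<M}"
    have "g X \<le> (\<Prod>x\<in>X. w (fst x)) * (D * (\<Prod>k<M. solution_prob V S (level X k))) / D"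
      unfolding g_def D_def using solution_prob_lift_le[OF V A U X, where S = S and T = T] wpos[OF X] D
      by (intro divide_right_mono mult_left_mono) (auto simp: D_def)
    also have "\<dots> = (\<Prod>k<M. f (level X k))"
      using D unfolding f_def prod.distrib prod_levels[OF A X] by simp
    finally show "g X \<le> (\<Prod>k<M. f (level X k))" .
  qed
  moreover have "potts_partition_function V A S J = (\<Sum>B\<in>Pow A. f B)"
    by (simp add: potts_partition_function_expand[OF V A] f_def w_def)
  moreover have "potts_partition_function U (A \<times> {..<M}) T (J \<circ> fst) = D * (\<Sum>X\<in>Pow (A \<times> {..<M}). g X)"
    using A D unfolding sum_distrib_left by (simp add: potts_partition_function_expand[OF U] g_def w_def)
  ultimately show ?thesis using D by (simp add: D_def mult_left_mono)
qed

section \<open>Sequences of a given type\<close>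

definition occurrences :: "nat \<Rightarrow> (nat \<Rightarrow> 'x) \<Rightarrow> 'x \<Rightarrow> nat" where
  "occurrences M y a = card {m \<in> {..<M}. y m = a}"

definition seqs_of_type :: "nat \<Rightarrow> 'x set \<Rightarrow> ('x \<Rightarrow> nat) \<Rightarrow> (nat \<Rightarrow> 'x) set" where
  "seqs_of_type M X t = {y \<in> {..<M} \<rightarrow>\<^sub>E X. \<forall>a\<in>X. occurrences M y a = t a}"

definition perms :: "nat \<Rightarrow> (nat \<Rightarrow> nat) set" where
  "perms M = {p. p permutes {..<M}}"

lemma finite_perms [simp]: "finite (perms M)"
  unfolding perms_def by (intro finite_permutations) simp

lemma card_perms: "card (perms M) = fact M"
  unfolding perms_def by (rule card_permutations) auto

lemma perms_lt: "p \<in> perms M \<Longrightarrow> m < M \<Longrightarrow> p m < M"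
  unfolding perms_def using permutes_in_image[of p "{..<M}" m] by auto

lemma finite_seqs_of_type [simp]: "finite X \<Longrightarrow> finite (seqs_of_type M X t)"
  unfolding seqs_of_type_def by (intro finite_subset[OF _ finite_PiE[of "{..<M}" "\<lambda>_. X"]]) auto

lemma count_mset_map_upt: "count (mset (map y [0..<M])) a = occurrences M y a"
proof -
  have "count (mset (map y [0..<M])) a = length (filter (\<lambda>b. a = b) (map y [0..<M]))"
    by (simp only: count_mset count_list_eq_length_filter)
  also have "\<dots> = card {i. i < length (map y [0..<M]) \<and> a = map y [0..<M] ! i}"
    by (rule length_filter_conv_card)
  also have "{i. i < length (map y [0..<M]) \<and> a = map y [0..<M] ! i} = {m \<in> {..<M}. y m = a}"
    by auto
  finally show ?thesis by (simp add: occurrences_def)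
qed

lemma card_seqs_of_type:
  assumes X: "finite X" and t: "(\<Sum>a\<in>X. t a) = M"
  shows "card (seqs_of_type M X t) * (\<Prod>a\<in>X. fact (t a)) = (fact M :: nat)"
proof -
  define A where "A = (\<Sum>a\<in>X. replicate_mset (t a) a)"
  have count: "count A a = (if a \<in> X then t a else 0)" for a
    unfolding A_def count_sum using X by (simp add: if_distrib sum.delta cong: if_cong)
  have setA: "set_mset A = {a \<in> X. t a \<noteq> 0}"
    using count by (auto simp flip: count_greater_zero_iff split: if_splits)
  have size: "size A = M" unfolding A_def by (simp add: t flip: t)
  have "bij_betw (\<lambda>y. map y [0..<M]) (seqs_of_type M X t) (permutations_of_multiset A)"
    unfolding bij_betw_def
  proof
    show "inj_on (\<lambda>y. map y [0..<M]) (seqs_of_type M X t)"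
    proof (rule inj_onI)
      fix y z assume y: "y \<in> seqs_of_type M X t" and z: "z \<in> seqs_of_type M X t"
        and eq: "map y [0..<M] = map z [0..<M]"
      have "y m = z m" if "m \<in> {..<M}" for m using eq that by (auto simp: map_eq_conv)
      then show "y = z" using y z PiE_ext[of y "{..<M}" "\<lambda>_. X" z] by (auto simp: seqs_of_type_def)
    qed
    show "(\<lambda>y. map y [0..<M]) ` seqs_of_type M X t = permutations_of_multiset A"
    proof (intro equalityI subsetI)
      fix xs assume "xs \<in> (\<lambda>y. map y [0..<M]) ` seqs_of_type M X t"
      then obtain y where y: "y \<in> seqs_of_type M X t" and xs: "xs = map y [0..<M]" by auto
      have "mset xs = A"
      proof (rule multiset_eqI)
        fix a
        have "occurrences M y a = (if a \<in> X then t a else 0)"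
        proof (cases "a \<in> X")
          case False
          then have "{m \<in> {..<M}. y m = a} = {}" using y by (auto simp: seqs_of_type_def PiE_def Pi_def)
          then show ?thesis using False by (simp add: occurrences_def)
        qed (use y in \<open>auto simp: seqs_of_type_def\<close>)
        then show "count (mset xs) a = count A a"
          unfolding xs count_mset_map_upt count .
      qed
      then show "xs \<in> permutations_of_multiset A" by (rule permutations_of_multisetI)
    next
      fix xs assume "xs \<in> permutations_of_multiset A"
      then have xs: "mset xs = A" by (rule permutations_of_multisetD)
      have len: "length xs = M" using xs size by (metis size_mset)
      define y where "y = (\<lambda>m\<in>{..<M}. xs ! m)"
      have map: "map y [0..<M] = xs"
        using len by (intro nth_equalityI) (auto simp: y_def)
      have "set xs \<subseteq> X" using setA xs by (metis (no_types, lifting) mem_Collect_eq set_mset_mset subsetI)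
      then have "y m \<in> X" if "m < M" for m using that len by (auto simp: y_def)
      then have "y \<in> {..<M} \<rightarrow>\<^sub>E X" by (auto simp: y_def)
      moreover have "occurrences M y a = t a" if "a \<in> X" for a
        using that count[of a] unfolding count_mset_map_upt[symmetric] map xs by simp
      ultimately have "y \<in> seqs_of_type M X t" by (simp add: seqs_of_type_def)
      then show "xs \<in> (\<lambda>y. map y [0..<M]) ` seqs_of_type M X t" using map by force
    qed
  qed
  then have "card (seqs_of_type M X t) = fact (size A) div (\<Prod>x\<in>set_mset A. fact (count A x))"
    using card_permutations_of_multiset(1)[of A] by (simp add: bij_betw_same_card)
  moreover have "(\<Prod>x\<in>set_mset A. fact (count A x)) = (\<Prod>a\<in>X. fact (t a) :: nat)"
    unfolding setA using X count by (intro prod.mono_neutral_cong_left) auto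
  ultimately show ?thesis
    using card_permutations_of_multiset(2)[of A] size by simp
qed

lemma card_seqs_of_type_pos:
  assumes "finite X" "(\<Sum>a\<in>X. t a) = M"
  shows "0 < card (seqs_of_type M X t)"
  using card_seqs_of_type[OF assms] by (metis fact_nonzero gr0I mult_0)

lemma occurrences_perm:
  assumes "p \<in> perms M"
  shows "occurrences M (\<lambda>m\<in>{..<M}. y (p m)) a = occurrences M y a"
proof -
  have "bij_betw p {m \<in> {..<M}. y (p m) = a} {m \<in> {..<M}. y m = a}"
  proof -
    have b: "bij_betw p {..<M} {..<M}" using assms by (simp add: perms_def permutes_imp_bij)
    show ?thesis using b unfolding bij_betw_def inj_on_def by auto
  qed
  moreover have "{m \<in> {..<M}. restrict (\<lambda>m. y (p m)) {..<M} m = a} = {m \<in> {..<M}. y (p m) = a}" by auto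
  ultimately show ?thesis unfolding occurrences_def by (simp add: bij_betw_same_card)
qed

lemma exists_perm:
  assumes "\<And>a. occurrences M x a = occurrences M y a"
  shows "\<exists>p\<in>perms M. \<forall>m<M. y m = x (p m)"
proof -
  have "mset (map y [0..<M]) = mset (map x [0..<M])"
    by (rule multiset_eqI) (simp only: count_mset_map_upt assms)
  from mset_eq_permutation[OF this] obtain p where
    p: "p permutes {..<M}" "permute_list p (map x [0..<M]) = map y [0..<M]" by auto
  have "y m = x (p m)" if m: "m < M" for m
  proof -
    have "p m < M" using p(1) m permutes_in_image[of p "{..<M}" m] by simp
    moreover have "permute_list p (map x [0..<M]) ! m = map x [0..<M] ! p m"
      by (rule permute_list_nth) (use p m in auto)
    ultimately show ?thesis unfolding p(2) using m by simp
  qed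
  then show ?thesis using p(1) by (auto simp: perms_def)
qed

text \<open>Rearranging positions acts transitively on a type class. Composition with a permutation
  taking \<open>z\<close> to \<open>z'\<close> injects the permutations reaching \<open>z\<close>
  into those reaching \<open>z'\<close>, so all \<open>fact M\<close> permutations are spread evenly
  over the class.\<close>

lemma card_perms_onto:
  assumes X: "finite X" and x: "x \<in> seqs_of_type M X t" and y: "y \<in> seqs_of_type M X t"
  shows "card {p \<in> perms M. \<forall>m<M. x (p m) = y m} * card (seqs_of_type M X t) = fact M"
proof -
  define N where "N z = {p \<in> perms M. \<forall>m<M. x (p m) = z m}" for z
  have xX: "x \<in> {..<M} \<rightarrow>\<^sub>E X" using x by (simp add: seqs_of_type_def)
  have occ: "occurrences M z a = occurrences M x a" if "z \<in> seqs_of_type M X t" for z a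
  proof (cases "a \<in> X")
    case True then show ?thesis using that x by (simp add: seqs_of_type_def)
  next
    case False
    then have "{m \<in> {..<M}. z m = a} = {}" "{m \<in> {..<M}. x m = a} = {}"
      using that x by (auto simp: seqs_of_type_def PiE_def Pi_def)
    then show ?thesis unfolding occurrences_def by metis
  qed
  have le: "card (N z) \<le> card (N z')" if z: "z \<in> seqs_of_type M X t" "z' \<in> seqs_of_type M X t" for z z'
  proof -
    obtain s where s: "s \<in> perms M" "\<forall>m<M. z' m = z (s m)"
      using exists_perm[of M z z'] occ z by metis
    have ss: "s permutes {..<M}" using s(1) by (simp add: perms_def)
    have "inj_on (\<lambda>p. p \<circ> s) (N z)"
    proof (rule inj_onI)
      fix p p' assume "p \<circ> s = p' \<circ> s"
      then have "p \<circ> s \<circ> inv s = p' \<circ> s \<circ> inv s" by simp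
      then show "p = p'" using permutes_inv_o(1)[OF ss] by (simp add: o_assoc[symmetric])
    qed
    moreover have "(\<lambda>p. p \<circ> s) ` N z \<subseteq> N z'"
      using s ss perms_lt[OF s(1)] by (auto simp: N_def perms_def intro: permutes_compose)
    moreover have "finite (N z')" by (simp add: N_def)
    ultimately show ?thesis by (rule card_inj_on_le)
  qed
  have eq: "card (N z) = card (N y)" if "z \<in> seqs_of_type M X t" for z
    using le that y by (simp add: antisym)
  have "perms M = (\<Union>z\<in>seqs_of_type M X t. N z)"
  proof (intro equalityI subsetI)
    fix p assume p: "p \<in> perms M"
    define z where "z = (\<lambda>m\<in>{..<M}. x (p m))"
    have "z \<in> {..<M} \<rightarrow>\<^sub>E X" using xX perms_lt[OF p] by (auto simp: z_def)
    then have "z \<in> seqs_of_type M X t"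
      using x occurrences_perm[OF p, of x] by (simp add: seqs_of_type_def z_def)
    moreover have "p \<in> N z" using p by (simp add: N_def z_def)
    ultimately show "p \<in> (\<Union>z\<in>seqs_of_type M X t. N z)" by blast
  qed (auto simp: N_def)
  then have "fact M = card (\<Union>z\<in>seqs_of_type M X t. N z)" using card_perms by metis
  also have "\<dots> = (\<Sum>z\<in>seqs_of_type M X t. card (N z))"
  proof (rule card_UN_disjoint)
    show "\<forall>z\<in>seqs_of_type M X t. \<forall>z'\<in>seqs_of_type M X t. z \<noteq> z' \<longrightarrow> N z \<inter> N z' = {}"
    proof (intro ballI impI)
      fix z z' assume z: "z \<in> seqs_of_type M X t" "z' \<in> seqs_of_type M X t" "z \<noteq> z'"
      show "N z \<inter> N z' = {}"
      proof (rule ccontr)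
        assume "N z \<inter> N z' \<noteq> {}"
        then have "z m = z' m" if "m \<in> {..<M}" for m using that by (auto simp: N_def)
        then show False using z PiE_ext[of z "{..<M}" "\<lambda>_. X" z'] by (auto simp: seqs_of_type_def)
      qed
    qed
  qed (use X in \<open>auto simp: N_def\<close>)
  also have "\<dots> = card (seqs_of_type M X t) * card (N y)" using eq by simp
  finally show ?thesis by (simp add: N_def mult.commute)
qed

text \<open>Here \<open>y\<close> is arbitrary: either it is a rearrangement of \<open>x\<close> on
  the first \<open>M\<close> positions and \<open>card_perms_onto\<close> applies, or no permutation
  reaches it.\<close>

lemma card_perms_onto_le:
  fixes x :: "nat \<Rightarrow> 'x::finite"
  assumes x: "x \<in> configs {..<M}"
  shows "real (card {p \<in> perms M. \<forall>m<M. x (p m) = y m})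
    \<le> fact M / real (card (seqs_of_type M UNIV (occurrences M x)))"
proof -
  let ?T = "seqs_of_type M UNIV (occurrences M x)"
  have xT: "x \<in> ?T" using x by (simp add: seqs_of_type_def configs_def)
  have pos: "0 < card ?T" using xT by (auto simp: card_gt_0_iff)
  show ?thesis
  proof (cases "{p \<in> perms M. \<forall>m<M. x (p m) = y m} = {}")
    case True
    then show ?thesis unfolding True by simp
  next
    case False
    then obtain p where p: "p \<in> perms M" "\<forall>m<M. x (p m) = y m" by blast
    define z where "z = (\<lambda>m\<in>{..<M}. x (p m))"
    have "z \<in> ?T" using occurrences_perm[OF p(1), of x] by (simp add: seqs_of_type_def z_def)
    from card_perms_onto[OF _ xT this]
    have "card {p \<in> perms M. \<forall>m<M. x (p m) = z m} * card ?T = fact M" by simp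
    moreover have "{p \<in> perms M. \<forall>m<M. x (p m) = z m} = {p \<in> perms M. \<forall>m<M. x (p m) = y m}"
      using p(2) by (auto simp: z_def)
    ultimately have "card {p \<in> perms M. \<forall>m<M. x (p m) = y m} * card ?T = fact M" by simp
    then have "real (card {p \<in> perms M. \<forall>m<M. x (p m) = y m} * card ?T) = real (fact M)"
      by (simp only:)
    then have "real (card {p \<in> perms M. \<forall>m<M. x (p m) = y m}) * real (card ?T) = fact M"
      by simp
    then show ?thesis using pos by (simp add: field_simps)
  qed
qed

text \<open>The sum counts the types, each of which occurs at most \<open>M\<close> times per letter.\<close>

lemma sum_inverse_card_seqs_of_type:
  "(\<Sum>x\<in>(configs {..<M} :: (nat \<Rightarrow> 'x::finite) set). 1 / real (card (seqs_of_type M UNIV (occurrences M x))))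
    \<le> real (M + 1) ^ CARD('x)"
proof -
  define R :: "('x \<Rightarrow> nat) set" where "R = (UNIV \<rightarrow>\<^sub>E {..M})"
  have occR: "occurrences M x \<in> R" for x :: "nat \<Rightarrow> 'x"
    unfolding R_def occurrences_def using card_mono[of "{..<M}" "{m \<in> {..<M}. x m = _}"] by auto
  have "(\<Sum>x\<in>(configs {..<M} :: (nat \<Rightarrow> 'x) set). 1 / real (card (seqs_of_type M UNIV (occurrences M x))))
    = (\<Sum>t\<in>R. \<Sum>x\<in>{x \<in> configs {..<M}. occurrences M x = t}. 1 / real (card (seqs_of_type M UNIV (occurrences M x))))"
    using occR by (intro sum.group[symmetric]) (auto simp: R_def intro!: finite_PiE)
  also have "\<dots> \<le> (\<Sum>t\<in>R. 1)"
  proof (intro sum_mono)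
    fix t :: "'x \<Rightarrow> nat"
    have eq: "{x \<in> configs {..<M}. occurrences M x = t} = seqs_of_type M UNIV t"
      unfolding seqs_of_type_def configs_def by auto
    have "(\<Sum>x\<in>{x \<in> configs {..<M}. occurrences M x = t}. 1 / real (card (seqs_of_type M UNIV (occurrences M x))))
      = (\<Sum>x\<in>seqs_of_type M UNIV t. 1 / real (card (seqs_of_type M UNIV t)))"
      by (intro sum.cong) (auto simp: eq[symmetric])
    also have "\<dots> \<le> 1" by simp
    finally show "(\<Sum>x\<in>{x \<in> configs {..<M}. occurrences M x = t}. 1 / real (card (seqs_of_type M UNIV (occurrences M x)))) \<le> 1" .
  qed
  also have "(\<Sum>t\<in>R. 1 :: real) = real (M + 1) ^ CARD('x)"
    by (simp add: R_def card_PiE)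
  finally show ?thesis .
qed

section \<open>Random covers\<close>

text \<open>Every pair of a column and a row has its own permutation. The covers are thus a full
  product, and averages over them factor over columns and, within a column, over rows.\<close>

definition covers :: "'v set \<Rightarrow> 'a set \<Rightarrow> nat \<Rightarrow> ('a \<Rightarrow> 'v \<Rightarrow> nat \<Rightarrow> nat) set" where
  "covers V A M = (A \<rightarrow>\<^sub>E (V \<rightarrow>\<^sub>E perms M))"

definition cover_matrix ::
  "('v \<Rightarrow> 'a \<Rightarrow> 'k::{field,finite}) \<Rightarrow> ('a \<Rightarrow> 'v \<Rightarrow> nat \<Rightarrow> nat) \<Rightarrow> 'v \<times> nat \<Rightarrow> 'a \<times> nat \<Rightarrow> 'k" where
  "cover_matrix S c = (\<lambda>(i, m') (\<alpha>, m). if m' = c \<alpha> i m then S i \<alpha> else 0)"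

lemma finite_perm_families [simp]: "finite V \<Longrightarrow> finite (V \<rightarrow>\<^sub>E perms M)"
  by (intro finite_PiE) auto

lemma finite_covers [simp]: "finite V \<Longrightarrow> finite A \<Longrightarrow> finite (covers V A M)"
  unfolding covers_def by (intro finite_PiE) auto

lemma card_perm_families: "finite V \<Longrightarrow> card (V \<rightarrow>\<^sub>E perms M) = fact M ^ card V"
  by (simp add: card_PiE card_perms)

lemma card_covers: "finite V \<Longrightarrow> finite A \<Longrightarrow> card (covers V A M) = fact M ^ (card V * card A)"
  unfolding covers_def by (simp add: card_PiE card_perms power_mult)

lemma linear_form_cover_matrix:
  assumes "finite V" "c \<in> covers V A M" "\<alpha> \<in> A" "m < M"
  shows "linear_form (V \<times> {..<M}) (cover_matrix S c) (\<alpha>, m) x = (\<Sum>i\<in>V. S i \<alpha> * x (i, c \<alpha> i m))"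
proof -
  have c: "c \<alpha> i m < M" if "i \<in> V" for i
  proof -
    have "c \<alpha> i \<in> perms M" using assms(2,3) that unfolding covers_def by blast
    then show ?thesis using assms(4) by (rule perms_lt)
  qed
  have "linear_form (V \<times> {..<M}) (cover_matrix S c) (\<alpha>, m) x
    = (\<Sum>i\<in>V. \<Sum>m'<M. if m' = c \<alpha> i m then S i \<alpha> * x (i, m') else 0)"
    unfolding linear_form_def cover_matrix_def sum.cartesian_product
    by (intro sum.cong) auto
  also have "\<dots> = (\<Sum>i\<in>V. S i \<alpha> * x (i, c \<alpha> i m))"
    using c by (intro sum.cong refl) simp
  finally show ?thesis .
qed

section \<open>Averages over covers: bounds from above\<close>

lemma sum_configs_Times:
  fixes h :: "('v \<Rightarrow> 'w \<Rightarrow> 'x::finite) \<Rightarrow> real"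
  shows "(\<Sum>x\<in>configs (V \<times> W). h (\<lambda>i\<in>V. \<lambda>m\<in>W. x (i, m))) = (\<Sum>z\<in>V \<rightarrow>\<^sub>E configs W. h z)"
proof (rule sum.reindex_bij_witness[where j = "\<lambda>x. \<lambda>i\<in>V. \<lambda>m\<in>W. x (i, m)"
      and i = "\<lambda>z. \<lambda>u\<in>V \<times> W. z (fst u) (snd u)"])
  fix x :: "'v \<times> 'w \<Rightarrow> 'x" assume x: "x \<in> configs (V \<times> W)"
  show "(\<lambda>u\<in>V \<times> W. (\<lambda>i\<in>V. \<lambda>m\<in>W. x (i, m)) (fst u) (snd u)) = x"
    using x by (intro configs_ext[of _ "V \<times> W"] restrict_in_configs) auto
  show "(\<lambda>i\<in>V. \<lambda>m\<in>W. x (i, m)) \<in> V \<rightarrow>\<^sub>E configs W" by auto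
next
  fix z :: "'v \<Rightarrow> 'w \<Rightarrow> 'x" assume z: "z \<in> V \<rightarrow>\<^sub>E configs W"
  show "(\<lambda>i\<in>V. \<lambda>m\<in>W. (\<lambda>u\<in>V \<times> W. z (fst u) (snd u)) (i, m)) = z"
  proof (rule PiE_ext[of _ V "\<lambda>_. configs W"])
    fix i assume i: "i \<in> V"
    have "(\<lambda>m\<in>W. (\<lambda>u\<in>V \<times> W. z (fst u) (snd u)) (i, m)) = z i"
      using z i by (intro configs_ext[of _ W] restrict_in_configs) auto
    then show "(\<lambda>i\<in>V. \<lambda>m\<in>W. (\<lambda>u\<in>V \<times> W. z (fst u) (snd u)) (i, m)) i = z i" using i by simp
  qed (use z in auto)
  show "(\<lambda>u\<in>V \<times> W. z (fst u) (snd u)) \<in> configs (V \<times> W)" by simp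
qed simp

lemma sum_PiE_insert:
  fixes h :: "('i \<Rightarrow> 'b) \<Rightarrow> real"
  assumes "i \<notin> V"
  shows "(\<Sum>p\<in>Pi\<^sub>E (insert i V) B. h p) = (\<Sum>p\<in>Pi\<^sub>E V B. \<Sum>b\<in>B i. h (p(i := b)))"
proof -
  have "(\<Sum>p\<in>Pi\<^sub>E (insert i V) B. h p) = (\<Sum>(b, p)\<in>B i \<times> Pi\<^sub>E V B. h (p(i := b)))"
    unfolding PiE_insert_eq using sum.reindex[OF inj_combinator[OF assms], of h B]
    by (simp add: case_prod_unfold comp_def)
  also have "\<dots> = (\<Sum>b\<in>B i. \<Sum>p\<in>Pi\<^sub>E V B. h (p(i := b)))"
    by (simp add: sum.cartesian_product)
  also have "\<dots> = (\<Sum>p\<in>Pi\<^sub>E V B. \<Sum>b\<in>B i. h (p(i := b)))" by (rule sum.swap)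
  finally show ?thesis .
qed

text \<open>
  For one column, once all permutations but the one of a row \<open>g\<close> with \<open>S g \<alpha> \<noteq> 0\<close> are chosen, the
  forms prescribe the rearrangement of \<open>z g\<close>.
\<close>

lemma count_annihilating_perms:
  fixes S :: "'v \<Rightarrow> 'a \<Rightarrow> 'k::{field,finite}"
  assumes V: "finite V" and g: "g \<in> V" "S g \<alpha> \<noteq> 0" and z: "z g \<in> configs {..<M}"
  shows "real (card {p \<in> V \<rightarrow>\<^sub>E perms M. \<forall>m<M. (\<Sum>i\<in>V. S i \<alpha> * z i (p i m)) = 0})
    \<le> fact M ^ card V / real (card (seqs_of_type M UNIV (occurrences M (z g))))"
proof -
  define V' where "V' = V - {g}"
  have VV': "V = insert g V'" "g \<notin> V'" "finite V'" using V g by (auto simp: V'_def)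
  define ok where "ok p \<longleftrightarrow> (\<forall>m<M. (\<Sum>i\<in>V. S i \<alpha> * z i (p i m)) = 0)" for p
  have "real (card {p \<in> V \<rightarrow>\<^sub>E perms M. ok p}) = (\<Sum>p\<in>V \<rightarrow>\<^sub>E perms M. if ok p then 1 else 0)"
    using V by (simp add: sum.If_cases Collect_conj_eq)
  also have "\<dots> = (\<Sum>p\<in>V' \<rightarrow>\<^sub>E perms M. \<Sum>b\<in>perms M. if ok (p(g := b)) then 1 else 0)"
    unfolding VV'(1) by (rule sum_PiE_insert[OF VV'(2)])
  also have "\<dots> \<le> (\<Sum>p\<in>V' \<rightarrow>\<^sub>E perms M. fact M / real (card (seqs_of_type M UNIV (occurrences M (z g)))))"
  proof (rule sum_mono)
    fix p assume "p \<in> V' \<rightarrow>\<^sub>E perms M"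
    define y where "y m = - (\<Sum>i\<in>V'. S i \<alpha> * z i (p i m)) / S g \<alpha>" for m
    have "ok (p(g := b)) \<longleftrightarrow> (\<forall>m<M. z g (b m) = y m)" for b
    proof -
      have "(\<Sum>i\<in>V. S i \<alpha> * z i ((p(g := b)) i m)) = S g \<alpha> * z g (b m) + (\<Sum>i\<in>V'. S i \<alpha> * z i (p i m))" for m
        unfolding VV'(1) using VV'(2,3) by (simp add: sum.insert) (intro sum.cong, auto)
      then show ?thesis
        unfolding ok_def y_def using g(2) by (simp add: field_simps eq_neg_iff_add_eq_0 add.commute)
    qed
    then have "(\<Sum>b\<in>perms M. if ok (p(g := b)) then 1 else 0) = real (card {b \<in> perms M. \<forall>m<M. z g (b m) = y m})"
      by (simp add: sum.If_cases Collect_conj_eq)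
    then show "(\<Sum>b\<in>perms M. if ok (p(g := b)) then 1 else 0)
        \<le> fact M / real (card (seqs_of_type M UNIV (occurrences M (z g))))"
      using card_perms_onto_le[OF z, of y] by simp
  qed
  also have "\<dots> = fact M ^ card V / real (card (seqs_of_type M UNIV (occurrences M (z g))))"
    using VV' by (simp add: card_perm_families)
  finally show ?thesis by (simp add: ok_def)
qed

text \<open>Fix the values \<open>z\<close> on the copies of all rows. Different columns use
  independent permutations, so the probabilities of their conditions multiply, and the column
  \<open>\<alpha>\<close> in \<open>I\<close> is controlled by the type class of
  \<open>z (g \<alpha>)\<close>. As \<open>g\<close> is injective, the sum over \<open>z\<close>
  then factors over the rows: a row chosen by \<open>g\<close> contributes at most the number of
  types, any other row contributes \<open>CARD('k) ^ M\<close>. These powers, together with the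
  factor \<open>CARD('k) ^ (M * card I)\<close> from the defect, cancel the normalisation of
  \<open>solution_prob\<close>.\<close>

lemma sum_covers_solution_prob_le:
  fixes S :: "'v \<Rightarrow> 'a \<Rightarrow> 'k::{field,finite}"
  assumes V: "finite V" and A: "finite A" and I: "I \<subseteq> A" "independent_columns V S I"
  shows "(\<Sum>c\<in>covers V A M. real CARD('k) ^ (M * card I)
      * solution_prob (V \<times> {..<M}) (cover_matrix S c) (I \<times> {..<M}))
    \<le> real (card (covers V A M)) * real (M + 1) ^ (CARD('k) * card I)"
proof -
  let ?q = "real CARD('k)"
  let ?Q = "V \<rightarrow>\<^sub>E perms M"
  have finI: "finite I" using I(1) A finite_subset by blast
  obtain g where g: "inj_on g I" "g ` I \<subseteq> V" "\<And>\<alpha>. \<alpha> \<in> I \<Longrightarrow> S (g \<alpha>) \<alpha> \<noteq> 0"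
    using independent_columns_transversal[OF finI V I(2)] by blast
  have cardgI: "card (g ` I) = card I" using g(1) by (rule card_image)
  have cardI: "card I \<le> card V" using card_mono[OF V g(2)] cardgI by simp
  define ok where "ok z \<alpha> p \<longleftrightarrow> (\<forall>m<M. (\<Sum>i\<in>V. S i \<alpha> * z i (p i m)) = 0)"
    for z :: "'v \<Rightarrow> nat \<Rightarrow> 'k" and \<alpha> and p :: "'v \<Rightarrow> nat \<Rightarrow> nat"
  define T where "T y = card (seqs_of_type M UNIV (occurrences M y))" for y :: "nat \<Rightarrow> 'k"
  have card_sol: "real (card (solutions (V \<times> {..<M}) (cover_matrix S c) (I \<times> {..<M})))
      = (\<Sum>z\<in>V \<rightarrow>\<^sub>E configs {..<M}. \<Prod>\<alpha>\<in>A. if \<alpha> \<in> I \<longrightarrow> ok z \<alpha> (c \<alpha>) then 1 else 0)"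
    if c: "c \<in> covers V A M" for c
  proof -
    define cur where "cur x = (\<lambda>i\<in>V. \<lambda>m\<in>{..<M}. x (i, m))" for x :: "'v \<times> nat \<Rightarrow> 'k"
    have sol: "x \<in> solutions (V \<times> {..<M}) (cover_matrix S c) (I \<times> {..<M})
        \<longleftrightarrow> x \<in> configs (V \<times> {..<M}) \<and> (\<forall>\<alpha>\<in>I. ok (cur x) \<alpha> (c \<alpha>))" for x
    proof -
      have "linear_form (V \<times> {..<M}) (cover_matrix S c) (\<alpha>, m) x = (\<Sum>i\<in>V. S i \<alpha> * cur x i (c \<alpha> i m))"
        if "\<alpha> \<in> I" "m < M" for \<alpha> m
      proof -
        have \<alpha>: "\<alpha> \<in> A" using that I by blast
        have "c \<alpha> i \<in> perms M" if "i \<in> V" for i using c \<alpha> that unfolding covers_def by blast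
        then have "c \<alpha> i m < M" if "i \<in> V" for i using that \<open>m < M\<close> perms_lt by blast
        then show ?thesis
          unfolding linear_form_cover_matrix[OF V c \<alpha> \<open>m < M\<close>] cur_def by (intro sum.cong) auto
      qed
      then show ?thesis unfolding solutions_def ok_def by auto
    qed
    have "real (card (solutions (V \<times> {..<M}) (cover_matrix S c) (I \<times> {..<M})))
      = (\<Sum>x\<in>configs (V \<times> {..<M}). if \<forall>\<alpha>\<in>I. ok (cur x) \<alpha> (c \<alpha>) then 1 else 0)"
    proof -
      have "solutions (V \<times> {..<M}) (cover_matrix S c) (I \<times> {..<M})
        = configs (V \<times> {..<M}) \<inter> {x. \<forall>\<alpha>\<in>I. ok (cur x) \<alpha> (c \<alpha>)}" using sol by blast
      then show ?thesis using V by (simp add: sum.If_cases)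
    qed
    also have "\<dots> = (\<Sum>z\<in>V \<rightarrow>\<^sub>E configs {..<M}. if \<forall>\<alpha>\<in>I. ok z \<alpha> (c \<alpha>) then 1 else 0)"
      unfolding cur_def by (rule sum_configs_Times)
    also have "\<dots> = (\<Sum>z\<in>V \<rightarrow>\<^sub>E configs {..<M}. \<Prod>\<alpha>\<in>A. if \<alpha> \<in> I \<longrightarrow> ok z \<alpha> (c \<alpha>) then 1 else 0)"
    proof (intro sum.cong refl)
      fix z
      show "(if \<forall>\<alpha>\<in>I. ok z \<alpha> (c \<alpha>) then 1 else 0 :: real) = (\<Prod>\<alpha>\<in>A. if \<alpha> \<in> I \<longrightarrow> ok z \<alpha> (c \<alpha>) then 1 else 0)"
      proof (cases "\<forall>\<alpha>\<in>I. ok z \<alpha> (c \<alpha>)")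
        case True then show ?thesis by (auto intro!: prod.neutral[symmetric])
      next
        case False
        then obtain \<alpha> where "\<alpha> \<in> I" "\<not> ok z \<alpha> (c \<alpha>)" by blast
        then have "(\<Prod>\<alpha>\<in>A. if \<alpha> \<in> I \<longrightarrow> ok z \<alpha> (c \<alpha>) then 1 else 0 :: real) = 0"
          using A I(1) by (intro prod_zero) auto
        then show ?thesis using False by simp
      qed
    qed
    finally show ?thesis .
  qed
  have "(\<Sum>c\<in>covers V A M. real (card (solutions (V \<times> {..<M}) (cover_matrix S c) (I \<times> {..<M}))))
      = (\<Sum>c\<in>covers V A M. \<Sum>z\<in>V \<rightarrow>\<^sub>E configs {..<M}. \<Prod>\<alpha>\<in>A. if \<alpha> \<in> I \<longrightarrow> ok z \<alpha> (c \<alpha>) then 1 else 0)"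
    by (rule sum.cong[OF refl card_sol])
  also have "\<dots> = (\<Sum>z\<in>V \<rightarrow>\<^sub>E configs {..<M}. \<Sum>c\<in>covers V A M. \<Prod>\<alpha>\<in>A. if \<alpha> \<in> I \<longrightarrow> ok z \<alpha> (c \<alpha>) then 1 else 0)"
    by (rule sum.swap)
  also have "\<dots> = (\<Sum>z\<in>V \<rightarrow>\<^sub>E configs {..<M}. \<Prod>\<alpha>\<in>A. \<Sum>p\<in>?Q. if \<alpha> \<in> I \<longrightarrow> ok z \<alpha> p then 1 else 0)"
    unfolding covers_def using V A by (subst prod_sum_PiE) auto
  \<comment> \<open>A column outside \<open>I\<close> admits all \<open>fact M ^ card V\<close>
    permutation families. A column in \<open>I\<close> admits at most this number divided by the
    size of the type class of its own transversal row.\<close>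
  also have "\<dots> \<le> (\<Sum>z\<in>V \<rightarrow>\<^sub>E configs {..<M}. \<Prod>\<alpha>\<in>A. fact M ^ card V * (if \<alpha> \<in> I then 1 / real (T (z (g \<alpha>))) else 1))"
  proof (intro sum_mono prod_mono conjI)
    fix z \<alpha> assume z: "z \<in> V \<rightarrow>\<^sub>E (configs {..<M} :: (nat \<Rightarrow> 'k) set)" and \<alpha>: "\<alpha> \<in> A"
    show "0 \<le> (\<Sum>p\<in>?Q. if \<alpha> \<in> I \<longrightarrow> ok z \<alpha> p then 1 else 0 :: real)" by (rule sum_nonneg) simp
    show "(\<Sum>p\<in>?Q. if \<alpha> \<in> I \<longrightarrow> ok z \<alpha> p then 1 else 0)
        \<le> fact M ^ card V * (if \<alpha> \<in> I then 1 / real (T (z (g \<alpha>))) else 1)"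
    proof (cases "\<alpha> \<in> I")
      case True
      have gV: "g \<alpha> \<in> V" using g(2) True by blast
      have "z (g \<alpha>) \<in> configs {..<M}" using z gV by blast
      from count_annihilating_perms[of V "g \<alpha>" S \<alpha> z M, OF V gV g(3)[OF True] this] show ?thesis
        using True V by (simp add: sum.If_cases Collect_conj_eq ok_def T_def)
    next
      case False
      then show ?thesis using V by (simp add: card_perm_families)
    qed
  qed
  also have "\<dots> = fact M ^ (card V * card A)
      * (\<Sum>z\<in>V \<rightarrow>\<^sub>E configs {..<M}. \<Prod>i\<in>V. if i \<in> g ` I then 1 / real (T (z i)) else 1)"
    unfolding sum_distrib_left
  proof (intro sum.cong refl)
    fix z :: "'v \<Rightarrow> nat \<Rightarrow> 'k"
    have "(\<Prod>\<alpha>\<in>A. if \<alpha> \<in> I then 1 / real (T (z (g \<alpha>))) else 1) = (\<Prod>\<alpha>\<in>I. 1 / real (T (z (g \<alpha>))))"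
      using A I(1) by (simp add: prod.If_cases Int_absorb1)
    also have "\<dots> = (\<Prod>i\<in>g ` I. 1 / real (T (z i)))" by (simp add: prod.reindex[OF g(1)])
    also have "\<dots> = (\<Prod>i\<in>V. if i \<in> g ` I then 1 / real (T (z i)) else 1)"
      using V g(2) by (simp add: prod.If_cases Int_absorb1)
    finally show "(\<Prod>\<alpha>\<in>A. fact M ^ card V * (if \<alpha> \<in> I then 1 / real (T (z (g \<alpha>))) else 1))
      = fact M ^ (card V * card A) * (\<Prod>i\<in>V. if i \<in> g ` I then 1 / real (T (z i)) else 1)"
      by (simp add: prod.distrib power_mult)
  qed
  also have "(\<Sum>z\<in>V \<rightarrow>\<^sub>E configs {..<M}. \<Prod>i\<in>V. if i \<in> g ` I then 1 / real (T (z i)) else 1)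
      = (\<Prod>i\<in>V. \<Sum>y\<in>configs {..<M}. if i \<in> g ` I then 1 / real (T y) else 1)"
    using V by (subst prod_sum_PiE) auto
  also have "\<dots> = (\<Prod>i\<in>V. if i \<in> g ` I then (\<Sum>y\<in>configs {..<M}. 1 / real (T y)) else ?q ^ M)"
    by (intro prod.cong) (auto simp: card_configs)
  also have "\<dots> = (\<Sum>y\<in>configs {..<M}. 1 / real (T y)) ^ card I * (?q ^ M) ^ (card V - card I)"
  proof -
    have "V \<inter> {i. i \<in> g ` I} = g ` I" "V \<inter> - {i. i \<in> g ` I} = V - g ` I" using g(2) by auto
    moreover have "card (V - g ` I) = card V - card I"
      using g(2) V cardgI by (simp add: card_Diff_subset finite_subset)
    ultimately show ?thesis using V cardgI by (simp add: prod.If_cases)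
  qed
  also have "fact M ^ (card V * card A) * \<dots>
      \<le> fact M ^ (card V * card A) * ((real (M + 1) ^ CARD('k)) ^ card I * (?q ^ M) ^ (card V - card I))"
    unfolding T_def
    by (intro mult_left_mono mult_right_mono power_mono sum_inverse_card_seqs_of_type sum_nonneg) auto
  finally have main: "(\<Sum>c\<in>covers V A M. real (card (solutions (V \<times> {..<M}) (cover_matrix S c) (I \<times> {..<M}))))
      \<le> fact M ^ (card V * card A) * ((real (M + 1) ^ CARD('k)) ^ card I * (?q ^ M) ^ (card V - card I))" .
  have "(\<Sum>c\<in>covers V A M. ?q ^ (M * card I)
      * solution_prob (V \<times> {..<M}) (cover_matrix S c) (I \<times> {..<M}))
    = ?q ^ (M * card I) / ?q ^ (card V * M)
      * (\<Sum>c\<in>covers V A M. real (card (solutions (V \<times> {..<M}) (cover_matrix S c) (I \<times> {..<M}))))"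
    unfolding sum_distrib_left by (simp add: solution_prob_def card_cartesian_product)
  also have "\<dots> \<le> ?q ^ (M * card I) / ?q ^ (card V * M)
      * (fact M ^ (card V * card A) * ((real (M + 1) ^ CARD('k)) ^ card I * (?q ^ M) ^ (card V - card I)))"
    by (rule mult_left_mono[OF main]) simp
  also have "\<dots> = fact M ^ (card V * card A) * (real (M + 1) ^ CARD('k)) ^ card I"
  proof -
    have "M * card I + M * (card V - card I) = card V * M"
      using cardI by (simp add: algebra_simps diff_mult_distrib2)
    then have "?q ^ (M * card I) * (?q ^ M) ^ (card V - card I) = ?q ^ (card V * M)"
      by (metis power_add power_mult)
    then have "?q ^ (M * card I) / ?q ^ (card V * M) * (?q ^ M) ^ (card V - card I) = 1" by simp
    then show ?thesis by (simp only: mult_ac mult_1_right times_divide_eq_right times_divide_eq_left)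
  qed
  finally show ?thesis using V A by (simp add: card_covers power_mult)
qed

lemma sum_covers_lift_defect_le:
  fixes S :: "'v \<Rightarrow> 'a \<Rightarrow> 'k::{field,finite}"
  assumes V: "finite V" and A: "finite A"
  shows "(\<Sum>c\<in>covers V A M. lift_defect V A S M (V \<times> {..<M}) (cover_matrix S c))
    \<le> real (card (covers V A M)) * (2 ^ card A * real (M + 1) ^ (CARD('k) * card A))"
proof -
  define \<I> where "\<I> = {I. I \<subseteq> A \<and> independent_columns V S I}"
  have "\<I> \<subseteq> Pow A" by (auto simp: \<I>_def)
  then have card: "card \<I> \<le> 2 ^ card A" using A card_mono[of "Pow A" \<I>] by (simp add: card_Pow)
  have "(\<Sum>c\<in>covers V A M. lift_defect V A S M (V \<times> {..<M}) (cover_matrix S c))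
    = (\<Sum>I\<in>\<I>. \<Sum>c\<in>covers V A M. real CARD('k) ^ (M * card I)
      * solution_prob (V \<times> {..<M}) (cover_matrix S c) (I \<times> {..<M}))"
    unfolding lift_defect_def \<I>_def by (rule sum.swap)
  also have "\<dots> \<le> (\<Sum>I\<in>\<I>. real (card (covers V A M)) * real (M + 1) ^ (CARD('k) * card A))"
  proof (rule sum_mono)
    fix I assume "I \<in> \<I>"
    then have I: "I \<subseteq> A" "independent_columns V S I" by (auto simp: \<I>_def)
    have "real (card (covers V A M)) * real (M + 1) ^ (CARD('k) * card I)
        \<le> real (card (covers V A M)) * real (M + 1) ^ (CARD('k) * card A)"
      using card_mono[OF A I(1)] by (intro mult_left_mono power_increasing) auto
    with sum_covers_solution_prob_le[OF V A I]
    show "(\<Sum>c\<in>covers V A M. real CARD('k) ^ (M * card I)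
      * solution_prob (V \<times> {..<M}) (cover_matrix S c) (I \<times> {..<M}))
      \<le> real (card (covers V A M)) * real (M + 1) ^ (CARD('k) * card A)" by (rule order_trans)
  qed
  also have "\<dots> = real (card \<I>) * (real (card (covers V A M)) * real (M + 1) ^ (CARD('k) * card A))" by simp
  also have "\<dots> \<le> 2 ^ card A * (real (card (covers V A M)) * real (M + 1) ^ (CARD('k) * card A))"
    using card by (intro mult_right_mono) (auto simp flip: of_nat_le_iff)
  finally show ?thesis by (simp add: mult_ac)
qed

lemma sum_covers_potts_le:
  fixes S :: "'v \<Rightarrow> 'a \<Rightarrow> 'k::{field,finite}"
  assumes V: "finite V" and A: "finite A" and J: "\<And>\<alpha>. \<alpha> \<in> A \<Longrightarrow> 0 < J \<alpha>"
  shows "(\<Sum>c\<in>covers V A M. potts_partition_function (V \<times> {..<M}) (A \<times> {..<M}) (cover_matrix S c) (J \<circ> fst))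
    \<le> real (card (covers V A M)) * (2 ^ card A * real (M + 1) ^ (CARD('k) * card A))
      * potts_partition_function V A S J ^ M"
proof -
  have nn: "0 \<le> potts_partition_function V A S J"
    unfolding potts_partition_function_def by (intro sum_nonneg mult_nonneg_nonneg prod_nonneg) auto
  have "(\<Sum>c\<in>covers V A M. potts_partition_function (V \<times> {..<M}) (A \<times> {..<M}) (cover_matrix S c) (J \<circ> fst))
    \<le> (\<Sum>c\<in>covers V A M. lift_defect V A S M (V \<times> {..<M}) (cover_matrix S c) * potts_partition_function V A S J ^ M)"
    using V A J by (intro sum_mono potts_partition_function_lift_le) auto
  also have "\<dots> \<le> real (card (covers V A M)) * (2 ^ card A * real (M + 1) ^ (CARD('k) * card A))
      * potts_partition_function V A S J ^ M"
    unfolding sum_distrib_right[symmetric]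
    by (intro mult_right_mono sum_covers_lift_defect_le V A) (use nn in simp)
  finally show ?thesis .
qed

section \<open>Averages over covers: bounds from below\<close>

lemma sum_covers_potts_eq:
  fixes S :: "'v \<Rightarrow> 'a \<Rightarrow> 'k::{field,finite}"
  assumes V: "finite V" and A: "finite A"
  shows "(\<Sum>c\<in>covers V A M. potts_partition_function (V \<times> {..<M}) (A \<times> {..<M}) (cover_matrix S c) (J \<circ> fst))
    = 1 / real CARD('k) ^ (card V * M) * (\<Sum>z\<in>V \<rightarrow>\<^sub>E configs {..<M}. \<Prod>\<alpha>\<in>A. \<Sum>p\<in>V \<rightarrow>\<^sub>E perms M.
        \<Prod>m<M. exp (J \<alpha> * delta0 (\<Sum>i\<in>V. S i \<alpha> * z i (p i m))))"
proof -
  let ?q = "real CARD('k)"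
  define E where "E z \<alpha> p = (\<Prod>m<M. exp (J \<alpha> * delta0 (\<Sum>i\<in>V. S i \<alpha> * z i (p i m))))"
    for z :: "'v \<Rightarrow> nat \<Rightarrow> 'k" and \<alpha> and p :: "'v \<Rightarrow> nat \<Rightarrow> nat"
  have one: "potts_partition_function (V \<times> {..<M}) (A \<times> {..<M}) (cover_matrix S c) (J \<circ> fst)
    = 1 / ?q ^ (card V * M) * (\<Sum>z\<in>V \<rightarrow>\<^sub>E configs {..<M}. \<Prod>\<alpha>\<in>A. E z \<alpha> (c \<alpha>))"
    if c: "c \<in> covers V A M" for c
  proof -
    define cur where "cur x = (\<lambda>i\<in>V. \<lambda>m\<in>{..<M}. x (i, m))" for x :: "'v \<times> nat \<Rightarrow> 'k"
    have "(\<Prod>\<beta>\<in>A \<times> {..<M}. exp ((J \<circ> fst) \<beta> * delta0 (\<Sum>u\<in>V \<times> {..<M}. cover_matrix S c u \<beta> * x u)))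
        = (\<Prod>\<alpha>\<in>A. E (cur x) \<alpha> (c \<alpha>))" for x
    proof -
      have "(\<Sum>u\<in>V \<times> {..<M}. cover_matrix S c u (\<alpha>, m) * x u) = (\<Sum>i\<in>V. S i \<alpha> * cur x i (c \<alpha> i m))"
        if \<alpha>: "\<alpha> \<in> A" and m: "m < M" for \<alpha> m
      proof -
        have "c \<alpha> i \<in> perms M" if "i \<in> V" for i using c \<alpha> that unfolding covers_def by blast
        then have "c \<alpha> i m < M" if "i \<in> V" for i using that m perms_lt by blast
        then show ?thesis
          using linear_form_cover_matrix[OF V c \<alpha> m, of S x]
          by (simp add: linear_form_def cur_def)
      qed
      then show ?thesis
        unfolding E_def prod.cartesian_product by (intro prod.cong) auto
    qed
    then have "potts_partition_function (V \<times> {..<M}) (A \<times> {..<M}) (cover_matrix S c) (J \<circ> fst)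
        = 1 / ?q ^ (card V * M) * (\<Sum>x\<in>configs (V \<times> {..<M}). \<Prod>\<alpha>\<in>A. E (cur x) \<alpha> (c \<alpha>))"
      unfolding potts_partition_function_def sum_distrib_left by (simp add: card_cartesian_product)
    also have "(\<Sum>x\<in>configs (V \<times> {..<M}). \<Prod>\<alpha>\<in>A. E (cur x) \<alpha> (c \<alpha>))
        = (\<Sum>z\<in>V \<rightarrow>\<^sub>E configs {..<M}. \<Prod>\<alpha>\<in>A. E z \<alpha> (c \<alpha>))"
      unfolding cur_def by (rule sum_configs_Times)
    finally show ?thesis .
  qed
  have "(\<Sum>c\<in>covers V A M. potts_partition_function (V \<times> {..<M}) (A \<times> {..<M}) (cover_matrix S c) (J \<circ> fst))
    = (\<Sum>c\<in>covers V A M. 1 / ?q ^ (card V * M) * (\<Sum>z\<in>V \<rightarrow>\<^sub>E configs {..<M}. \<Prod>\<alpha>\<in>A. E z \<alpha> (c \<alpha>)))"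
    by (rule sum.cong[OF refl one])
  also have "\<dots> = 1 / ?q ^ (card V * M) * (\<Sum>z\<in>V \<rightarrow>\<^sub>E configs {..<M}. \<Sum>c\<in>covers V A M. \<Prod>\<alpha>\<in>A. E z \<alpha> (c \<alpha>))"
    unfolding sum_distrib_left[symmetric] by (subst sum.swap) (rule refl)
  also have "(\<Sum>z\<in>V \<rightarrow>\<^sub>E configs {..<M}. \<Sum>c\<in>covers V A M. \<Prod>\<alpha>\<in>A. E z \<alpha> (c \<alpha>))
      = (\<Sum>z\<in>V \<rightarrow>\<^sub>E configs {..<M}. \<Prod>\<alpha>\<in>A. \<Sum>p\<in>V \<rightarrow>\<^sub>E perms M. E z \<alpha> p)"
    unfolding covers_def using V A by (subst prod_sum_PiE) auto
  finally show ?thesis by (simp only: E_def)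
qed

lemma occurrences_component:
  fixes ys :: "nat \<Rightarrow> 'v \<Rightarrow> 'k::finite"
  assumes e: "finite e" and ys: "ys \<in> {..<M} \<rightarrow>\<^sub>E configs e"
  shows "occurrences M (\<lambda>m\<in>{..<M}. ys m i) a = (\<Sum>y\<in>{y \<in> configs e. y i = a}. occurrences M ys y)"
proof -
  have "(\<Sum>y\<in>{y \<in> configs e. y i = a}. \<Sum>m\<in>{m \<in> {m \<in> {..<M}. ys m i = a}. ys m = y}. 1)
      = (\<Sum>m\<in>{m \<in> {..<M}. ys m i = a}. 1 :: nat)"
    using e ys by (intro sum.group) auto
  moreover have "(\<Sum>y\<in>{y \<in> configs e. y i = a}. \<Sum>m\<in>{m \<in> {m \<in> {..<M}. ys m i = a}. ys m = y}. 1)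
      = (\<Sum>y\<in>{y \<in> configs e. y i = a}. occurrences M ys y)"
  proof (rule sum.cong[OF refl])
    fix y assume "y \<in> {y \<in> configs e. y i = a}"
    then have "{m \<in> {m \<in> {..<M}. ys m i = a}. ys m = y} = {m \<in> {..<M}. ys m = y}" by auto
    then show "(\<Sum>m\<in>{m \<in> {m \<in> {..<M}. ys m i = a}. ys m = y}. 1) = occurrences M ys y"
      unfolding occurrences_def by simp
  qed
  moreover have "{m \<in> {..<M}. (\<lambda>m\<in>{..<M}. ys m i) m = a} = {m \<in> {..<M}. ys m i = a}" by auto
  ultimately show ?thesis by (simp add: occurrences_def)
qed

lemma prod_over_type:
  fixes f :: "'x \<Rightarrow> real"
  assumes "finite X" "ys \<in> seqs_of_type M X t"
  shows "(\<Prod>m<M. f (ys m)) = (\<Prod>y\<in>X. f y ^ t y)"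
proof -
  have "(\<Prod>m<M. f (ys m)) = (\<Prod>y\<in>X. \<Prod>m\<in>{m \<in> {..<M}. ys m = y}. f (ys m))"
    using assms by (intro prod.group[symmetric]) (auto simp: seqs_of_type_def)
  also have "\<dots> = (\<Prod>y\<in>X. f y ^ t y)"
    using assms(2) by (intro prod.cong refl) (auto simp: seqs_of_type_def occurrences_def)
  finally show ?thesis .
qed

text \<open>Only those permutation families are kept for which the configurations seen by the
  \<open>M\<close> copies of \<open>\<alpha>\<close> form a sequence of type \<open>T\<close>. The
  condition on \<open>T\<close> says that the components of such a sequence have the types
  \<open>t i\<close> of the rows, so rearranging the \<open>z i\<close> can produce it. Every
  sequence of type \<open>T\<close> arises from equally many families and has the same product of
  potentials.\<close>

lemma column_sum_ge:
  fixes S :: "'v \<Rightarrow> 'a \<Rightarrow> 'k::{field,finite}"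
  assumes V: "finite V"
    and z: "\<And>i. i \<in> V \<Longrightarrow> z i \<in> seqs_of_type M UNIV (t i)"
    and T: "\<And>i a. i \<in> potts_edge V S \<alpha> \<Longrightarrow> (\<Sum>y\<in>{y \<in> configs (potts_edge V S \<alpha>). y i = a}. T y) = t i a"
  shows "fact M ^ card V * (real (card (seqs_of_type M (configs (potts_edge V S \<alpha>)) T))
      * (\<Prod>y\<in>configs (potts_edge V S \<alpha>). potts_psi V S J \<alpha> y ^ T y)
      / (\<Prod>i\<in>potts_edge V S \<alpha>. real (card (seqs_of_type M UNIV (t i)))))
    \<le> (\<Sum>p\<in>V \<rightarrow>\<^sub>E perms M. \<Prod>m<M. exp (J \<alpha> * delta0 (\<Sum>i\<in>V. S i \<alpha> * z i (p i m))))"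
proof -
  define e where "e = potts_edge V S \<alpha>"
  have S0: "S i \<alpha> = 0" if "i \<in> V - e" for i
    using that by (auto simp: e_def potts_edge_def)
  have eV: "e \<subseteq> V" by (auto simp: e_def potts_edge_def)
  have fe: "finite e" using eV V finite_subset by blast
  define C where "C = seqs_of_type M (configs e :: ('v \<Rightarrow> 'k) set) T"
  have fC: "finite C" unfolding C_def using fe by simp
  define \<Psi> where "\<Psi> = (\<Prod>y\<in>configs e. potts_psi V S J \<alpha> y ^ T y)"
  define G where "G p = (\<Prod>m<M. exp (J \<alpha> * delta0 (\<Sum>i\<in>V. S i \<alpha> * z i (p i m))))"
    for p :: "'v \<Rightarrow> nat \<Rightarrow> nat"
  \<comment> \<open>The choices for row \<open>i\<close> that arrange \<open>z i\<close> into the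
    corresponding component of \<open>ys\<close>; rows outside the hyperedge are free.\<close>
  define B where "B ys i = (if i \<in> e then {b \<in> perms M. \<forall>m<M. z i (b m) = ys m i} else perms M)"
    for ys :: "nat \<Rightarrow> 'v \<Rightarrow> 'k" and i
  define P where "P ys = Pi\<^sub>E V (B ys)" for ys :: "nat \<Rightarrow> 'v \<Rightarrow> 'k"
  have PQ: "P ys \<subseteq> V \<rightarrow>\<^sub>E perms M" for ys unfolding P_def B_def by (intro PiE_mono) auto
  have fP: "finite (P ys)" for ys by (rule finite_subset[OF PQ finite_perm_families[OF V]])
  have Pz: "z i (p i m) = ys m i" if "p \<in> P ys" "i \<in> e" "m < M" for p ys i m
  proof -
    have "p i \<in> B ys i" using that eV unfolding P_def by blast
    then show ?thesis using that by (simp add: B_def)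
  qed
  have cardP: "real (card (P ys)) = fact M ^ card V / (\<Prod>i\<in>e. real (card (seqs_of_type M UNIV (t i))))"
    if ys: "ys \<in> C" for ys
  proof -
    have ysE: "ys \<in> {..<M} \<rightarrow>\<^sub>E configs e" using ys by (simp add: C_def seqs_of_type_def)
    have "real (card (B ys i)) = fact M / (if i \<in> e then real (card (seqs_of_type M UNIV (t i))) else 1)"
      if i: "i \<in> V" for i
    proof (cases "i \<in> e")
      case True
      have "(\<lambda>m\<in>{..<M}. ys m i) \<in> seqs_of_type M UNIV (t i)"
      proof -
        have "occurrences M (\<lambda>m\<in>{..<M}. ys m i) a = t i a" for a
        proof -
          have "occurrences M (\<lambda>m\<in>{..<M}. ys m i) a = (\<Sum>y\<in>{y \<in> configs e. y i = a}. occurrences M ys y)"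
            by (rule occurrences_component[OF fe ysE])
          also have "\<dots> = (\<Sum>y\<in>{y \<in> configs e. y i = a}. T y)"
            using ys by (intro sum.cong refl) (auto simp: C_def seqs_of_type_def)
          also have "\<dots> = t i a" using T[of i a] True by (simp add: e_def)
          finally show ?thesis .
        qed
        then show ?thesis by (auto simp: seqs_of_type_def)
      qed
      from card_perms_onto[OF _ z[OF i] this]
      have "card {b \<in> perms M. \<forall>m<M. z i (b m) = ys m i} * card (seqs_of_type M UNIV (t i)) = fact M"
        by (simp cong: conj_cong)
      then have "real (card (B ys i) * card (seqs_of_type M UNIV (t i))) = real (fact M)"
        using True by (simp only: B_def if_True)
      then have prod: "real (card (B ys i)) * real (card (seqs_of_type M UNIV (t i))) = fact M" by simp
      have "real (card (seqs_of_type M UNIV (t i))) \<noteq> 0"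
        using z[OF i] by (auto simp: card_eq_0_iff)
      from nonzero_eq_divide_eq[OF this] prod show ?thesis using True by (simp only: if_True)
    next
      case False
      then show ?thesis by (simp add: B_def card_perms)
    qed
    then have "real (card (P ys)) = (\<Prod>i\<in>V. fact M / (if i \<in> e then real (card (seqs_of_type M UNIV (t i))) else 1))"
      unfolding P_def using V by (simp add: card_PiE)
    also have "\<dots> = fact M ^ card V / (\<Prod>i\<in>e. real (card (seqs_of_type M UNIV (t i))))"
      using V eV by (simp add: prod_dividef prod.If_cases Int_absorb1)
    finally show ?thesis .
  qed
  have GP: "G p = \<Psi>" if ys: "ys \<in> C" and p: "p \<in> P ys" for p ys
  proof -
    have "(\<Sum>i\<in>V. S i \<alpha> * z i (p i m)) = (\<Sum>i\<in>e. S i \<alpha> * ys m i)" if "m < M" for m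
    proof -
      have "(\<Sum>i\<in>V. S i \<alpha> * z i (p i m)) = (\<Sum>i\<in>e. S i \<alpha> * z i (p i m))"
        using V eV S0 by (intro sum.mono_neutral_right) auto
      also have "\<dots> = (\<Sum>i\<in>e. S i \<alpha> * ys m i)"
        using Pz[OF p] that by (intro sum.cong refl) auto
      finally show ?thesis .
    qed
    then have "G p = (\<Prod>m<M. potts_psi V S J \<alpha> (ys m))"
      unfolding G_def potts_psi_def e_def[symmetric] by (intro prod.cong) auto
    also have "\<dots> = \<Psi>"
      unfolding \<Psi>_def by (rule prod_over_type) (use ys fe in \<open>auto simp: C_def\<close>)
    finally show ?thesis .
  qed
  have disj: "P ys \<inter> P ys' = {}" if ys: "ys \<in> C" "ys' \<in> C" "ys \<noteq> ys'" for ys ys'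
  proof (rule ccontr)
    assume "P ys \<inter> P ys' \<noteq> {}"
    then obtain p where p: "p \<in> P ys" "p \<in> P ys'" by blast
    have "ys = ys'"
    proof (rule PiE_ext[of _ "{..<M}" "\<lambda>_. configs e"])
      show 1: "ys \<in> {..<M} \<rightarrow>\<^sub>E configs e" "ys' \<in> {..<M} \<rightarrow>\<^sub>E configs e"
        using ys by (auto simp: C_def seqs_of_type_def)
      fix m assume m: "m \<in> {..<M}"
      show "ys m = ys' m"
      proof (rule configs_ext[of _ e])
        show "ys m \<in> configs e" "ys' m \<in> configs e" using 1 m by auto
        show "ys m i = ys' m i" if "i \<in> e" for i
          using Pz[OF p(1) that, of m] Pz[OF p(2) that, of m] m by simp
      qed
    qed
    then show False using ys by simp
  qed
  have "fact M ^ card V * (real (card C) * \<Psi> / (\<Prod>i\<in>e. real (card (seqs_of_type M UNIV (t i)))))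
      = (\<Sum>ys\<in>C. real (card (P ys)) * \<Psi>)"
    using cardP by simp
  also have "\<dots> = (\<Sum>ys\<in>C. \<Sum>p\<in>P ys. G p)"
    using GP by (intro sum.cong refl) simp
  also have "\<dots> = (\<Sum>p\<in>(\<Union>ys\<in>C. P ys). G p)"
    by (rule sum.UNION_disjoint[symmetric]) (use fC fP disj in auto)
  also have "\<dots> \<le> (\<Sum>p\<in>V \<rightarrow>\<^sub>E perms M. G p)"
    using PQ V by (intro sum_mono2) (auto simp: G_def intro!: prod_nonneg)
  finally show ?thesis unfolding C_def \<Psi>_def G_def e_def .
qed

text \<open>The sum over row values is cut down to \<open>z\<close> whose rows have the types
  \<open>t i\<close>. For these, \<open>column_sum_ge\<close> bounds each column by a quantity that
  no longer depends on \<open>z\<close>, so the number of such \<open>z\<close> factors out.\<close>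

lemma sum_covers_potts_ge:
  fixes S :: "'v \<Rightarrow> 'a \<Rightarrow> 'k::{field,finite}"
  assumes V: "finite V" and A: "finite A"
    and t: "\<And>i. i \<in> V \<Longrightarrow> (\<Sum>a\<in>UNIV. t i a) = M"
    and T: "\<And>\<alpha> i a. \<alpha> \<in> A \<Longrightarrow> i \<in> potts_edge V S \<alpha> \<Longrightarrow>
      (\<Sum>y\<in>{y \<in> configs (potts_edge V S \<alpha>). y i = a}. T \<alpha> y) = t i a"
  shows "real (card (covers V A M)) * (1 / real CARD('k) ^ (card V * M)
      * (\<Prod>i\<in>V. real (card (seqs_of_type M UNIV (t i))))
      * (\<Prod>\<alpha>\<in>A. real (card (seqs_of_type M (configs (potts_edge V S \<alpha>)) (T \<alpha>)))
          * (\<Prod>y\<in>configs (potts_edge V S \<alpha>). potts_psi V S J \<alpha> y ^ T \<alpha> y)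
          / (\<Prod>i\<in>potts_edge V S \<alpha>. real (card (seqs_of_type M UNIV (t i))))))
    \<le> (\<Sum>c\<in>covers V A M. potts_partition_function (V \<times> {..<M}) (A \<times> {..<M}) (cover_matrix S c) (J \<circ> fst))"
proof -
  define R where "R \<alpha> = real (card (seqs_of_type M (configs (potts_edge V S \<alpha>)) (T \<alpha>)))
          * (\<Prod>y\<in>configs (potts_edge V S \<alpha>). potts_psi V S J \<alpha> y ^ T \<alpha> y)
          / (\<Prod>i\<in>potts_edge V S \<alpha>. real (card (seqs_of_type M UNIV (t i))))" for \<alpha>
  define G where "G z \<alpha> = (\<Sum>p\<in>V \<rightarrow>\<^sub>E perms M. \<Prod>m<M. exp (J \<alpha> * delta0 (\<Sum>i\<in>V. S i \<alpha> * z i (p i m))))"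
    for z :: "'v \<Rightarrow> nat \<Rightarrow> 'k" and \<alpha>
  have G0: "0 \<le> G z \<alpha>" for z \<alpha> unfolding G_def by (intro sum_nonneg prod_nonneg) auto
  have R0: "0 \<le> R \<alpha>" for \<alpha>
    unfolding R_def potts_psi_def
    by (intro divide_nonneg_nonneg mult_nonneg_nonneg prod_nonneg) auto
  define Z where "Z = Pi\<^sub>E V (\<lambda>i. seqs_of_type M UNIV (t i))"
  have Zsub: "Z \<subseteq> V \<rightarrow>\<^sub>E configs {..<M}"
    unfolding Z_def by (intro PiE_mono) (auto simp: seqs_of_type_def configs_def)
  have "real (card (covers V A M)) * ((\<Prod>i\<in>V. real (card (seqs_of_type M UNIV (t i)))) * (\<Prod>\<alpha>\<in>A. R \<alpha>))
      = (\<Sum>z\<in>Z. \<Prod>\<alpha>\<in>A. fact M ^ card V * R \<alpha>)"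
    using V A by (simp add: Z_def card_PiE card_covers prod.distrib power_mult)
  also have "\<dots> \<le> (\<Sum>z\<in>Z. \<Prod>\<alpha>\<in>A. G z \<alpha>)"
  proof (intro sum_mono prod_mono conjI)
    fix z \<alpha> assume z: "z \<in> Z" and \<alpha>: "\<alpha> \<in> A"
    show "0 \<le> fact M ^ card V * R \<alpha>" using R0 by simp
    show "fact M ^ card V * R \<alpha> \<le> G z \<alpha>"
      unfolding R_def G_def
    proof (rule column_sum_ge[OF V])
      show "z i \<in> seqs_of_type M UNIV (t i)" if "i \<in> V" for i using z that unfolding Z_def by blast
    qed (use T \<alpha> in auto)
  qed
  also have "\<dots> \<le> (\<Sum>z\<in>V \<rightarrow>\<^sub>E configs {..<M}. \<Prod>\<alpha>\<in>A. G z \<alpha>)"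
    using Zsub V G0 by (intro sum_mono2 prod_nonneg) (auto intro!: finite_PiE)
  finally have "1 / real CARD('k) ^ (card V * M) *
      (real (card (covers V A M)) * ((\<Prod>i\<in>V. real (card (seqs_of_type M UNIV (t i)))) * (\<Prod>\<alpha>\<in>A. R \<alpha>)))
    \<le> 1 / real CARD('k) ^ (card V * M) * (\<Sum>z\<in>V \<rightarrow>\<^sub>E configs {..<M}. \<Prod>\<alpha>\<in>A. G z \<alpha>)"
    by (rule mult_left_mono) simp
  then show ?thesis
    unfolding sum_covers_potts_eq[OF V A] R_def[symmetric] G_def[symmetric] by (simp add: mult_ac)
qed

section \<open>Entropy estimates\<close>

definition xlnx :: "real \<Rightarrow> real" where
  "xlnx x = x * ln x"

lemma ln_fact_ge: "real n * ln (real n) - real n \<le> ln (fact n)"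
proof (induction n)
  case (Suc n)
  show ?case
  proof (cases "n = 0")
    case False
    have "real (Suc n) = real n * (1 + 1 / real n)" using False by (simp add: field_simps)
    then have "ln (real (Suc n)) - ln (real n) = ln (1 + 1 / real n)"
      using False by (simp only:) (subst ln_mult_pos, auto intro: add_pos_nonneg)
    also have "\<dots> \<le> 1 / real n" by (rule ln_add_one_self_le_self) simp
    finally have "real n * (ln (real (Suc n)) - ln (real n)) \<le> 1" using False by (simp add: field_simps)
    moreover have "ln (fact (Suc n)) = ln (real (Suc n)) + ln (fact n)"
      unfolding fact_Suc of_nat_mult by (rule ln_mult_pos) auto
    ultimately show ?thesis using Suc by (simp add: algebra_simps)
  qed simp
qed simp

text \<open>Stirling's formula with a logarithmic error, by comparing increments. With
  \<open>n + 1\<close> inside the logarithm the error is nonnegative and increasing from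
  \<open>n = 0\<close> on, so that all letters of a type can share the error of
  \<open>M\<close>.\<close>

lemma ln_fact_le: "ln (fact n) \<le> real n * ln (real n) - real n + (1 + ln (real n + 1))"
proof -
  have "ln (fact n) \<le> real n * ln (real n) - real n + (1 + ln (real n))" if "1 \<le> n"
    using that
  proof (induction n rule: dec_induct)
    case (step n)
    have n: "0 < real n" using step by simp
    have "ln (real n) - ln (real (Suc n)) = ln (real n / real (Suc n))"
      using n by (simp add: ln_div)
    also have "\<dots> \<le> real n / real (Suc n) - 1" using n by (intro ln_le_minus_one) simp
    also have "\<dots> = - (1 / real (Suc n))" by (simp add: field_simps)
    finally have "real (Suc n) * (ln (real n) - ln (real (Suc n))) \<le> real (Suc n) * (- (1 / real (Suc n)))"
      by (intro mult_left_mono) auto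
    then have "real (Suc n) * (ln (real n) - ln (real (Suc n))) \<le> - 1" by simp
    moreover have "ln (fact (Suc n)) = ln (real (Suc n)) + ln (fact n)"
      unfolding fact_Suc of_nat_mult by (rule ln_mult_pos) auto
    ultimately show ?case using step.IH by (simp add: algebra_simps)
  qed simp
  then show ?thesis by (cases "n = 0") (auto intro: order_trans)
qed

text \<open>The size of the class is a multinomial coefficient, and the linear terms of Stirling's
  formula cancel because \<open>t\<close> sums to \<open>M\<close>. The constant collects one error
  for each letter and one for \<open>fact M\<close>.\<close>

lemma ln_card_seqs_of_type:
  fixes t :: "'x \<Rightarrow> nat" and \<tau> :: "'x \<Rightarrow> real"
  assumes X: "finite X" and t: "(\<Sum>a\<in>X. t a) = M" and M: "0 < M"
    and \<tau>: "\<And>a. a \<in> X \<Longrightarrow> real (t a) = real M * \<tau> a"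
  shows "\<bar>ln (real (card (seqs_of_type M X t))) + real M * (\<Sum>a\<in>X. xlnx (\<tau> a))\<bar>
    \<le> (real (card X) + 1) * (1 + ln (real M + 1))"
proof -
  let ?L = "1 + ln (real M + 1)"
  have L: "0 \<le> ?L" using M by simp
  have "real (card (seqs_of_type M X t) * (\<Prod>a\<in>X. fact (t a))) = real (fact M)"
    using card_seqs_of_type[OF X t] by (simp only:)
  then have "real (card (seqs_of_type M X t)) * (\<Prod>a\<in>X. fact (t a)) = fact M" by simp
  moreover have "0 < real (card (seqs_of_type M X t))" using card_seqs_of_type_pos[OF X t] by simp
  ultimately have "ln (real (card (seqs_of_type M X t))) + ln (\<Prod>a\<in>X. fact (t a) :: real) = ln (fact M)"
    by (metis ln_mult_pos prod_pos fact_gt_zero)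
  then have lnC: "ln (real (card (seqs_of_type M X t))) = ln (fact M) - (\<Sum>a\<in>X. ln (fact (t a)))"
    by (subst (asm) ln_prod) (auto simp: X)
  have sumt: "(\<Sum>a\<in>X. real (t a)) = real M" using t by (metis of_nat_sum)
  have tM: "t a \<le> M" if "a \<in> X" for a using member_le_sum[of a X t] X t that by simp
  have E: "real M * (\<Sum>a\<in>X. xlnx (\<tau> a)) = (\<Sum>a\<in>X. real (t a) * ln (real (t a))) - real M * ln (real M)"
  proof -
    have "real M * xlnx (\<tau> a) = real (t a) * ln (real (t a)) - real (t a) * ln (real M)" if "a \<in> X" for a
    proof (cases "t a = 0")
      case True
      then show ?thesis using \<tau>[OF that] M by (simp add: xlnx_def)
    next
      case False
      have "\<tau> a = real (t a) / real M" using \<tau>[OF that] M by simp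
      then have "ln (\<tau> a) = ln (real (t a)) - ln (real M)" using False M by (simp add: ln_div)
      moreover have "real M * xlnx (\<tau> a) = real (t a) * ln (\<tau> a)"
        unfolding xlnx_def \<tau>[OF that] by simp
      ultimately show ?thesis by (simp add: right_diff_distrib)
    qed
    then have "real M * (\<Sum>a\<in>X. xlnx (\<tau> a)) = (\<Sum>a\<in>X. real (t a) * ln (real (t a)) - real (t a) * ln (real M))"
      unfolding sum_distrib_left by (intro sum.cong) auto
    then show ?thesis by (simp add: sum_subtractf sumt flip: sum_distrib_right)
  qed
  have up: "(\<Sum>a\<in>X. ln (fact (t a))) \<le> (\<Sum>a\<in>X. real (t a) * ln (real (t a))) - real M + real (card X) * ?L"
  proof -
    have "(\<Sum>a\<in>X. ln (fact (t a))) \<le> (\<Sum>a\<in>X. real (t a) * ln (real (t a)) - real (t a) + ?L)"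
    proof (rule sum_mono)
      fix a assume "a \<in> X"
      then have "ln (real (t a) + 1) \<le> ln (real M + 1)" using tM by simp
      then show "ln (fact (t a)) \<le> real (t a) * ln (real (t a)) - real (t a) + ?L"
        using ln_fact_le[of "t a"] by linarith
    qed
    then show ?thesis by (simp only: sum.distrib sum_subtractf sumt sum_constant distrib_left)
  qed
  have low: "(\<Sum>a\<in>X. real (t a) * ln (real (t a))) - real M \<le> (\<Sum>a\<in>X. ln (fact (t a)))"
    unfolding sumt[symmetric] sum_subtractf[symmetric] by (intro sum_mono ln_fact_ge)
  have "real (card X) * ?L \<ge> 0" using L by simp
  then show ?thesis
    unfolding lnC E abs_le_iff using up low ln_fact_le[of M] ln_fact_ge[of M] L
    by (simp add: distrib_right) 
qed

section \<open>The Bethe functional of the Potts model\<close>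

text \<open>The logarithm of the Bethe functional with the logarithm of the quotient split: each
  hyperedge contributes its energy, its entropy and minus the entropies of its vertices. In this
  form every summand is continuous up to the boundary of the polytope and corresponds to the
  logarithm of one factor in the lower bound for covers.\<close>

definition potts_functional ::
  "'v set \<Rightarrow> 'a set \<Rightarrow> ('v \<Rightarrow> 'a \<Rightarrow> 'k::{field,finite}) \<Rightarrow> ('a \<Rightarrow> real)
    \<Rightarrow> ('v \<Rightarrow> 'k \<Rightarrow> real) \<times> ('a \<Rightarrow> ('v \<Rightarrow> 'k) \<Rightarrow> real) \<Rightarrow> real" where
  "potts_functional V A S J \<tau> = - (real (card V) * ln (real CARD('k)))
    - (\<Sum>i\<in>V. \<Sum>x\<in>UNIV. xlnx (fst \<tau> i x))
    + (\<Sum>\<alpha>\<in>A. (\<Sum>y\<in>configs (potts_edge V S \<alpha>). snd \<tau> \<alpha> y * ln (potts_psi V S J \<alpha> y))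
        - (\<Sum>y\<in>configs (potts_edge V S \<alpha>). xlnx (snd \<tau> \<alpha> y))
        + (\<Sum>i\<in>potts_edge V S \<alpha>. \<Sum>x\<in>UNIV. xlnx (fst \<tau> i x)))"

lemma potts_partition_function_pos:
  fixes S :: "'v \<Rightarrow> 'a \<Rightarrow> 'k::{field,finite}"
  assumes "finite V"
  shows "0 < potts_partition_function V A S J"
  unfolding potts_partition_function_def using assms
  by (intro sum_pos mult_pos_pos prod_pos) (auto simp: configs_def PiE_eq_empty_iff intro!: finite_PiE)

lemma finite_potts_edge: "finite V \<Longrightarrow> finite (potts_edge V S \<alpha>)"
  by (simp add: potts_edge_def)

text \<open>Where \<open>\<tau>e \<alpha> y\<close> is positive, each vertex marginal at
  \<open>y\<close> is at least as large, so the logarithm of the product splits; where it vanishes,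
  both sides are 0. Grouping the configurations of the hyperedge by their value at \<open>i\<close>
  then turns the sum of \<open>\<tau>e \<alpha> y * ln (\<tau>v i (y i))\<close> into the vertex
  term.\<close>

lemma log_bethe_value_potts:
  fixes S :: "'v \<Rightarrow> 'a \<Rightarrow> 'k::{field,finite}"
  assumes V: "finite V" and \<tau>: "\<tau> \<in> local_marginal_polytope V A (potts_edge V S)"
  shows "log_bethe_value V A (potts_edge V S) potts_phi (potts_psi V S J) \<tau> = potts_functional V A S J \<tau>"
proof -
  obtain \<tau>v \<tau>e where \<tau>ve: "\<tau> = (\<tau>v, \<tau>e)" by fastforce
  have v0: "0 \<le> \<tau>v i x" and v1: "(\<Sum>x\<in>UNIV. \<tau>v i x) = 1" if "i \<in> V" for i x
    using \<tau> that by (auto simp: \<tau>ve local_marginal_polytope_def)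
  have phi: "(\<Sum>i\<in>V. \<Sum>x\<in>UNIV. \<tau>v i x * ln (potts_phi i x)) = - (real (card V) * ln (real CARD('k)))"
  proof -
    have "(\<Sum>x\<in>UNIV. \<tau>v i x * ln (potts_phi i x)) = - ln (real CARD('k))" if "i \<in> V" for i
      unfolding potts_phi_def sum_distrib_right[symmetric] v1[OF that] by (simp add: ln_div)
    then show ?thesis by simp
  qed
  have edge: "(\<Sum>y\<in>configs (potts_edge V S \<alpha>). \<tau>e \<alpha> y * ln (\<tau>e \<alpha> y / (\<Prod>i\<in>potts_edge V S \<alpha>. \<tau>v i (y i))))
      = (\<Sum>y\<in>configs (potts_edge V S \<alpha>). xlnx (\<tau>e \<alpha> y))
        - (\<Sum>i\<in>potts_edge V S \<alpha>. \<Sum>x\<in>UNIV. xlnx (\<tau>v i x))" if \<alpha>: "\<alpha> \<in> A" for \<alpha>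
  proof -
    let ?e = "potts_edge V S \<alpha>"
    have fe: "finite ?e" using V by (rule finite_potts_edge)
    have e0: "0 \<le> \<tau>e \<alpha> y" if "y \<in> configs ?e" for y
      using \<tau> \<alpha> that by (auto simp: \<tau>ve local_marginal_polytope_def)
    have marg: "(\<Sum>y\<in>{y \<in> configs ?e. y i = x}. \<tau>e \<alpha> y) = \<tau>v i x" if "i \<in> ?e" for i x
      using \<tau> \<alpha> that by (auto simp: \<tau>ve local_marginal_polytope_def)
    have le: "\<tau>e \<alpha> y \<le> \<tau>v i (y i)" if "i \<in> ?e" "y \<in> configs ?e" for i y
      unfolding marg[OF that(1), of "y i", symmetric]
      using that fe e0 by (intro member_le_sum) auto
    have "\<tau>e \<alpha> y * ln (\<tau>e \<alpha> y / (\<Prod>i\<in>?e. \<tau>v i (y i)))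
        = xlnx (\<tau>e \<alpha> y) - (\<Sum>i\<in>?e. \<tau>e \<alpha> y * ln (\<tau>v i (y i)))" if y: "y \<in> configs ?e" for y
    proof (cases "\<tau>e \<alpha> y = 0")
      case False
      then have pos: "0 < \<tau>e \<alpha> y" using e0[OF y] by simp
      then have vpos: "0 < \<tau>v i (y i)" if "i \<in> ?e" for i using le[OF that y] by linarith
      then have "ln (\<Prod>i\<in>?e. \<tau>v i (y i)) = (\<Sum>i\<in>?e. ln (\<tau>v i (y i)))"
        by (intro ln_prod) (auto simp: fe less_imp_neq[symmetric])
      moreover have "0 < (\<Prod>i\<in>?e. \<tau>v i (y i))" using vpos by (intro prod_pos)
      ultimately show ?thesis using pos by (simp add: ln_div xlnx_def right_diff_distrib sum_distrib_left)
    qed (simp add: xlnx_def)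
    then have "(\<Sum>y\<in>configs ?e. \<tau>e \<alpha> y * ln (\<tau>e \<alpha> y / (\<Prod>i\<in>?e. \<tau>v i (y i))))
        = (\<Sum>y\<in>configs ?e. xlnx (\<tau>e \<alpha> y)) - (\<Sum>y\<in>configs ?e. \<Sum>i\<in>?e. \<tau>e \<alpha> y * ln (\<tau>v i (y i)))"
      by (simp add: sum_subtractf)
    also have "(\<Sum>y\<in>configs ?e. \<Sum>i\<in>?e. \<tau>e \<alpha> y * ln (\<tau>v i (y i)))
        = (\<Sum>i\<in>?e. \<Sum>y\<in>configs ?e. \<tau>e \<alpha> y * ln (\<tau>v i (y i)))" by (rule sum.swap)
    also have "\<dots> = (\<Sum>i\<in>?e. \<Sum>x\<in>UNIV. xlnx (\<tau>v i x))"
    proof (intro sum.cong refl)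
      fix i assume i: "i \<in> ?e"
      have "(\<Sum>y\<in>configs ?e. \<tau>e \<alpha> y * ln (\<tau>v i (y i)))
          = (\<Sum>x\<in>UNIV. \<Sum>y\<in>{y \<in> configs ?e. y i = x}. \<tau>e \<alpha> y * ln (\<tau>v i (y i)))"
        using fe by (intro sum.group[symmetric]) auto
      also have "\<dots> = (\<Sum>x\<in>UNIV. xlnx (\<tau>v i x))"
        unfolding xlnx_def using marg[OF i]
        by (intro sum.cong refl) (simp flip: sum_distrib_right)
      finally show "(\<Sum>y\<in>configs ?e. \<tau>e \<alpha> y * ln (\<tau>v i (y i))) = (\<Sum>x\<in>UNIV. xlnx (\<tau>v i x))" .
    qed
    finally show ?thesis .
  qed
  show ?thesis
    unfolding log_bethe_value_def potts_functional_def \<tau>ve prod.case fst_conv snd_conv phi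
    by (simp add: edge sum.distrib sum_subtractf xlnx_def[symmetric])
qed

text \<open>The same sum over covers is bounded below through the types \<open>M\<close> times
  \<tau> and above through the average defect. After cancelling the number of covers and taking
  logarithms, the main terms are multiples of \<open>M\<close>. The remainder consists of the
  Stirling errors of all type classes and the logarithm of the defect bound, together of order
  \<open>ln M\<close>.\<close>

lemma potts_functional_le_of_integral:
  fixes S :: "'v \<Rightarrow> 'a \<Rightarrow> 'k::{field,finite}"
  assumes V: "finite V" and A: "finite A" and J: "\<And>\<alpha>. \<alpha> \<in> A \<Longrightarrow> 0 < J \<alpha>"
    and \<tau>: "(\<tau>v, \<tau>e) \<in> local_marginal_polytope V A (potts_edge V S)" and M: "0 < M"
    and t: "\<And>i a. i \<in> V \<Longrightarrow> real (t i a) = real M * \<tau>v i a"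
    and T: "\<And>\<alpha> y. \<alpha> \<in> A \<Longrightarrow> y \<in> configs (potts_edge V S \<alpha>) \<Longrightarrow> real (T \<alpha> y) = real M * \<tau>e \<alpha> y"
  shows "real M * potts_functional V A S J (\<tau>v, \<tau>e) \<le> real M * ln (potts_partition_function V A S J)
    + (real (card V) * (real CARD('k) + 1) + (\<Sum>\<alpha>\<in>A. real (card (configs (potts_edge V S \<alpha>) :: ('v \<Rightarrow> 'k) set)) + 1
        + real (card (potts_edge V S \<alpha>)) * (real CARD('k) + 1))) * (1 + ln (real M + 1))
    + real (card A) * ln 2 + real (CARD('k) * card A) * ln (real M + 1)"
proof -
  let ?q = "real CARD('k)" and ?L = "1 + ln (real M + 1)" and ?e = "potts_edge V S"
  let ?Z = "potts_partition_function V A S J"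
  have fe: "finite (?e \<alpha>)" for \<alpha> using V by (rule finite_potts_edge)
  have eV: "?e \<alpha> \<subseteq> V" for \<alpha> by (auto simp: potts_edge_def)
  define C where "C i = real (card (seqs_of_type M UNIV (t i)))" for i
  define D where "D \<alpha> = real (card (seqs_of_type M (configs (?e \<alpha>)) (T \<alpha>)))" for \<alpha>
  define \<Psi> where "\<Psi> \<alpha> = (\<Prod>y\<in>configs (?e \<alpha>). potts_psi V S J \<alpha> y ^ T \<alpha> y)" for \<alpha>
  have v1: "(\<Sum>x\<in>UNIV. \<tau>v i x) = 1" if "i \<in> V" for i
    using \<tau> that by (auto simp: local_marginal_polytope_def)
  have e1: "(\<Sum>y\<in>configs (?e \<alpha>). \<tau>e \<alpha> y) = 1" if "\<alpha> \<in> A" for \<alpha>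
    using \<tau> that by (auto simp: local_marginal_polytope_def)
  have marg: "(\<Sum>y\<in>{y \<in> configs (?e \<alpha>). y i = x}. \<tau>e \<alpha> y) = \<tau>v i x" if "\<alpha> \<in> A" "i \<in> ?e \<alpha>" for \<alpha> i x
    using \<tau> that by (auto simp: local_marginal_polytope_def)
  have sum_t: "(\<Sum>a\<in>UNIV. t i a) = M" if "i \<in> V" for i
  proof -
    have "real (\<Sum>a\<in>UNIV. t i a) = real M * (\<Sum>a\<in>UNIV. \<tau>v i a)"
      using t[OF that] by (simp add: sum_distrib_left)
    then have "real (\<Sum>a\<in>UNIV. t i a) = real M" using v1[OF that] by (simp only: mult_1_right)
    then show ?thesis by (simp only: of_nat_eq_iff)
  qed
  have sum_T: "(\<Sum>y\<in>configs (?e \<alpha>). T \<alpha> y) = M" if "\<alpha> \<in> A" for \<alpha>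
  proof -
    have "real (\<Sum>y\<in>configs (?e \<alpha>). T \<alpha> y) = real M * (\<Sum>y\<in>configs (?e \<alpha>). \<tau>e \<alpha> y)"
      using T[OF that] by (simp add: sum_distrib_left)
    then have "real (\<Sum>y\<in>configs (?e \<alpha>). T \<alpha> y) = real M" using e1[OF that] by (simp only: mult_1_right)
    then show ?thesis by (simp only: of_nat_eq_iff)
  qed
  have sum_Ti: "(\<Sum>y\<in>{y \<in> configs (?e \<alpha>). y i = a}. T \<alpha> y) = t i a" if "\<alpha> \<in> A" "i \<in> ?e \<alpha>" for \<alpha> i a
  proof -
    have "real (\<Sum>y\<in>{y \<in> configs (?e \<alpha>). y i = a}. T \<alpha> y) = real M * (\<Sum>y\<in>{y \<in> configs (?e \<alpha>). y i = a}. \<tau>e \<alpha> y)"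
      using T[OF that(1)] by (simp add: sum_distrib_left)
    also have "\<dots> = real (t i a)" using marg[OF that, of a] t[OF subsetD[OF eV that(2)], of a] by simp
    finally show ?thesis by (simp only: of_nat_eq_iff)
  qed
  have Cpos: "0 < C i" if "i \<in> V" for i
    unfolding C_def using card_seqs_of_type_pos[OF _ sum_t[OF that]] by simp
  have Dpos: "0 < D \<alpha>" if "\<alpha> \<in> A" for \<alpha>
    unfolding D_def using card_seqs_of_type_pos[OF _ sum_T[OF that]] fe by simp
  have \<psi>pos: "0 < potts_psi V S J \<alpha> y" for \<alpha> y by (simp add: potts_psi_def)
  have \<Psi>pos: "0 < \<Psi> \<alpha>" for \<alpha> unfolding \<Psi>_def using \<psi>pos by (intro prod_pos zero_less_power) auto
  have Zpos: "0 < ?Z" using V by (rule potts_partition_function_pos)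
  have "card (covers V A M) > 0" using V A by (simp add: card_covers)
  moreover have "real (card (covers V A M)) * (1 / ?q ^ (card V * M) * (\<Prod>i\<in>V. C i)
      * (\<Prod>\<alpha>\<in>A. D \<alpha> * \<Psi> \<alpha> / (\<Prod>i\<in>?e \<alpha>. C i)))
      \<le> real (card (covers V A M)) * (2 ^ card A * real (M + 1) ^ (CARD('k) * card A)) * ?Z ^ M"
    unfolding C_def D_def \<Psi>_def
    by (rule order_trans[OF sum_covers_potts_ge[OF V A sum_t sum_Ti] sum_covers_potts_le[OF V A J]])
  ultimately have main: "1 / ?q ^ (card V * M) * (\<Prod>i\<in>V. C i) * (\<Prod>\<alpha>\<in>A. D \<alpha> * \<Psi> \<alpha> / (\<Prod>i\<in>?e \<alpha>. C i))
      \<le> 2 ^ card A * real (M + 1) ^ (CARD('k) * card A) * ?Z ^ M" (is "?l \<le> ?r")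
    by (subst (asm) mult.assoc[of "real (card (covers V A M))"]) (simp only: mult_le_cancel_left_pos of_nat_0_less_iff)
  have edgepos: "0 < (\<Prod>i\<in>?e \<alpha>. C i)" for \<alpha> using Cpos eV by (intro prod_pos) blast
  have Vpos: "0 < (\<Prod>i\<in>V. C i)" using Cpos by (rule prod_pos)
  have Apos: "0 < (\<Prod>\<alpha>\<in>A. D \<alpha> * \<Psi> \<alpha> / (\<Prod>i\<in>?e \<alpha>. C i))"
    using Dpos \<Psi>pos edgepos by (intro prod_pos[of A] divide_pos_pos mult_pos_pos) auto
  have qpos: "0 < 1 / ?q ^ (card V * M)" by simp
  have lpos: "0 < ?l" by (intro mult_pos_pos qpos Vpos Apos)
  have "ln ?l \<le> ln ?r" using main lpos by (subst ln_le_cancel_iff) auto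
  moreover have "ln ?l = - (real M * (real (card V) * ln ?q)) + (\<Sum>i\<in>V. ln (C i))
      + (\<Sum>\<alpha>\<in>A. ln (D \<alpha>) + ln (\<Psi> \<alpha>) - (\<Sum>i\<in>?e \<alpha>. ln (C i)))"
  proof -
    have aux: "ln (d * p / c) = ln d + ln p - ln c" if "0 < d" "0 < p" "0 < c" for d p c :: real
      using that by (simp add: ln_div ln_mult_pos)
    have "ln (\<Prod>\<alpha>\<in>A. D \<alpha> * \<Psi> \<alpha> / (\<Prod>i\<in>?e \<alpha>. C i)) = (\<Sum>\<alpha>\<in>A. ln (D \<alpha> * \<Psi> \<alpha> / (\<Prod>i\<in>?e \<alpha>. C i)))"
      using A Dpos \<Psi>pos edgepos by (intro ln_prod) (auto simp: less_imp_neq[symmetric])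
    also have "\<dots> = (\<Sum>\<alpha>\<in>A. ln (D \<alpha>) + ln (\<Psi> \<alpha>) - (\<Sum>i\<in>?e \<alpha>. ln (C i)))"
    proof (rule sum.cong[OF refl])
      fix \<alpha> assume \<alpha>: "\<alpha> \<in> A"
      have "ln (\<Prod>i\<in>?e \<alpha>. C i) = (\<Sum>i\<in>?e \<alpha>. ln (C i))"
        using fe Cpos eV by (intro ln_prod) (auto simp: less_imp_neq[symmetric] subset_iff)
      then show "ln (D \<alpha> * \<Psi> \<alpha> / (\<Prod>i\<in>?e \<alpha>. C i)) = ln (D \<alpha>) + ln (\<Psi> \<alpha>) - (\<Sum>i\<in>?e \<alpha>. ln (C i))"
        using aux[OF Dpos[OF \<alpha>] \<Psi>pos[of \<alpha>] edgepos[of \<alpha>]] by simp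
    qed
    finally have 1: "ln (\<Prod>\<alpha>\<in>A. D \<alpha> * \<Psi> \<alpha> / (\<Prod>i\<in>?e \<alpha>. C i))
        = (\<Sum>\<alpha>\<in>A. ln (D \<alpha>) + ln (\<Psi> \<alpha>) - (\<Sum>i\<in>?e \<alpha>. ln (C i)))" .
    have 2: "ln (\<Prod>i\<in>V. C i) = (\<Sum>i\<in>V. ln (C i))"
      using V Cpos by (intro ln_prod) (auto simp: less_imp_neq[symmetric])
    have 3: "ln (1 / ?q ^ (card V * M)) = - (real M * (real (card V) * ln ?q))"
      by (simp add: ln_div ln_realpow)
    have "ln ?l = ln (1 / ?q ^ (card V * M)) + ln (\<Prod>i\<in>V. C i) + ln (\<Prod>\<alpha>\<in>A. D \<alpha> * \<Psi> \<alpha> / (\<Prod>i\<in>?e \<alpha>. C i))"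
      by (simp only: ln_mult_pos[OF mult_pos_pos[OF qpos Vpos] Apos] ln_mult_pos[OF qpos Vpos])
    then show ?thesis using 1 2 3 by simp
  qed
  moreover have "ln ?r = real (card A) * ln 2 + real (CARD('k) * card A) * ln (real M + 1) + real M * ln ?Z"
    using Zpos by (simp add: ln_mult_pos ln_realpow add.commute)
  moreover have "real M * potts_functional V A S J (\<tau>v, \<tau>e)
      - (real (card V) * (?q + 1) + (\<Sum>\<alpha>\<in>A. real (card (configs (?e \<alpha>) :: ('v \<Rightarrow> 'k) set)) + 1
        + real (card (?e \<alpha>)) * (?q + 1))) * ?L
      \<le> - (real M * (real (card V) * ln ?q)) + (\<Sum>i\<in>V. ln (C i))
      + (\<Sum>\<alpha>\<in>A. ln (D \<alpha>) + ln (\<Psi> \<alpha>) - (\<Sum>i\<in>?e \<alpha>. ln (C i)))"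
  proof -
    define HV where "HV i = (\<Sum>x\<in>UNIV. xlnx (\<tau>v i x))" for i
    define HE where "HE \<alpha> = (\<Sum>y\<in>configs (?e \<alpha>). xlnx (\<tau>e \<alpha> y))" for \<alpha>
    define EN where "EN \<alpha> = (\<Sum>y\<in>configs (?e \<alpha>). \<tau>e \<alpha> y * ln (potts_psi V S J \<alpha> y))" for \<alpha>
    have lnC: "\<bar>ln (C i) + real M * HV i\<bar> \<le> (?q + 1) * ?L" if "i \<in> V" for i
      unfolding C_def HV_def using ln_card_seqs_of_type[OF _ sum_t[OF that] M, of "\<tau>v i"] t[OF that] by simp
    have lnD: "\<bar>ln (D \<alpha>) + real M * HE \<alpha>\<bar> \<le> (real (card (configs (?e \<alpha>) :: ('v \<Rightarrow> 'k) set)) + 1) * ?L"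
      if "\<alpha> \<in> A" for \<alpha>
      unfolding D_def HE_def using fe by (intro ln_card_seqs_of_type sum_T[OF that] M T[OF that]) auto
    have ln\<Psi>: "ln (\<Psi> \<alpha>) = real M * EN \<alpha>" if "\<alpha> \<in> A" for \<alpha>
    proof -
      have "ln (\<Psi> \<alpha>) = (\<Sum>y\<in>configs (?e \<alpha>). ln (potts_psi V S J \<alpha> y ^ T \<alpha> y))"
        unfolding \<Psi>_def using fe \<psi>pos by (intro ln_prod) (auto simp: less_imp_neq[symmetric])
      also have "\<dots> = (\<Sum>y\<in>configs (?e \<alpha>). real M * (\<tau>e \<alpha> y * ln (potts_psi V S J \<alpha> y)))"
        using T[OF that] \<psi>pos by (intro sum.cong refl) (simp add: ln_realpow)
      finally show ?thesis by (simp add: EN_def sum_distrib_left)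
    qed
    have s1: "(\<Sum>i\<in>V. - (real M * HV i)) - real (card V) * (?q + 1) * ?L \<le> (\<Sum>i\<in>V. ln (C i))"
    proof -
      have "(\<Sum>i\<in>V. - (real M * HV i) - (?q + 1) * ?L) \<le> (\<Sum>i\<in>V. ln (C i))"
      proof (rule sum_mono)
        fix i assume "i \<in> V"
        from lnC[OF this] show "- (real M * HV i) - (?q + 1) * ?L \<le> ln (C i)" by linarith
      qed
      then show ?thesis by (simp add: sum_subtractf mult.assoc)
    qed
    have s2: "real M * (EN \<alpha> - HE \<alpha> + (\<Sum>i\<in>?e \<alpha>. HV i))
        - (real (card (configs (?e \<alpha>) :: ('v \<Rightarrow> 'k) set)) + 1 + real (card (?e \<alpha>)) * (?q + 1)) * ?L
        \<le> ln (D \<alpha>) + ln (\<Psi> \<alpha>) - (\<Sum>i\<in>?e \<alpha>. ln (C i))" if \<alpha>: "\<alpha> \<in> A" for \<alpha>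
    proof -
      have "(\<Sum>i\<in>?e \<alpha>. ln (C i)) \<le> (\<Sum>i\<in>?e \<alpha>. - (real M * HV i) + (?q + 1) * ?L)"
      proof (rule sum_mono)
        fix i assume "i \<in> ?e \<alpha>"
        then have "i \<in> V" using eV by blast
        from lnC[OF this] show "ln (C i) \<le> - (real M * HV i) + (?q + 1) * ?L" by linarith
      qed
      also have "\<dots> = - (real M * (\<Sum>i\<in>?e \<alpha>. HV i)) + real (card (?e \<alpha>)) * (?q + 1) * ?L"
        by (simp add: sum.distrib sum_subtractf sum_negf sum_distrib_left mult.assoc)
      finally show ?thesis
        using lnD[OF \<alpha>] ln\<Psi>[OF \<alpha>] by (simp add: algebra_simps abs_le_iff)
    qed
    have "(\<Sum>\<alpha>\<in>A. real M * (EN \<alpha> - HE \<alpha> + (\<Sum>i\<in>?e \<alpha>. HV i))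
        - (real (card (configs (?e \<alpha>) :: ('v \<Rightarrow> 'k) set)) + 1 + real (card (?e \<alpha>)) * (?q + 1)) * ?L)
        \<le> (\<Sum>\<alpha>\<in>A. ln (D \<alpha>) + ln (\<Psi> \<alpha>) - (\<Sum>i\<in>?e \<alpha>. ln (C i)))"
      by (rule sum_mono[OF s2])
    then have s3: "real M * (\<Sum>\<alpha>\<in>A. EN \<alpha> - HE \<alpha> + (\<Sum>i\<in>?e \<alpha>. HV i))
        - (\<Sum>\<alpha>\<in>A. real (card (configs (?e \<alpha>) :: ('v \<Rightarrow> 'k) set)) + 1 + real (card (?e \<alpha>)) * (?q + 1)) * ?L
        \<le> (\<Sum>\<alpha>\<in>A. ln (D \<alpha>) + ln (\<Psi> \<alpha>) - (\<Sum>i\<in>?e \<alpha>. ln (C i)))"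
      by (simp only: sum_subtractf sum_distrib_left sum_distrib_right)
    have F: "potts_functional V A S J (\<tau>v, \<tau>e) = - (real (card V) * ln ?q) - (\<Sum>i\<in>V. HV i)
        + (\<Sum>\<alpha>\<in>A. EN \<alpha> - HE \<alpha> + (\<Sum>i\<in>?e \<alpha>. HV i))"
      by (simp only: potts_functional_def HV_def HE_def EN_def fst_conv snd_conv)
    have s1': "- (real M * (\<Sum>i\<in>V. HV i)) - real (card V) * (?q + 1) * ?L \<le> (\<Sum>i\<in>V. ln (C i))"
      using s1 by (simp only: sum_negf sum_distrib_left)
    show ?thesis
      unfolding F distrib_right distrib_left right_diff_distrib
      using s1' s3 by (simp only: distrib_right distrib_left right_diff_distrib)
  qed
  ultimately show ?thesis by linarith
qed

text \<open>Divide by \<open>k * D\<close> and let \<open>k\<close> grow. The hypothesis concerns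
  multiples of \<open>D\<close> because \<open>D\<close> will be a common denominator of a rational
  point, which makes those multiples admissible cover degrees.\<close>

lemma nonpos_of_log_growth:
  fixes x a b :: real
  assumes D: "0 < D" and le: "\<And>k. 0 < k \<Longrightarrow> real (k * D) * x \<le> a + b * ln (real (k * D) + 1)" and b: "0 \<le> b"
  shows "x \<le> 0"
proof -
  define s where "s k = Suc k * D" for k
  have s: "strict_mono s" unfolding s_def strict_mono_def using D by simp
  have "(\<lambda>n. (a + b * ln 2) * (1 / real n) + b * (ln (real n) / real n)) \<longlonglongrightarrow> (a + b * ln 2) * 0 + b * 0"
    by (intro tendsto_intros lim_1_over_n)
  then have "(\<lambda>n. (a + b * ln 2) * (1 / real n) + b * (ln (real n) / real n)) \<longlonglongrightarrow> 0" by simp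
  from LIMSEQ_subseq_LIMSEQ[OF this s]
  have lim: "(\<lambda>k. (a + b * ln 2) * (1 / real (s k)) + b * (ln (real (s k)) / real (s k))) \<longlonglongrightarrow> 0"
    by (simp add: comp_def)
  have "x \<le> (a + b * ln 2) * (1 / real (s k)) + b * (ln (real (s k)) / real (s k))" for k
  proof -
    have "1 \<le> s k" using D by (simp add: s_def Suc_le_eq)
    then have sk: "1 \<le> real (s k)" by simp
    have "ln (real (s k) + 1) \<le> ln (2 * real (s k))" using sk by simp
    also have "\<dots> = ln 2 + ln (real (s k))" using sk by (simp add: ln_mult_pos)
    finally have "b * ln (real (s k) + 1) \<le> b * (ln 2 + ln (real (s k)))" using b by (rule mult_left_mono)
    then have "real (s k) * x \<le> a + b * (ln 2 + ln (real (s k)))"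
      using le[of "Suc k"] by (simp add: s_def)
    then have "x \<le> (a + b * (ln 2 + ln (real (s k)))) / real (s k)"
      using sk by (simp add: pos_le_divide_eq mult.commute)
    then show ?thesis by (simp add: add_divide_distrib distrib_left)
  qed
  then show ?thesis using lim by (intro LIMSEQ_le_const[OF lim]) auto
qed

lemma common_denominator:
  assumes "finite F" "\<And>x. x \<in> F \<Longrightarrow> x \<in> \<rat> \<and> 0 \<le> (x::real)"
  shows "\<exists>D>0. \<forall>x\<in>F. \<exists>n. real D * x = real n"
  using assms
proof (induction F rule: finite_induct)
  case (insert x F)
  then obtain D where D: "0 < D" "\<forall>x\<in>F. \<exists>n. real D * x = real n" by blast
  obtain m n :: nat where n: "n \<noteq> 0" "\<bar>x\<bar> = real m / real n"
    using Rats_abs_nat_div_natE[of x] insert.prems by blast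
  then have x: "x = real m / real n" using insert.prems by simp
  have "\<exists>k. real (D * n) * y = real k" if "y \<in> insert x F" for y
  proof (cases "y = x")
    case True
    then have "real (D * n) * y = real (D * m)" using n x by simp
    then show ?thesis by blast
  next
    case False
    then have "y \<in> F" using that by simp
    then obtain k where "real D * y = real k" using D(2) by metis
    then have "real (D * n) * y = real (n * k)" by simp
    then show ?thesis by (rule exI)
  qed
  then show ?case using D n by (intro exI[of _ "D * n"]) auto
qed auto

lemma potts_functional_le_of_rational:
  fixes S :: "'v \<Rightarrow> 'a \<Rightarrow> 'k::{field,finite}"
  assumes V: "finite V" and A: "finite A" and J: "\<And>\<alpha>. \<alpha> \<in> A \<Longrightarrow> 0 < J \<alpha>"
    and \<tau>: "(\<tau>v, \<tau>e) \<in> local_marginal_polytope V A (potts_edge V S)"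
    and rv: "\<And>i a. i \<in> V \<Longrightarrow> \<tau>v i a \<in> \<rat>"
    and re: "\<And>\<alpha> y. \<alpha> \<in> A \<Longrightarrow> y \<in> configs (potts_edge V S \<alpha>) \<Longrightarrow> \<tau>e \<alpha> y \<in> \<rat>"
  shows "potts_functional V A S J (\<tau>v, \<tau>e) \<le> ln (potts_partition_function V A S J)"
proof -
  define F where "F = (\<Union>i\<in>V. range (\<tau>v i)) \<union> (\<Union>\<alpha>\<in>A. \<tau>e \<alpha> ` configs (potts_edge V S \<alpha>))"
  have "finite F" unfolding F_def using V A by (auto simp: finite_potts_edge)
  moreover have "x \<in> \<rat> \<and> 0 \<le> x" if "x \<in> F" for x
    using that \<tau> rv re unfolding F_def by (auto simp: local_marginal_polytope_def)
  ultimately obtain D where D: "0 < D" "\<forall>x\<in>F. \<exists>n. real D * x = real n"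
    using common_denominator[of F] by blast
  \<comment> \<open>The counts are written as floors to make them natural numbers; at multiples of
    the common denominator the floors are exact.\<close>
  have ex: "real (k * D) * x = real (nat \<lfloor>real (k * D) * x\<rfloor>)" if x: "x \<in> F" for x and k :: nat
  proof -
    obtain n where "real D * x = real n" using D x by blast
    then have "real (k * D) * x = real (k * n)" by simp
    then show ?thesis by (simp only: floor_of_nat nat_int)
  qed
  define b where "b = real (card V) * (real CARD('k) + 1) + (\<Sum>\<alpha>\<in>A. real (card (configs (potts_edge V S \<alpha>) :: ('v \<Rightarrow> 'k) set)) + 1
        + real (card (potts_edge V S \<alpha>)) * (real CARD('k) + 1))"
  have b0: "0 \<le> b" unfolding b_def by (intro add_nonneg_nonneg sum_nonneg mult_nonneg_nonneg) auto
  let ?d = "potts_functional V A S J (\<tau>v, \<tau>e) - ln (potts_partition_function V A S J)"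
  have "?d \<le> 0"
  proof (rule nonpos_of_log_growth[OF D(1)])
    show "0 \<le> b + real (CARD('k) * card A)" using b0 by simp
    fix k :: nat assume k: "0 < k"
    have "real (k * D) * potts_functional V A S J (\<tau>v, \<tau>e) \<le> real (k * D) * ln (potts_partition_function V A S J)
      + b * (1 + ln (real (k * D) + 1)) + real (card A) * ln 2 + real (CARD('k) * card A) * ln (real (k * D) + 1)"
      unfolding b_def
    proof (rule potts_functional_le_of_integral[OF V A J \<tau>, where t = "\<lambda>i a. nat \<lfloor>real (k * D) * \<tau>v i a\<rfloor>"
          and T = "\<lambda>\<alpha> y. nat \<lfloor>real (k * D) * \<tau>e \<alpha> y\<rfloor>"])
      show "0 < k * D" using k D by simp
      show "real (nat \<lfloor>real (k * D) * \<tau>v i a\<rfloor>) = real (k * D) * \<tau>v i a" if "i \<in> V" for i a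
        using that by (intro ex[symmetric]) (auto simp: F_def)
      show "real (nat \<lfloor>real (k * D) * \<tau>e \<alpha> y\<rfloor>) = real (k * D) * \<tau>e \<alpha> y"
        if "\<alpha> \<in> A" "y \<in> configs (potts_edge V S \<alpha>)" for \<alpha> y
        using that by (intro ex[symmetric]) (auto simp: F_def)
    qed
    then show "real (k * D) * ?d \<le> (b + real (card A) * ln 2) + (b + real (CARD('k) * card A)) * ln (real (k * D) + 1)"
      unfolding right_diff_distrib distrib_right distrib_left by linarith
  qed
  then show ?thesis by simp
qed

text \<open>Away from 0 this is calculus. At 0 it follows from
  \<open>\<bar>y * ln y\<bar> \<le> 2 * sqrt y\<close> on the unit interval, which is
  \<open>ln u \<le> u - 1\<close> at \<open>u = 1 / sqrt y\<close>.\<close>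

lemma continuous_on_xlnx: "continuous_on {0..} xlnx"
  unfolding continuous_on_eq_continuous_within
proof
  fix x :: real assume x: "x \<in> {0..}"
  show "continuous (at x within {0..}) xlnx"
  proof (cases "x = 0")
    case False
    then have "isCont xlnx x" unfolding xlnx_def using x by (intro continuous_intros) auto
    then show ?thesis by (rule continuous_at_imp_continuous_at_within)
  next
    case True
    have bound: "norm (xlnx y) \<le> 2 * sqrt y" if "0 \<le> y" "y \<le> 1" for y
    proof (cases "y = 0")
      case False
      then have y: "0 < y" using that by simp
      have "ln (1 / sqrt y) \<le> 1 / sqrt y - 1" using y by (intro ln_le_minus_one) simp
      also have "\<dots> \<le> 1 / sqrt y" by simp
      finally have "- ln (sqrt y) \<le> 1 / sqrt y" using y by (simp add: ln_div)
      then have "- ln y \<le> 2 / sqrt y" using y by (simp add: ln_sqrt)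
      then have "y * (- ln y) \<le> y * (2 / sqrt y)" using y by (intro mult_left_mono) auto
      also have "\<dots> = 2 * (y / sqrt y)" by simp
      also have "\<dots> = 2 * sqrt y" using y by (simp only: real_div_sqrt less_imp_le)
      finally have "y * (- ln y) \<le> 2 * sqrt y" .
      moreover have "ln y \<le> 0" using y that by simp
      ultimately show ?thesis using y by (simp add: xlnx_def abs_mult)
    qed (simp add: xlnx_def)
    have ev: "\<forall>\<^sub>F y in at 0 within {0..}. norm (xlnx y) \<le> 2 * sqrt y"
    proof -
      have "\<forall>\<^sub>F y in at 0 within {0..}. (y::real) \<in> {..<1}"
        by (rule eventually_at_topological[THEN iffD2]) (auto intro!: exI[of _ "{..<1::real}"])
      moreover have "\<forall>\<^sub>F y in at 0 within {0..}. (y::real) \<in> {0..}"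
        by (simp add: eventually_at_filter)
      ultimately show ?thesis by eventually_elim (use bound in auto)
    qed
    have "((\<lambda>y::real. 2 * sqrt y) \<longlongrightarrow> 2 * sqrt 0) (at 0 within {0..})"
      by (intro tendsto_intros)
    then have "((\<lambda>y::real. 2 * sqrt y) \<longlongrightarrow> 0) (at 0 within {0..})" by simp
    from Lim_null_comparison[OF ev this] have "(xlnx \<longlongrightarrow> 0) (at 0 within {0..})" .
    moreover have "xlnx 0 = 0" by (simp add: xlnx_def)
    ultimately show ?thesis unfolding True continuous_within by (simp only:)
  qed
qed

section \<open>Rational points of the local marginal polytope\<close>

lemma sum_configs_prod:
  fixes h :: "'v \<Rightarrow> 'k::finite \<Rightarrow> real"
  assumes "finite e"
  shows "(\<Sum>y\<in>configs e. \<Prod>j\<in>e. h j (y j)) = (\<Prod>j\<in>e. \<Sum>a\<in>UNIV. h j a)"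
  unfolding configs_def using assms by (subst prod_sum_PiE) auto

lemma sum_configs_prod_fixed:
  fixes h :: "'v \<Rightarrow> 'k::finite \<Rightarrow> real"
  assumes e: "finite e" and i: "i \<in> e"
  shows "(\<Sum>y\<in>{y \<in> configs e. y i = x}. \<Prod>j\<in>e. h j (y j)) = h i x * (\<Prod>j\<in>e - {i}. \<Sum>a\<in>UNIV. h j a)"
proof -
  define B where "B j = (if j = i then {x} else (UNIV :: 'k set))" for j
  have "{y \<in> configs e. y i = x} = Pi\<^sub>E e B"
  proof (intro equalityI subsetI)
    fix y assume "y \<in> {y \<in> configs e. y i = x}"
    then show "y \<in> Pi\<^sub>E e B" by (auto simp: configs_def B_def PiE_iff)
  next
    fix y assume y: "y \<in> Pi\<^sub>E e B"
    then have "y i \<in> B i" using i by blast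
    then show "y \<in> {y \<in> configs e. y i = x}" using y by (auto simp: configs_def B_def PiE_iff)
  qed
  then have "(\<Sum>y\<in>{y \<in> configs e. y i = x}. \<Prod>j\<in>e. h j (y j)) = (\<Prod>j\<in>e. \<Sum>a\<in>B j. h j a)"
    using e by (subst prod_sum_PiE) (auto simp: B_def)
  also have "\<dots> = h i x * (\<Prod>j\<in>e - {i}. \<Sum>a\<in>B j. h j a)"
    using e i by (simp add: prod.remove[of e i] B_def)
  also have "(\<Prod>j\<in>e - {i}. \<Sum>a\<in>B j. h j a) = (\<Prod>j\<in>e - {i}. \<Sum>a\<in>UNIV. h j a)"
    by (intro prod.cong) (auto simp: B_def)
  finally show ?thesis .
qed

text \<open>
  Round \<open>N \<tau>\<close> down, put the missing vertex mass on the letter 0, and spread the residual of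
  each hyperedge by the product coupling of its residual vertex marginals \<open>r\<close> of total mass \<open>R\<close>.
\<close>

lemma rational_approximation:
  fixes \<tau>v :: "'v \<Rightarrow> 'k::{field,finite} \<Rightarrow> real" and \<tau>e :: "'a \<Rightarrow> ('v \<Rightarrow> 'k) \<Rightarrow> real"
  assumes V: "finite V" and e: "\<And>\<alpha>. \<alpha> \<in> A \<Longrightarrow> e \<alpha> \<subseteq> V"
    and \<tau>: "(\<tau>v, \<tau>e) \<in> local_marginal_polytope V A e" and N: "0 < N"
  obtains \<sigma>v \<sigma>e where "(\<sigma>v, \<sigma>e) \<in> local_marginal_polytope V A e"
    "\<And>i x. i \<in> V \<Longrightarrow> \<sigma>v i x \<in> \<rat> \<and> \<bar>\<sigma>v i x - \<tau>v i x\<bar> \<le> (1 + real CARD('k)) / real N"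
    "\<And>\<alpha> y. \<alpha> \<in> A \<Longrightarrow> y \<in> configs (e \<alpha>) \<Longrightarrow> \<sigma>e \<alpha> y \<in> \<rat>
      \<and> \<bar>\<sigma>e \<alpha> y - \<tau>e \<alpha> y\<bar> \<le> (1 + real (card (configs (e \<alpha>) :: ('v \<Rightarrow> 'k) set))) / real N"
proof -
  have fe: "finite (e \<alpha>)" if "\<alpha> \<in> A" for \<alpha> using e[OF that] V finite_subset by blast
  have v0: "0 \<le> \<tau>v i x" and v1: "(\<Sum>x\<in>UNIV. \<tau>v i x) = 1" if "i \<in> V" for i x
    using \<tau> that by (auto simp: local_marginal_polytope_def)
  have e0: "0 \<le> \<tau>e \<alpha> y" if "\<alpha> \<in> A" "y \<in> configs (e \<alpha>)" for \<alpha> y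
    using \<tau> that by (auto simp: local_marginal_polytope_def)
  have e1: "(\<Sum>y\<in>configs (e \<alpha>). \<tau>e \<alpha> y) = 1" if "\<alpha> \<in> A" for \<alpha>
    using \<tau> that by (auto simp: local_marginal_polytope_def)
  have marg: "(\<Sum>y\<in>{y \<in> configs (e \<alpha>). y i = x}. \<tau>e \<alpha> y) = \<tau>v i x" if "\<alpha> \<in> A" "i \<in> e \<alpha>" for \<alpha> i x
    using \<tau> that by (auto simp: local_marginal_polytope_def)
  define fl where "fl i x = real_of_int \<lfloor>real N * \<tau>v i x\<rfloor>" for i x
  define t where "t i x = fl i x + (if x = 0 then real N - (\<Sum>a\<in>UNIV. fl i a) else 0)" for i x
  define T where "T \<alpha> y = real_of_int \<lfloor>real N * \<tau>e \<alpha> y\<rfloor>" for \<alpha> y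
  define s where "s \<alpha> i x = (\<Sum>y\<in>{y \<in> configs (e \<alpha>). y i = x}. T \<alpha> y)" for \<alpha> i x
  define r where "r \<alpha> i x = t i x - s \<alpha> i x" for \<alpha> i x
  define R where "R \<alpha> = real N - (\<Sum>y\<in>configs (e \<alpha>). T \<alpha> y)" for \<alpha>
  \<comment> \<open>The quotients by \<open>R\<close> are probability distributions, whence the
    outer factor \<open>R\<close>. That factor also makes \<open>P\<close> vanish when
    \<open>R \<alpha> = 0\<close>. For an empty hyperedge the product is 1, and the whole residual
    goes to the empty configuration.\<close>
  define P where "P \<alpha> y = R \<alpha> * (\<Prod>i\<in>e \<alpha>. r \<alpha> i (y i) / R \<alpha>)" for \<alpha> y
  define \<sigma>v where "\<sigma>v i x = t i x / real N" for i x
  define \<sigma>e where "\<sigma>e \<alpha> y = (T \<alpha> y + P \<alpha> y) / real N" for \<alpha> y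
  have fl_le: "fl i x \<le> real N * \<tau>v i x" and fl_ge: "real N * \<tau>v i x - 1 \<le> fl i x" for i x
    unfolding fl_def by linarith+
  have T_le: "T \<alpha> y \<le> real N * \<tau>e \<alpha> y" and T_ge: "real N * \<tau>e \<alpha> y - 1 \<le> T \<alpha> y" for \<alpha> y
    unfolding T_def by linarith+
  have T0: "0 \<le> T \<alpha> y" if "\<alpha> \<in> A" "y \<in> configs (e \<alpha>)" for \<alpha> y
    using e0[OF that] by (simp add: T_def)
  have fl_sum: "0 \<le> real N - (\<Sum>a\<in>UNIV. fl i a)" "real N - (\<Sum>a\<in>UNIV. fl i a) \<le> real CARD('k)"
    if i: "i \<in> V" for i
  proof -
    have "(\<Sum>a\<in>UNIV. fl i a) \<le> (\<Sum>a\<in>UNIV. real N * \<tau>v i a)" by (intro sum_mono fl_le)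
    then show "0 \<le> real N - (\<Sum>a\<in>UNIV. fl i a)" using v1[OF i] by (simp flip: sum_distrib_left)
    have "(\<Sum>a\<in>UNIV. real N * \<tau>v i a - 1) \<le> (\<Sum>a\<in>UNIV. fl i a)" by (intro sum_mono fl_ge)
    then show "real N - (\<Sum>a\<in>UNIV. fl i a) \<le> real CARD('k)"
      using v1[OF i] by (simp add: sum_subtractf flip: sum_distrib_left)
  qed
  have R0: "0 \<le> R \<alpha>" and R_le: "R \<alpha> \<le> real (card (configs (e \<alpha>) :: ('v \<Rightarrow> 'k) set))" if \<alpha>: "\<alpha> \<in> A" for \<alpha>
  proof -
    have "(\<Sum>y\<in>configs (e \<alpha>). T \<alpha> y) \<le> (\<Sum>y\<in>configs (e \<alpha>). real N * \<tau>e \<alpha> y)" by (intro sum_mono T_le)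
    then show "0 \<le> R \<alpha>" using e1[OF \<alpha>] by (simp add: R_def flip: sum_distrib_left)
    have "(\<Sum>y\<in>configs (e \<alpha>). real N * \<tau>e \<alpha> y - 1) \<le> (\<Sum>y\<in>configs (e \<alpha>). T \<alpha> y)" by (intro sum_mono T_ge)
    then show "R \<alpha> \<le> real (card (configs (e \<alpha>) :: ('v \<Rightarrow> 'k) set))"
      using e1[OF \<alpha>] by (simp add: R_def sum_subtractf flip: sum_distrib_left)
  qed
  have t_sum: "(\<Sum>x\<in>UNIV. t i x) = real N" for i
    unfolding t_def by (simp add: sum.distrib)
  have t_ge: "fl i x \<le> t i x" if "i \<in> V" for i x using fl_sum(1)[OF that] by (simp add: t_def)
  \<comment> \<open>The vertex marginal \<open>s\<close> of the rounded hyperedge counts is an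
    integer that is at most \<open>N * \<tau>v i x\<close>, hence at most its floor. Rounding down
    therefore leaves a nonnegative residual for every letter, as a coupling requires.\<close>
  have r0: "0 \<le> r \<alpha> i x" if \<alpha>: "\<alpha> \<in> A" and i: "i \<in> e \<alpha>" for \<alpha> i x
  proof -
    have "s \<alpha> i x \<le> (\<Sum>y\<in>{y \<in> configs (e \<alpha>). y i = x}. real N * \<tau>e \<alpha> y)"
      unfolding s_def by (intro sum_mono T_le)
    also have "\<dots> = real N * \<tau>v i x" using marg[OF \<alpha> i] by (simp flip: sum_distrib_left)
    finally have "s \<alpha> i x \<le> real N * \<tau>v i x" .
    moreover have "s \<alpha> i x = real_of_int (\<Sum>y\<in>{y \<in> configs (e \<alpha>). y i = x}. \<lfloor>real N * \<tau>e \<alpha> y\<rfloor>)"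
      by (simp add: s_def T_def)
    ultimately have "s \<alpha> i x \<le> fl i x" unfolding fl_def by (simp only: of_int_le_iff le_floor_iff)
    then show ?thesis using t_ge[of i x] i e[OF \<alpha>] unfolding r_def by fastforce
  qed
  have r_sum: "(\<Sum>x\<in>UNIV. r \<alpha> i x) = R \<alpha>" if \<alpha>: "\<alpha> \<in> A" for \<alpha> i
  proof -
    have "(\<Sum>x\<in>UNIV. s \<alpha> i x) = (\<Sum>y\<in>configs (e \<alpha>). T \<alpha> y)"
      unfolding s_def using fe[OF \<alpha>] by (intro sum.group) auto
    then show ?thesis by (simp add: r_def R_def sum_subtractf t_sum)
  qed
  have rR: "(\<Sum>x\<in>UNIV. r \<alpha> i x / R \<alpha>) = 1" if "\<alpha> \<in> A" "R \<alpha> \<noteq> 0" for \<alpha> i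
    using r_sum[OF that(1)] that(2) by (simp flip: sum_divide_distrib)
  have P_sum: "(\<Sum>y\<in>configs (e \<alpha>). P \<alpha> y) = R \<alpha>" if \<alpha>: "\<alpha> \<in> A" for \<alpha>
    unfolding P_def sum_distrib_left[symmetric] 
      sum_configs_prod[OF fe[OF \<alpha>], where h = "\<lambda>i x. r \<alpha> i x / R \<alpha>"]
    using rR[OF \<alpha>] by (cases "R \<alpha> = 0") auto
  have P_marg: "(\<Sum>y\<in>{y \<in> configs (e \<alpha>). y i = x}. P \<alpha> y) = r \<alpha> i x" if \<alpha>: "\<alpha> \<in> A" and i: "i \<in> e \<alpha>" for \<alpha> i x
  proof (cases "R \<alpha> = 0")
    case True
    then have "(\<Sum>x\<in>UNIV. r \<alpha> i x) = 0" using r_sum[OF \<alpha>] by simp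
    then have "r \<alpha> i x = 0" using r0[OF \<alpha> i] by (simp add: sum_nonneg_eq_0_iff)
    then show ?thesis using True by (simp add: P_def)
  next
    case False
    then show ?thesis
      unfolding P_def sum_distrib_left[symmetric] 
        sum_configs_prod_fixed[OF fe[OF \<alpha>] i, where x = x and h = "\<lambda>i x. r \<alpha> i x / R \<alpha>"]
      using rR[OF \<alpha> False] by simp
  qed
  have P0: "0 \<le> P \<alpha> y" if "\<alpha> \<in> A" for \<alpha> y
    unfolding P_def using R0[OF that] r0[OF that] by (intro mult_nonneg_nonneg prod_nonneg) auto
  have P_le: "P \<alpha> y \<le> R \<alpha>" if \<alpha>: "\<alpha> \<in> A" and y: "y \<in> configs (e \<alpha>)" for \<alpha> y
    unfolding P_sum[OF \<alpha>, symmetric] using P0[OF \<alpha>] y fe[OF \<alpha>] by (intro member_le_sum) auto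
  have fl_Rats: "fl i x \<in> \<rat>" and T_Rats: "T \<alpha> y \<in> \<rat>" for i x \<alpha> y
    by (simp_all add: fl_def T_def)
  have sum_fl_Rats: "(\<Sum>a\<in>UNIV. fl i a) \<in> \<rat>" and sum_T_Rats: "(\<Sum>y\<in>Y. T \<alpha> y) \<in> \<rat>" for i \<alpha> Y
    by (simp_all add: fl_def T_def flip: of_int_sum)
  have t_Rats: "t i x \<in> \<rat>" for i x
    unfolding t_def using fl_Rats sum_fl_Rats by (auto intro!: Rats_add Rats_diff)
  show thesis
  proof (rule that)
    show "(\<sigma>v, \<sigma>e) \<in> local_marginal_polytope V A e"
      unfolding local_marginal_polytope_def
    proof (clarsimp, intro conjI ballI allI)
      show "0 \<le> \<sigma>v i x" if "i \<in> V" for i x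
      proof -
        have "0 \<le> fl i x" using v0[OF that] by (simp add: fl_def)
        then show ?thesis using t_ge[OF that, of x] by (simp add: \<sigma>v_def)
      qed
      show "0 \<le> \<sigma>e \<alpha> y" if "\<alpha> \<in> A" "y \<in> configs (e \<alpha>)" for \<alpha> y
        using T0[OF that] P0[OF that(1)] by (simp add: \<sigma>e_def)
      show "(\<Sum>x\<in>UNIV. \<sigma>v i x) = 1" for i
        unfolding \<sigma>v_def sum_divide_distrib[symmetric] t_sum using N by simp
      show "(\<Sum>y\<in>configs (e \<alpha>). \<sigma>e \<alpha> y) = 1" if "\<alpha> \<in> A" for \<alpha>
        unfolding \<sigma>e_def sum_divide_distrib[symmetric] sum.distrib P_sum[OF that] using N by (simp add: R_def)
      show "(\<Sum>y | y \<in> configs (e \<alpha>) \<and> y i = x. \<sigma>e \<alpha> y) = \<sigma>v i x" if "\<alpha> \<in> A" "i \<in> e \<alpha>" for \<alpha> i x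
        unfolding \<sigma>e_def \<sigma>v_def sum_divide_distrib[symmetric] sum.distrib P_marg[OF that]
        by (simp add: r_def s_def)
    qed
    show "\<sigma>v i x \<in> \<rat> \<and> \<bar>\<sigma>v i x - \<tau>v i x\<bar> \<le> (1 + real CARD('k)) / real N" if "i \<in> V" for i x
    proof
      show "\<sigma>v i x \<in> \<rat>" using t_Rats by (simp add: \<sigma>v_def)
      \<comment> \<open>At most 1 is lost by the floor, and at most \<open>CARD('k)\<close> is moved
        to the letter 0.\<close>
      have "\<bar>t i x - real N * \<tau>v i x\<bar> \<le> 1 + real CARD('k)"
      proof -
        have "t i x = fl i x \<or> t i x = fl i x + (real N - (\<Sum>a\<in>UNIV. fl i a))" by (simp add: t_def)
        then show ?thesis using fl_sum[OF that] fl_le[of i x] fl_ge[of i x] by linarith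
      qed
      moreover have "\<sigma>v i x - \<tau>v i x = (t i x - real N * \<tau>v i x) / real N"
        using N by (simp add: \<sigma>v_def field_simps)
      ultimately show "\<bar>\<sigma>v i x - \<tau>v i x\<bar> \<le> (1 + real CARD('k)) / real N"
        using N by (simp add: divide_right_mono)
    qed
    show "\<sigma>e \<alpha> y \<in> \<rat> \<and> \<bar>\<sigma>e \<alpha> y - \<tau>e \<alpha> y\<bar> \<le> (1 + real (card (configs (e \<alpha>) :: ('v \<Rightarrow> 'k) set))) / real N"
      if \<alpha>: "\<alpha> \<in> A" and y: "y \<in> configs (e \<alpha>)" for \<alpha> y
    proof
      have prod_Rats: "(\<Prod>i\<in>F. f i) \<in> \<rat>" if "\<And>i. f i \<in> \<rat>" for F :: "'v set" and f :: "'v \<Rightarrow> real"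
        using that by (induction F rule: infinite_finite_induct) auto
      have "r \<alpha> i x \<in> \<rat>" for i x
        unfolding r_def s_def by (intro Rats_diff t_Rats sum_T_Rats)
      moreover have "R \<alpha> \<in> \<rat>" unfolding R_def by (intro Rats_diff sum_T_Rats) auto
      ultimately show "\<sigma>e \<alpha> y \<in> \<rat>"
        unfolding \<sigma>e_def P_def by (intro Rats_divide Rats_add Rats_mult prod_Rats T_Rats) auto
      have "\<bar>T \<alpha> y + P \<alpha> y - real N * \<tau>e \<alpha> y\<bar> \<le> 1 + real (card (configs (e \<alpha>) :: ('v \<Rightarrow> 'k) set))"
        using T_le[of \<alpha> y] T_ge[of \<alpha> y] P0[OF \<alpha>, of y] P_le[OF \<alpha> y] R_le[OF \<alpha>] by linarith
      moreover have "\<sigma>e \<alpha> y - \<tau>e \<alpha> y = (T \<alpha> y + P \<alpha> y - real N * \<tau>e \<alpha> y) / real N"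
        using N by (simp add: \<sigma>e_def field_simps)
      ultimately show "\<bar>\<sigma>e \<alpha> y - \<tau>e \<alpha> y\<bar> \<le> (1 + real (card (configs (e \<alpha>) :: ('v \<Rightarrow> 'k) set))) / real N"
        using N by (simp add: divide_right_mono)
    qed
  qed
qed

section \<open>Passage to all points of the polytope and to all nonnegative couplings\<close>

lemma tendsto_xlnx:
  assumes "(f \<longlongrightarrow> l) F" "0 \<le> l" "\<And>n. 0 \<le> f n"
  shows "((\<lambda>n. xlnx (f n)) \<longlongrightarrow> xlnx l) F"
  using assms by (intro continuous_on_tendsto_compose[OF continuous_on_xlnx]) auto

lemma LIMSEQ_of_abs_diff_le:
  fixes f :: "nat \<Rightarrow> real"
  assumes "\<And>n. \<bar>f n - l\<bar> \<le> c / real (Suc n)"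
  shows "f \<longlonglongrightarrow> l"
proof -
  have "(\<lambda>n. c * inverse (real (Suc n))) \<longlonglongrightarrow> c * 0"
    by (intro tendsto_intros LIMSEQ_inverse_real_of_nat)
  then have "(\<lambda>n. c / real (Suc n)) \<longlonglongrightarrow> 0" by (simp add: divide_inverse)
  then have "(\<lambda>n. f n - l) \<longlonglongrightarrow> 0"
    by (rule Lim_null_comparison[rotated]) (use assms in auto)
  then show ?thesis by (simp add: LIM_zero_iff)
qed

lemma potts_functional_le_pos:
  fixes S :: "'v \<Rightarrow> 'a \<Rightarrow> 'k::{field,finite}"
  assumes V: "finite V" and A: "finite A" and J: "\<And>\<alpha>. \<alpha> \<in> A \<Longrightarrow> 0 < J \<alpha>"
    and \<tau>: "(\<tau>v, \<tau>e) \<in> local_marginal_polytope V A (potts_edge V S)"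
  shows "potts_functional V A S J (\<tau>v, \<tau>e) \<le> ln (potts_partition_function V A S J)"
proof -
  let ?L = "local_marginal_polytope V A (potts_edge V S)"
  have eV: "potts_edge V S \<alpha> \<subseteq> V" for \<alpha> by (auto simp: potts_edge_def)
  have "\<exists>\<sigma>. \<sigma> \<in> ?L \<and> (\<forall>i\<in>V. \<forall>x. fst \<sigma> i x \<in> \<rat> \<and> \<bar>fst \<sigma> i x - \<tau>v i x\<bar> \<le> (1 + real CARD('k)) / real (Suc n))
      \<and> (\<forall>\<alpha>\<in>A. \<forall>y\<in>configs (potts_edge V S \<alpha>). snd \<sigma> \<alpha> y \<in> \<rat>
        \<and> \<bar>snd \<sigma> \<alpha> y - \<tau>e \<alpha> y\<bar> \<le> (1 + real (card (configs (potts_edge V S \<alpha>) :: ('v \<Rightarrow> 'k) set))) / real (Suc n))" for n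
  proof (rule rational_approximation[OF V eV \<tau>, where N = "Suc n"])
    fix \<sigma>v \<sigma>e
    assume "(\<sigma>v, \<sigma>e) \<in> ?L"
      "\<And>i x. i \<in> V \<Longrightarrow> \<sigma>v i x \<in> \<rat> \<and> \<bar>\<sigma>v i x - \<tau>v i x\<bar> \<le> (1 + real CARD('k)) / real (Suc n)"
      "\<And>\<alpha> y. \<alpha> \<in> A \<Longrightarrow> y \<in> configs (potts_edge V S \<alpha>) \<Longrightarrow> \<sigma>e \<alpha> y \<in> \<rat>
        \<and> \<bar>\<sigma>e \<alpha> y - \<tau>e \<alpha> y\<bar> \<le> (1 + real (card (configs (potts_edge V S \<alpha>) :: ('v \<Rightarrow> 'k) set))) / real (Suc n)"
    then show ?thesis by (intro exI[of _ "(\<sigma>v, \<sigma>e)"]) (simp del: of_nat_Suc)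
  qed simp
  then obtain \<sigma> where \<sigma>: "\<And>n. \<sigma> n \<in> ?L"
    "\<And>n i x. i \<in> V \<Longrightarrow> fst (\<sigma> n) i x \<in> \<rat> \<and> \<bar>fst (\<sigma> n) i x - \<tau>v i x\<bar> \<le> (1 + real CARD('k)) / real (Suc n)"
    "\<And>n \<alpha> y. \<alpha> \<in> A \<Longrightarrow> y \<in> configs (potts_edge V S \<alpha>) \<Longrightarrow> snd (\<sigma> n) \<alpha> y \<in> \<rat>
        \<and> \<bar>snd (\<sigma> n) \<alpha> y - \<tau>e \<alpha> y\<bar> \<le> (1 + real (card (configs (potts_edge V S \<alpha>) :: ('v \<Rightarrow> 'k) set))) / real (Suc n)"
    by metis
  have limv: "(\<lambda>n. fst (\<sigma> n) i x) \<longlonglongrightarrow> \<tau>v i x" if "i \<in> V" for i x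
    by (rule LIMSEQ_of_abs_diff_le) (use \<sigma>(2)[OF that] in blast)
  have lime: "(\<lambda>n. snd (\<sigma> n) \<alpha> y) \<longlonglongrightarrow> \<tau>e \<alpha> y" if "\<alpha> \<in> A" "y \<in> configs (potts_edge V S \<alpha>)" for \<alpha> y
    by (rule LIMSEQ_of_abs_diff_le) (use \<sigma>(3)[OF that] in blast)
  have xv: "(\<lambda>n. xlnx (fst (\<sigma> n) i x)) \<longlonglongrightarrow> xlnx (\<tau>v i x)" if "i \<in> V" for i x
    using \<tau> \<sigma>(1) that by (intro tendsto_xlnx limv) (auto simp: local_marginal_polytope_def case_prod_beta)
  have xe: "(\<lambda>n. xlnx (snd (\<sigma> n) \<alpha> y)) \<longlonglongrightarrow> xlnx (\<tau>e \<alpha> y)"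
    if "\<alpha> \<in> A" "y \<in> configs (potts_edge V S \<alpha>)" for \<alpha> y
    using \<tau> \<sigma>(1) that by (intro tendsto_xlnx lime) (auto simp: local_marginal_polytope_def case_prod_beta)
  have "(\<lambda>n. potts_functional V A S J (\<sigma> n)) \<longlonglongrightarrow> potts_functional V A S J (\<tau>v, \<tau>e)"
    unfolding potts_functional_def fst_conv snd_conv
    using eV by (intro tendsto_intros xv xe lime) auto
  moreover have "potts_functional V A S J (\<sigma> n) \<le> ln (potts_partition_function V A S J)" for n
  proof -
    have "(fst (\<sigma> n), snd (\<sigma> n)) \<in> ?L" using \<sigma>(1) by simp
    from potts_functional_le_of_rational[OF V A J this] \<sigma>(2,3) show ?thesis by simp
  qed
  ultimately show ?thesis by (intro LIMSEQ_le_const2) auto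
qed

text \<open>Adding \<open>\<epsilon> n\<close> to every coupling restores strict positivity. For
  fixed \<tau>, both sides are continuous in the couplings.\<close>

lemma potts_functional_le:
  fixes S :: "'v \<Rightarrow> 'a \<Rightarrow> 'k::{field,finite}"
  assumes V: "finite V" and A: "finite A" and J: "\<And>\<alpha>. \<alpha> \<in> A \<Longrightarrow> 0 \<le> J \<alpha>"
    and \<tau>: "\<tau> \<in> local_marginal_polytope V A (potts_edge V S)"
  shows "potts_functional V A S J \<tau> \<le> ln (potts_partition_function V A S J)"
proof -
  define \<epsilon> where "\<epsilon> n = inverse (real (Suc n))" for n
  have \<epsilon>: "\<epsilon> \<longlonglongrightarrow> 0" unfolding \<epsilon>_def by (rule LIMSEQ_inverse_real_of_nat)
  have J\<epsilon>: "(\<lambda>n. J \<alpha> + \<epsilon> n) \<longlonglongrightarrow> J \<alpha>" for \<alpha>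
    using tendsto_add[OF tendsto_const \<epsilon>, of "J \<alpha>"] by simp
  have F: "(\<lambda>n. potts_functional V A S (\<lambda>\<alpha>. J \<alpha> + \<epsilon> n) \<tau>) \<longlonglongrightarrow> potts_functional V A S J \<tau>"
    unfolding potts_functional_def potts_psi_def ln_exp by (intro tendsto_intros J\<epsilon>)
  have "(\<lambda>n. potts_partition_function V A S (\<lambda>\<alpha>. J \<alpha> + \<epsilon> n)) \<longlonglongrightarrow> potts_partition_function V A S J"
    unfolding potts_partition_function_def by (intro tendsto_intros J\<epsilon>)
  then have Z: "(\<lambda>n. ln (potts_partition_function V A S (\<lambda>\<alpha>. J \<alpha> + \<epsilon> n))) \<longlonglongrightarrow> ln (potts_partition_function V A S J)"
    using potts_partition_function_pos[OF V, of A S J] by (intro tendsto_ln) auto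
  have "potts_functional V A S (\<lambda>\<alpha>. J \<alpha> + \<epsilon> n) \<tau> \<le> ln (potts_partition_function V A S (\<lambda>\<alpha>. J \<alpha> + \<epsilon> n))" for n
  proof -
    have "0 < J \<alpha> + \<epsilon> n" if "\<alpha> \<in> A" for \<alpha>
      using J[OF that] by (intro add_nonneg_pos) (simp_all add: \<epsilon>_def)
    moreover have "(fst \<tau>, snd \<tau>) \<in> local_marginal_polytope V A (potts_edge V S)" using \<tau> by simp
    ultimately show ?thesis
      using potts_functional_le_pos[OF V A, of "\<lambda>\<alpha>. J \<alpha> + \<epsilon> n" "fst \<tau>" "snd \<tau>" S] by simp
  qed
  then show ?thesis by (intro LIMSEQ_le[OF F Z]) auto
qed

section \<open>Existence of the maxima\<close>

lemma closed_Collect_ball: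
  "(\<And>i. i \<in> I \<Longrightarrow> closed {x. P i x}) \<Longrightarrow> closed {x. \<forall>i\<in>I. P i x}"
  unfolding Collect_ball_eq by (rule closed_INT) auto

lemma continuous_on_fst_coordinate: "continuous_on T (\<lambda>\<tau>. fst \<tau> i x)"
  by (rule continuous_on_product_then_coordinatewise[OF continuous_on_product_then_coordinatewise[OF
        continuous_on_fst[OF continuous_on_id]]])

lemma continuous_on_snd_coordinate: "continuous_on T (\<lambda>\<tau>. snd \<tau> \<alpha> y)"
  by (rule continuous_on_product_then_coordinatewise[OF continuous_on_product_then_coordinatewise[OF
        continuous_on_snd[OF continuous_on_id]]])

lemma compact_fun_box:
  fixes S :: "'a \<Rightarrow> 'b::topological_space set"
  assumes "\<And>i. compact (S i)"
  shows "compact {f. \<forall>i. f i \<in> S i}"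
proof -
  have "compactin (product_topology (\<lambda>i. euclidean) UNIV) (Pi\<^sub>E UNIV S)"
    unfolding compactin_PiE using assms by simp
  then show ?thesis by (simp add: euclidean_product_topology PiE_UNIV_domain Pi_def)
qed

text \<open>Coordinates outside \<open>V\<close>, \<open>A\<close> and the configurations of the
  hyperedges are unconstrained in both polytopes, so \<open>C\<close> need not be bounded. Setting
  them to 0 stays in \<open>C\<close> by \<open>restr\<close>, leaves the functional unchanged and
  lands in a product of unit intervals and singletons, which is compact by Tychonoff's theorem even
  over infinite index types.\<close>

lemma potts_functional_attains_max:
  fixes S :: "'v \<Rightarrow> 'a \<Rightarrow> 'k::{field,finite}"
  assumes V: "finite V" and A: "finite A"
    and C: "closed C" "C \<noteq> {}" "C \<subseteq> local_marginal_polytope V A (potts_edge V S)"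
    and restr: "\<And>\<tau>. \<tau> \<in> C \<Longrightarrow> (\<lambda>i x. if i \<in> V then fst \<tau> i x else 0,
      \<lambda>\<alpha> y. if \<alpha> \<in> A \<and> y \<in> configs (potts_edge V S \<alpha>) then snd \<tau> \<alpha> y else 0) \<in> C"
  shows "\<exists>\<tau>\<in>C. \<forall>\<sigma>\<in>C. potts_functional V A S J \<sigma> \<le> potts_functional V A S J \<tau>"
proof -
  let ?e = "potts_edge V S"
  have fe: "finite (?e \<alpha>)" for \<alpha> using V by (rule finite_potts_edge)
  have eV: "?e \<alpha> \<subseteq> V" for \<alpha> by (auto simp: potts_edge_def)
  define Bv where "Bv = {f :: 'v \<Rightarrow> 'k \<Rightarrow> real. \<forall>i. f i \<in> {g. \<forall>x. g x \<in> (if i \<in> V then {0..1} else {0})}}"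
  define Be where "Be = {f :: 'a \<Rightarrow> ('v \<Rightarrow> 'k) \<Rightarrow> real.
    \<forall>\<alpha>. f \<alpha> \<in> {g. \<forall>y. g y \<in> (if \<alpha> \<in> A \<and> y \<in> configs (?e \<alpha>) then {0..1} else {0})}}"
  have "compact Bv" unfolding Bv_def by (intro compact_fun_box) auto
  moreover have "compact Be" unfolding Be_def by (intro compact_fun_box) auto
  ultimately have "compact (C \<inter> Bv \<times> Be)" by (intro closed_Int_compact C compact_Times)
  define res where "res \<tau> = (\<lambda>i x. if i \<in> V then fst \<tau> i x else 0,
      \<lambda>\<alpha> y. if \<alpha> \<in> A \<and> y \<in> configs (?e \<alpha>) then snd \<tau> \<alpha> y else 0)"
    for \<tau> :: "('v \<Rightarrow> 'k \<Rightarrow> real) \<times> ('a \<Rightarrow> ('v \<Rightarrow> 'k) \<Rightarrow> real)"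
  have res: "res \<tau> \<in> C \<inter> Bv \<times> Be" if \<tau>: "\<tau> \<in> C" for \<tau>
  proof -
    have L: "\<tau> \<in> local_marginal_polytope V A ?e" using \<tau> C by blast
    have "0 \<le> fst \<tau> i x \<and> fst \<tau> i x \<le> 1" if "i \<in> V" for i x
    proof -
      have nn: "0 \<le> fst \<tau> i z" and "(\<Sum>z\<in>UNIV. fst \<tau> i z) = 1" for z
        using L that by (auto simp: local_marginal_polytope_def case_prod_beta)
      moreover have "fst \<tau> i x \<le> (\<Sum>z\<in>UNIV. fst \<tau> i z)" by (rule member_le_sum) (use nn in auto)
      ultimately show ?thesis by simp
    qed
    moreover have "0 \<le> snd \<tau> \<alpha> y \<and> snd \<tau> \<alpha> y \<le> 1" if "\<alpha> \<in> A" "y \<in> configs (?e \<alpha>)" for \<alpha> y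
    proof -
      have nn: "0 \<le> snd \<tau> \<alpha> z" if "z \<in> configs (?e \<alpha>)" for z
        using L that \<open>\<alpha> \<in> A\<close> by (auto simp: local_marginal_polytope_def case_prod_beta)
      have "(\<Sum>z\<in>configs (?e \<alpha>). snd \<tau> \<alpha> z) = 1"
        using L that by (auto simp: local_marginal_polytope_def case_prod_beta)
      moreover have "snd \<tau> \<alpha> y \<le> (\<Sum>z\<in>configs (?e \<alpha>). snd \<tau> \<alpha> z)"
        by (rule member_le_sum) (use nn that fe in auto)
      ultimately show ?thesis using nn[OF that(2)] by simp
    qed
    ultimately have "res \<tau> \<in> Bv \<times> Be" by (simp add: res_def Bv_def Be_def)
    then show ?thesis using restr[OF \<tau>] by (simp add: res_def)
  qed
  have F_res: "potts_functional V A S J (res \<tau>) = potts_functional V A S J \<tau>" for \<tau>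
    unfolding potts_functional_def res_def fst_conv snd_conv using eV
    by (intro arg_cong2[where f = "(+)"] arg_cong2[where f = "(-)"] sum.cong refl) auto
  have xv: "continuous_on (C \<inter> Bv \<times> Be) (\<lambda>\<tau>. xlnx (fst \<tau> i x))" for i x
    by (rule continuous_on_compose2[OF continuous_on_xlnx continuous_on_fst_coordinate]) (cases "i \<in> V"; auto simp: Bv_def)
  have xe: "continuous_on (C \<inter> Bv \<times> Be) (\<lambda>\<tau>. xlnx (snd \<tau> \<alpha> y))" for \<alpha> y
    by (rule continuous_on_compose2[OF continuous_on_xlnx continuous_on_snd_coordinate]) (cases "\<alpha> \<in> A \<and> y \<in> configs (?e \<alpha>)"; auto simp: Be_def)
  have "continuous_on (C \<inter> Bv \<times> Be) (potts_functional V A S J)"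
    unfolding potts_functional_def by (intro continuous_intros xv xe continuous_on_snd_coordinate)
  moreover have "C \<inter> Bv \<times> Be \<noteq> {}" using C(2) res by blast
  ultimately obtain \<tau> where "\<tau> \<in> C \<inter> Bv \<times> Be"
    "\<forall>\<sigma>\<in>C \<inter> Bv \<times> Be. potts_functional V A S J \<sigma> \<le> potts_functional V A S J \<tau>"
    using continuous_attains_sup[OF \<open>compact (C \<inter> Bv \<times> Be)\<close>] by blast
  then show ?thesis using res F_res by (metis IntD1)
qed

lemma closed_local_marginal_polytope:
  fixes e :: "'a \<Rightarrow> 'v set"
  shows "closed (local_marginal_polytope V A e :: (('v \<Rightarrow> 'k::finite \<Rightarrow> real) \<times> ('a \<Rightarrow> ('v \<Rightarrow> 'k) \<Rightarrow> real)) set)"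
    and "closed (mean_field_points V A e :: (('v \<Rightarrow> 'k::finite \<Rightarrow> real) \<times> ('a \<Rightarrow> ('v \<Rightarrow> 'k) \<Rightarrow> real)) set)"
proof -
  note cv = continuous_on_fst_coordinate and ce = continuous_on_snd_coordinate
  show 1: "closed (local_marginal_polytope V A e :: (('v \<Rightarrow> 'k \<Rightarrow> real) \<times> ('a \<Rightarrow> ('v \<Rightarrow> 'k) \<Rightarrow> real)) set)"
    unfolding local_marginal_polytope_def case_prod_beta
    by (intro closed_Collect_conj closed_Collect_ball closed_Collect_all closed_Collect_le closed_Collect_eq
        continuous_on_sum cv ce continuous_on_const)
  have "closed {\<tau> :: ('v \<Rightarrow> 'k \<Rightarrow> real) \<times> ('a \<Rightarrow> ('v \<Rightarrow> 'k) \<Rightarrow> real).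
      \<forall>\<alpha>\<in>A. \<forall>x\<in>configs (e \<alpha>). snd \<tau> \<alpha> x = (\<Prod>i\<in>e \<alpha>. fst \<tau> i (x i))}"
    by (intro closed_Collect_ball closed_Collect_eq continuous_on_prod cv ce)
  with 1 show "closed (mean_field_points V A e :: (('v \<Rightarrow> 'k \<Rightarrow> real) \<times> ('a \<Rightarrow> ('v \<Rightarrow> 'k) \<Rightarrow> real)) set)"
    unfolding mean_field_points_def Collect_conj_eq by (auto intro: closed_Int)
qed

text \<open>A witness that both domains of maximisation are nonempty, as every mean-field point lies
  in the polytope.\<close>

lemma uniform_in_mean_field_points:
  fixes V :: "'v set" and A :: "'a set"
  assumes e: "\<And>\<alpha>. \<alpha> \<in> A \<Longrightarrow> finite (e \<alpha>)"
  shows "(\<lambda>i x. 1 / real CARD('k::{field,finite}), \<lambda>\<alpha> y. \<Prod>i\<in>e \<alpha>. 1 / real CARD('k))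
    \<in> (mean_field_points V A e :: (('v \<Rightarrow> 'k \<Rightarrow> real) \<times> ('a \<Rightarrow> ('v \<Rightarrow> 'k) \<Rightarrow> real)) set)"
proof -
  have "(\<Sum>y\<in>(configs (e \<alpha>) :: ('v \<Rightarrow> 'k) set). \<Prod>i\<in>e \<alpha>. 1 / real CARD('k)) = 1" if "\<alpha> \<in> A" for \<alpha>
    using sum_configs_prod[OF e[OF that], of "\<lambda>_ _ :: 'k. 1 / real CARD('k)"] by simp
  moreover have "(\<Sum>y\<in>{y \<in> configs (e \<alpha>). y i = x}. \<Prod>i\<in>e \<alpha>. 1 / real CARD('k)) = 1 / real CARD('k)"
    if "\<alpha> \<in> A" "i \<in> e \<alpha>" for \<alpha> i and x :: 'k
    using sum_configs_prod_fixed[OF e[OF that(1)] that(2), where x = x and h = "\<lambda>_ _ :: 'k. 1 / real CARD('k)"] by simp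
  ultimately show ?thesis
    by (auto simp: mean_field_points_def local_marginal_polytope_def intro!: prod_nonneg)
qed

lemma restrict_in_local_marginal_polytope:
  assumes "\<And>\<alpha>. \<alpha> \<in> A \<Longrightarrow> e \<alpha> \<subseteq> V" "\<tau> \<in> local_marginal_polytope V A e"
  shows "(\<lambda>i x. if i \<in> V then fst \<tau> i x else 0,
      \<lambda>\<alpha> y. if \<alpha> \<in> A \<and> y \<in> configs (e \<alpha>) then snd \<tau> \<alpha> y else 0) \<in> local_marginal_polytope V A e"
proof -
  have "(\<Sum>y\<in>{y \<in> configs (e \<alpha>). y i = x}. if \<alpha> \<in> A \<and> y \<in> configs (e \<alpha>) then snd \<tau> \<alpha> y else 0)
      = (\<Sum>y\<in>{y \<in> configs (e \<alpha>). y i = x}. snd \<tau> \<alpha> y)" if "\<alpha> \<in> A" for \<alpha> i x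
    using that by (intro sum.cong) auto
  moreover have "(\<Sum>y\<in>configs (e \<alpha>). if \<alpha> \<in> A \<and> y \<in> configs (e \<alpha>) then snd \<tau> \<alpha> y else 0)
      = (\<Sum>y\<in>configs (e \<alpha>). snd \<tau> \<alpha> y)" if "\<alpha> \<in> A" for \<alpha>
    using that by (intro sum.cong) auto
  ultimately show ?thesis
    using assms unfolding local_marginal_polytope_def case_prod_beta by fastforce
qed

lemma restrict_in_mean_field_points:
  assumes "\<And>\<alpha>. \<alpha> \<in> A \<Longrightarrow> e \<alpha> \<subseteq> V" "\<tau> \<in> mean_field_points V A e"
  shows "(\<lambda>i x. if i \<in> V then fst \<tau> i x else 0,
      \<lambda>\<alpha> y. if \<alpha> \<in> A \<and> y \<in> configs (e \<alpha>) then snd \<tau> \<alpha> y else 0) \<in> mean_field_points V A e"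
proof -
  have "(\<Prod>i\<in>e \<alpha>. if i \<in> V then fst \<tau> i (y i) else 0) = (\<Prod>i\<in>e \<alpha>. fst \<tau> i (y i))" if "\<alpha> \<in> A" for \<alpha> y
    using assms(1)[OF that] by (intro prod.cong) auto
  then show ?thesis
    using assms(2) restrict_in_local_marginal_polytope[of A e V \<tau>] assms(1)
    by (simp add: mean_field_points_def)
qed

text \<open>The potentials are positive, so \<open>bethe_value\<close> takes its exponential
  branch.\<close>

lemma bethe_value_potts:
  fixes S :: "'v \<Rightarrow> 'a \<Rightarrow> 'k::{field,finite}"
  assumes "finite V" "\<tau> \<in> local_marginal_polytope V A (potts_edge V S)"
  shows "bethe_value V A (potts_edge V S) potts_phi (potts_psi V S J) \<tau> = exp (potts_functional V A S J \<tau>)"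
  unfolding bethe_value_def log_bethe_value_potts[OF assms] by (simp add: potts_phi_def potts_psi_def)

theorem theorem5p6:
  fixes V :: "'v set" and A :: "'a set"
    and S :: "'v \<Rightarrow> 'a \<Rightarrow> 'k::{field,finite}"
    and J :: "'a \<Rightarrow> real"
  assumes "finite V" and "finite A"
    and "\<And>\<alpha>. \<alpha> \<in> A \<Longrightarrow> 0 \<le> J \<alpha>"
  shows "potts_partition_function V A S J \<ge> potts_bethe V A S J
       \<and> potts_bethe V A S J \<ge> potts_mean_field V A S J"
proof -
  note V = assms(1) and A = assms(2) and J = assms(3)
  let ?e = "potts_edge V S" and ?F = "potts_functional V A S J"
  let ?val = "bethe_value V A ?e potts_phi (potts_psi V S J)"
  let ?L = "local_marginal_polytope V A ?e :: (('v \<Rightarrow> 'k \<Rightarrow> real) \<times> ('a \<Rightarrow> ('v \<Rightarrow> 'k) \<Rightarrow> real)) set"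
  let ?M = "mean_field_points V A ?e :: (('v \<Rightarrow> 'k \<Rightarrow> real) \<times> ('a \<Rightarrow> ('v \<Rightarrow> 'k) \<Rightarrow> real)) set"
  have eV: "?e \<alpha> \<subseteq> V" for \<alpha> by (auto simp: potts_edge_def)
  have mf_sub: "?M \<subseteq> ?L" by (auto simp: mean_field_points_def)
  have M_ne: "?M \<noteq> {}" 
    by (rule ex_in_conv[THEN iffD1], rule exI, rule uniform_in_mean_field_points, rule finite_potts_edge[OF V])
  have val: "?val \<tau> = exp (?F \<tau>)" if "\<tau> \<in> ?L" for \<tau> by (rule bethe_value_potts[OF V that])
  have L_ne: "?L \<noteq> {}" using M_ne mf_sub by auto
  \<comment> \<open>\<open>GREATEST\<close> can be evaluated only at an attained maximum, so a
    maximiser is produced for each of the two domains.\<close>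
  have "\<exists>\<tau>\<in>?L. \<forall>\<sigma>\<in>?L. ?F \<sigma> \<le> ?F \<tau>"
    by (rule potts_functional_attains_max[OF V A closed_local_marginal_polytope(1) L_ne order_refl
          restrict_in_local_marginal_polytope[OF eV]])
  then obtain \<tau> where \<tau>: "\<tau> \<in> ?L" "\<And>\<sigma>. \<sigma> \<in> ?L \<Longrightarrow> ?F \<sigma> \<le> ?F \<tau>" by blast
  have "\<exists>\<mu>\<in>?M. \<forall>\<sigma>\<in>?M. ?F \<sigma> \<le> ?F \<mu>"
    by (rule potts_functional_attains_max[OF V A closed_local_marginal_polytope(2) M_ne mf_sub
          restrict_in_mean_field_points[OF eV]])
  then obtain \<mu> where \<mu>: "\<mu> \<in> ?M" "\<And>\<sigma>. \<sigma> \<in> ?M \<Longrightarrow> ?F \<sigma> \<le> ?F \<mu>" by blast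
  have \<mu>L: "\<mu> \<in> ?L" using \<mu>(1) mf_sub by blast
  have bethe: "potts_bethe V A S J = exp (?F \<tau>)"
    unfolding potts_bethe_def bethe_partition_function_def
  proof (rule Greatest_equality)
    show "\<exists>\<sigma>\<in>?L. exp (?F \<tau>) = ?val \<sigma>" using \<tau>(1) val by metis
    show "z \<le> exp (?F \<tau>)" if "\<exists>\<sigma>\<in>?L. z = ?val \<sigma>" for z
    proof -
      from that obtain \<sigma> where \<sigma>: "\<sigma> \<in> ?L" "z = ?val \<sigma>" by (rule bexE)
      then have "z = exp (?F \<sigma>)" using val[OF \<sigma>(1)] by simp
      then show ?thesis using \<tau>(2)[OF \<sigma>(1)] by simp
    qed
  qed
  have mf: "potts_mean_field V A S J = exp (?F \<mu>)"
    unfolding potts_mean_field_def mean_field_partition_function_def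
  proof (rule Greatest_equality)
    show "\<exists>\<sigma>\<in>?M. exp (?F \<mu>) = ?val \<sigma>" using \<mu>(1) val[OF \<mu>L] by metis
    show "z \<le> exp (?F \<mu>)" if "\<exists>\<sigma>\<in>?M. z = ?val \<sigma>" for z
    proof -
      from that obtain \<sigma> where \<sigma>: "\<sigma> \<in> ?M" "z = ?val \<sigma>" by (rule bexE)
      then have "z = exp (?F \<sigma>)" using val[OF subsetD[OF mf_sub \<sigma>(1)]] by simp
      then show ?thesis using \<mu>(2)[OF \<sigma>(1)] by simp
    qed
  qed
  have "exp (?F \<tau>) \<le> exp (ln (potts_partition_function V A S J))"
    using potts_functional_le[OF V A J \<tau>(1)] by simp
  also have "\<dots> = potts_partition_function V A S J"
    using potts_partition_function_pos[OF V] by simp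
  finally have "potts_bethe V A S J \<le> potts_partition_function V A S J" by (simp only: bethe)
  moreover have "potts_mean_field V A S J \<le> potts_bethe V A S J"
    unfolding bethe mf using \<tau>(2)[OF \<mu>L] by simp
  ultimately show ?thesis by simp
qed

end
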